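(* Let $\mathcal{G}$ be a class of measurable functions from $\mathbb{R}$ to $\mathbb{R}$ and, for $\eta>0$, let $\mathcal{G}_\eta=\{g(\cdot+t):|t|\le\eta,\ g\in\mathcal{G}\}$. Suppose that, for some $\eta>0$, $\mathcal{G}_\eta$ is ($F$-)Donsker and has envelope $V\in L_2(F)$ satisfying $$\int(V(y+s)-V(y))^2f(y)\,dy\to0\quad\text{as }s\to0.$$ If $$\sup_{g\in\mathcal{G}}\Big|n^{1/2}\int g(y)\big(f*k_{b_n}(y)-f(y)\big)\,dy\Big|\to0,$$ then $$\sup_{g\in\mathcal{G}}\Big|\int g(y)\hat f(y)\,dy-\frac1n\sum_{i=1}^ng(\varepsilon_i)\Big|=o_p(n^{-1/2}),$$ and the smoothed empirical process $\{n^{1/2}\int g(y)(\hat f(y)-f(y))\,dy:g\in\mathcal{G}\}$ converges weakly in $\ell_\infty(\mathcal{G})$ to a tight Brownian bridge process.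
   Context: $\varepsilon_1,\varepsilon_2,\dots$ are i.i.d. real random variables with mean zero, finite variance, positive density $f$ and distribution function $F$. With $k_{b_n}(y)=k(y/b_n)/b_n$, $\hat f(y)=\frac1n\sum_{i=1}^nk_{b_n}(y-\varepsilon_i)$ is the kernel density estimator and $f*k_{b_n}$ denotes convolution. The kernel $k$ is a symmetric, twice continuously differentiable density with compact support $[-1,1]$. The bandwidth satisfies $nb_n^4\to0$ and $nb_n^{d_*}\to\infty$ with $d_*=(50+20d)/(14+5d)$, where $d$ is a fixed positive integer (the parameter dimension in the paper's model). A class has envelope $V$ if $|g|\le V$ for all its members $g$. A (tight) Brownian bridge process indexed by $\mathcal{G}$ is a tight centered Gaussian process in $\ell_\infty(\mathcal{G})$ with covariance $E[g_1(\varepsilon)g_2(\varepsilon)]-E[g_1(\varepsilon)]E[g_2(\varepsilon)]$, where $\varepsilon$ has density $f$. *)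

theory Defs
  imports "HOL-Probability.Probability"
begin

section \<open>Outer expectation and weak convergence\<close>

text \<open>
  Infima over measurable majorants. The definition is only meant for bounded \<open>T\<close>; for those,
  admitting extended-real valued majorants would not change the infimum.
\<close>
definition outer_expectation :: "'a measure \<Rightarrow> ('a \<Rightarrow> real) \<Rightarrow> real" where
  "outer_expectation M T =
     Inf {integral\<^sup>L M U |U. integrable M U \<and> (\<forall>\<omega>\<in>space M. T \<omega> \<le> U \<omega>)}"

text \<open>
  \<open>Z\<^sub>n = o\<^sub>p(r\<^sub>n)\<close> for nonnegative \<open>Z\<^sub>n\<close>, in outer probability: suprema over an
  uncountable class need not be measurable.
\<close>
definition little_o_p :: "'a measure \<Rightarrow> (nat \<Rightarrow> 'a \<Rightarrow> ennreal) \<Rightarrow> (nat \<Rightarrow> real) \<Rightarrow> bool" where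
  "little_o_p M Z r \<longleftrightarrow>
     (\<forall>e>0. (\<lambda>n. outer_measure_of M {\<omega>\<in>space M. ennreal (e * r n) < Z n \<omega>}) \<longlonglongrightarrow> 0)"

text \<open>
  \<open>\<ell>\<^sub>\<infinity>(T)\<close>: the bounded real functions on \<open>T\<close> (extensional, i.e. \<open>undefined\<close> off \<open>T\<close>)
  with the supremum distance.
\<close>
abbreviation linf :: "'t set \<Rightarrow> ('t \<Rightarrow> real) metric" where
  "linf T \<equiv> funspace T euclidean_metric"

definition metric_borel :: "'z metric \<Rightarrow> 'z measure" where
  "metric_borel m = sigma (mspace m) {U. openin (mtopology_of m) U}"

text \<open>
  Weak convergence in the sense of Hoffmann-Joergensen, \<open>E\<^sup>* h(X\<^sub>n) \<rightarrow> \<integral> h dL\<close> for all bounded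
  continuous \<open>h\<close>, where the \<open>X\<^sub>n\<close> need not be measurable and \<open>L\<close> is a Borel law on \<open>m\<close>.
\<close>
definition converges_weakly ::
    "'a measure \<Rightarrow> 'z metric \<Rightarrow> (nat \<Rightarrow> 'a \<Rightarrow> 'z) \<Rightarrow> 'z measure \<Rightarrow> bool" where
  "converges_weakly M m X L \<longleftrightarrow>
     (\<forall>n. \<forall>\<omega>\<in>space M. X n \<omega> \<in> mspace m) \<and>
     (\<forall>h. continuous_map (mtopology_of m) euclideanreal h \<and> bounded (h ` mspace m) \<longrightarrow>
        (\<lambda>n. outer_expectation M (\<lambda>\<omega>. h (X n \<omega>))) \<longlonglongrightarrow> integral\<^sup>L L h)"

section \<open>Tight Brownian bridges and Donsker classes\<close>

definition tight_law :: "'z metric \<Rightarrow> 'z measure \<Rightarrow> bool" where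
  "tight_law m L \<longleftrightarrow>
     prob_space L \<and> sets L = sets (metric_borel m) \<and>
     (\<forall>e>0. \<exists>K. compactin (mtopology_of m) K \<and> measure L K \<ge> 1 - e)"

text \<open>Normal law with mean \<open>\<mu>\<close> and standard deviation \<open>\<sigma> \<ge> 0\<close>; the case \<open>\<sigma> = 0\<close> is a point mass.\<close>
definition normal_law :: "real \<Rightarrow> real \<Rightarrow> real measure" where
  "normal_law \<mu> \<sigma> =
     (if \<sigma> = 0 then return borel \<mu> else density lborel (\<lambda>x. ennreal (normal_density \<mu> \<sigma> x)))"

text \<open>Laws of processes indexed by \<open>T\<close> all of whose finite linear combinations are centered normal.\<close>
definition centered_gaussian_law :: "'t set \<Rightarrow> ('t \<Rightarrow> real) measure \<Rightarrow> bool" where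
  "centered_gaussian_law T L \<longleftrightarrow>
     (\<forall>S c. finite S \<and> S \<subseteq> T \<longrightarrow>
        (\<exists>\<sigma>\<ge>0. distr L borel (\<lambda>z. \<Sum>t\<in>S. c t * z t) = normal_law 0 \<sigma>))"

text \<open>\<open>L\<close> is the law, on \<open>\<ell>\<^sub>\<infinity>(G)\<close>, of a tight \<open>P\<close>-Brownian bridge indexed by \<open>G\<close>.\<close>
definition tight_brownian_bridge_law ::
    "'x measure \<Rightarrow> ('x \<Rightarrow> real) set \<Rightarrow> (('x \<Rightarrow> real) \<Rightarrow> real) measure \<Rightarrow> bool" where
  "tight_brownian_bridge_law P G L \<longleftrightarrow>
     tight_law (linf G) L \<and> centered_gaussian_law G L \<and>
     (\<forall>g1\<in>G. \<forall>g2\<in>G.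
        (\<integral>z. z g1 * z g2 \<partial>L) =
        (\<integral>x. g1 x * g2 x \<partial>P) - (\<integral>x. g1 x \<partial>P) * (\<integral>x. g2 x \<partial>P))"

text \<open>Samples are indexed from 0: the sample of size \<open>n\<close> is \<open>X 0, \<dots>, X (n - 1)\<close>.\<close>
definition empirical_process ::
    "'x measure \<Rightarrow> ('x \<Rightarrow> real) set \<Rightarrow> (nat \<Rightarrow> 'a \<Rightarrow> 'x) \<Rightarrow> nat \<Rightarrow> 'a \<Rightarrow> ('x \<Rightarrow> real) \<Rightarrow> real" where
  "empirical_process P G X n \<omega> =
     (\<lambda>g\<in>G. sqrt (real n) * ((1 / real n) * (\<Sum>i<n. g (X i \<omega>)) - (\<integral>x. g x \<partial>P)))"

text \<open>
  As usual, the observations entering the definition are the coordinate projections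
  of the infinite product space \<open>P\<^sup>\<infinity>\<close>, so that being Donsker depends on \<open>P\<close> and the class only.
\<close>
definition donsker :: "'x measure \<Rightarrow> ('x \<Rightarrow> real) set \<Rightarrow> bool" where
  "donsker P G \<longleftrightarrow>
     (\<forall>g\<in>G. g \<in> borel_measurable P \<and> integrable P (\<lambda>x. (g x)\<^sup>2)) \<and>
     (\<exists>L. tight_brownian_bridge_law P G L \<and>
        converges_weakly (\<Pi>\<^sub>M i\<in>(UNIV :: nat set). P) (linf G)
          (empirical_process P G (\<lambda>i x. x i)) L)"

definition envelope :: "('x \<Rightarrow> real) set \<Rightarrow> ('x \<Rightarrow> real) \<Rightarrow> bool" where
  "envelope G V \<longleftrightarrow> (\<forall>g\<in>G. \<forall>x. \<bar>g x\<bar> \<le> V x)"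

definition shift_class :: "(real \<Rightarrow> real) set \<Rightarrow> real \<Rightarrow> (real \<Rightarrow> real) set" where
  "shift_class G \<eta> = {(\<lambda>y. g (y + t)) |g t. g \<in> G \<and> \<bar>t\<bar> \<le> \<eta>}"

section \<open>Kernel density estimation\<close>

definition smoothing_kernel :: "(real \<Rightarrow> real) \<Rightarrow> bool" where
  "smoothing_kernel k \<longleftrightarrow>
     (\<forall>x. 0 \<le> k x) \<and> has_bochner_integral lborel k 1 \<and>
     (\<forall>x. k (- x) = k x) \<and>
     (\<exists>k' k''. (\<forall>x. (k has_real_derivative k' x) (at x)) \<and>
               (\<forall>x. (k' has_real_derivative k'' x) (at x)) \<and>
               continuous_on UNIV k'') \<and>
     (\<forall>x. x \<notin> {-1..1} \<longrightarrow> k x = 0)"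

definition scaled_kernel :: "(real \<Rightarrow> real) \<Rightarrow> real \<Rightarrow> real \<Rightarrow> real" where
  "scaled_kernel k b y = k (y / b) / b"

definition kernel_estimator ::
    "(real \<Rightarrow> real) \<Rightarrow> (nat \<Rightarrow> real) \<Rightarrow> (nat \<Rightarrow> 'a \<Rightarrow> real) \<Rightarrow> nat \<Rightarrow> 'a \<Rightarrow> real \<Rightarrow> real" where
  "kernel_estimator k b \<epsilon> n \<omega> y = (1 / real n) * (\<Sum>i<n. scaled_kernel k (b n) (y - \<epsilon> i \<omega>))"

definition convolve :: "(real \<Rightarrow> real) \<Rightarrow> (real \<Rightarrow> real) \<Rightarrow> real \<Rightarrow> real" where
  "convolve p q y = (\<integral>x. p (y - x) * q x \<partial>lborel)"

end

theory Submission
  imports Defs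
begin

text \<open>
  Write \<open>P\<^sub>n\<close> for the empirical measure of the sample and \<open>\<nu>\<^sub>n g = \<surd>n (P\<^sub>n g - \<integral> g dF)\<close>. The substitution
  \<open>y = \<epsilon>\<^sub>i + b u\<close> turns \<open>\<integral> g f\<^sub>n\<close>, with \<open>f\<^sub>n\<close> the kernel estimator, into the kernel average over \<open>u\<close>
  of \<open>P\<^sub>n g(\<cdot> + b u)\<close>. Hence \<open>\<surd>n (\<integral> g f\<^sub>n - P\<^sub>n g)\<close> is the kernel average of the increments
  \<open>\<nu>\<^sub>n g(\<cdot> + b u) - \<nu>\<^sub>n g\<close> plus the bias \<open>\<surd>n \<integral> g (f * k\<^sub>b - f)\<close>, which vanishes uniformly by
  hypothesis (\<open>smoothing_deviation\<close>). Since \<open>|u| \<le> 1\<close> on the support of the kernel, both functions in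
  an increment belong to the Donsker class of shifts as soon as the bandwidth is at most \<open>\<eta>\<close>. So the
  first claim follows from two facts: increments of \<open>\<nu>\<^sub>n\<close> are uniformly small over pairs that are
  close in \<open>L\<^sub>2(F)\<close>, and small shifts move the members of the class uniformly little in \<open>L\<^sub>2(F)\<close>.

  The first fact (\<open>converges_weakly_asymptotic_equicontinuity\<close>) is read off the tight limit law \<open>L\<close>.
  The bounded functions in a compact set of large \<open>L\<close>-mass oscillate little on the cells of a finite
  partition of the index set. The number of pairs of cells is fixed before one decides how close in
  \<open>L\<^sub>2(F)\<close> the indices have to be; so one close representative per pair of cells, Chebyshev's
  inequality and a union bound control all close pairs at once, without any study of sample paths.
  The empirical processes inherit the estimate, because in the limit they are attracted by every
  compact set of large mass (\<open>converges_weakly_near_compact\<close>).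

  The second fact (\<open>totally_bounded_shift_continuous\<close>) holds for each single function by continuity of
  translations in \<open>L\<^sub>1\<close>, applied to \<open>f\<close> and to \<open>g f\<close> for truncated \<open>g\<close>. The truncation error is
  governed by \<open>V\<close>, whose tails stay small under small shifts by the hypothesis on \<open>V\<close>. Uniformity
  comes from total boundedness of the class in \<open>L\<^sub>2(F)\<close>, which again is a consequence of tightness: two
  indices in one cell have, with probability at least one half, a small Gaussian increment, and this
  bounds its standard deviation (\<open>tight_brownian_bridge_totally_bounded\<close>).

  For the second claim, the restriction of \<open>\<nu>\<^sub>n\<close> from the class of shifts to \<open>G\<close> converges to the
  restricted Brownian bridge, and the smoothed process is uniformly close to it in outer probability;
  a version of Slutsky's lemma for nonmeasurable maps with tight limits concludes
  (\<open>converges_weakly_slutsky\<close>).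
\<close>

section \<open>Outer expectations\<close>

lemma outer_expectation_le:
  assumes "prob_space M" "\<And>\<omega>. \<omega> \<in> space M \<Longrightarrow> \<bar>T \<omega>\<bar> \<le> B"
    "integrable M U" "\<And>\<omega>. \<omega> \<in> space M \<Longrightarrow> T \<omega> \<le> U \<omega>"
  shows "outer_expectation M T \<le> integral\<^sup>L M U"
proof -
  interpret prob_space M by fact
  have "- B \<le> integral\<^sup>L M W" if W: "integrable M W" "\<forall>\<omega>\<in>space M. T \<omega> \<le> W \<omega>" for W
  proof -
    have "- B \<le> W \<omega>" if "\<omega> \<in> space M" for \<omega>
      using W(2) that assms(2)[OF that] by fastforce
    then have "(\<integral>\<omega>. - B \<partial>M) \<le> integral\<^sup>L M W"
      using W(1) by (intro integral_mono) auto
    then show ?thesis by (simp add: prob_space)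
  qed
  then show ?thesis
    unfolding outer_expectation_def using assms(3,4)
    by (intro cInf_lower bdd_belowI[of _ "- B"]) auto
qed

lemma outer_expectation_ge:
  assumes "prob_space M" "\<And>\<omega>. \<omega> \<in> space M \<Longrightarrow> T \<omega> \<le> B"
    "\<And>U. integrable M U \<Longrightarrow> (\<And>\<omega>. \<omega> \<in> space M \<Longrightarrow> T \<omega> \<le> U \<omega>) \<Longrightarrow> c \<le> integral\<^sup>L M U"
  shows "c \<le> outer_expectation M T"
proof -
  interpret prob_space M by fact
  have "integrable M (\<lambda>_. B)" by simp
  then show ?thesis
    unfolding outer_expectation_def using assms(2,3)
    by (intro cInf_greatest) fastforce+
qed

lemma outer_expectation_mono:
  assumes "prob_space M" "\<And>\<omega>. \<omega> \<in> space M \<Longrightarrow> \<bar>T \<omega>\<bar> \<le> B" "\<And>\<omega>. \<omega> \<in> space M \<Longrightarrow> T' \<omega> \<le> B'"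
    "\<And>\<omega>. \<omega> \<in> space M \<Longrightarrow> T \<omega> \<le> T' \<omega>"
  shows "outer_expectation M T \<le> outer_expectation M T'"
  by (rule outer_expectation_ge[OF assms(1,3)])
     (auto intro!: outer_expectation_le[OF assms(1,2)] intro: order_trans[OF assms(4)])

lemma outer_expectation_add_le:
  assumes "prob_space M" "\<And>\<omega>. \<omega> \<in> space M \<Longrightarrow> \<bar>T \<omega>\<bar> \<le> B" "\<And>\<omega>. \<omega> \<in> space M \<Longrightarrow> \<bar>T' \<omega>\<bar> \<le> B'"
  shows "outer_expectation M (\<lambda>\<omega>. T \<omega> + T' \<omega>) \<le> outer_expectation M T + outer_expectation M T'"
proof -
  have bd: "\<bar>T \<omega> + T' \<omega>\<bar> \<le> B + B'" if "\<omega> \<in> space M" for \<omega>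
    using assms(2,3)[OF that] by linarith
  have *: "outer_expectation M (\<lambda>\<omega>. T \<omega> + T' \<omega>) \<le> integral\<^sup>L M U + integral\<^sup>L M U'"
    if "integrable M U" "\<And>\<omega>. \<omega> \<in> space M \<Longrightarrow> T \<omega> \<le> U \<omega>"
      "integrable M U'" "\<And>\<omega>. \<omega> \<in> space M \<Longrightarrow> T' \<omega> \<le> U' \<omega>" for U U'
    using outer_expectation_le[OF assms(1) bd, where U="\<lambda>\<omega>. U \<omega> + U' \<omega>"] that
    by (simp add: add_mono)
  have "outer_expectation M (\<lambda>\<omega>. T \<omega> + T' \<omega>) - outer_expectation M T' \<le> outer_expectation M T"
  proof (rule outer_expectation_ge[OF assms(1)])
    show "\<omega> \<in> space M \<Longrightarrow> T \<omega> \<le> B" for \<omega> using assms(2)[of \<omega>] by auto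
    fix U assume U: "integrable M U" "\<And>\<omega>. \<omega> \<in> space M \<Longrightarrow> T \<omega> \<le> U \<omega>"
    have "outer_expectation M (\<lambda>\<omega>. T \<omega> + T' \<omega>) - integral\<^sup>L M U \<le> outer_expectation M T'"
    proof (rule outer_expectation_ge[OF assms(1)])
      show "\<omega> \<in> space M \<Longrightarrow> T' \<omega> \<le> B'" for \<omega> using assms(3)[of \<omega>] by auto
      fix U' assume "integrable M U'" "\<And>\<omega>. \<omega> \<in> space M \<Longrightarrow> T' \<omega> \<le> U' \<omega>"
      from *[OF U this] show "outer_expectation M (\<lambda>\<omega>. T \<omega> + T' \<omega>) - integral\<^sup>L M U \<le> integral\<^sup>L M U'"
        by linarith
    qed
    then show "outer_expectation M (\<lambda>\<omega>. T \<omega> + T' \<omega>) - outer_expectation M T' \<le> integral\<^sup>L M U"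
      by linarith
  qed
  then show ?thesis by linarith
qed

lemma outer_expectation_const:
  assumes "prob_space M"
  shows "outer_expectation M (\<lambda>_. c) = c"
proof (rule antisym)
  interpret prob_space M by fact
  show "outer_expectation M (\<lambda>_. c) \<le> c"
    using outer_expectation_le[OF assms, where T="\<lambda>_. c" and B="\<bar>c\<bar>" and U="\<lambda>_. c"] by (simp add: prob_space)
  show "c \<le> outer_expectation M (\<lambda>_. c)"
  proof (rule outer_expectation_ge[OF assms order_refl])
    fix U assume "integrable M U" "\<And>\<omega>. \<omega> \<in> space M \<Longrightarrow> c \<le> U \<omega>"
    then have "(\<integral>\<omega>. c \<partial>M) \<le> integral\<^sup>L M U" by (intro integral_mono) auto
    then show "c \<le> integral\<^sup>L M U" by (simp add: prob_space)
  qed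
qed

lemma outer_expectation_cmult_le:
  assumes "prob_space M" "\<And>\<omega>. \<omega> \<in> space M \<Longrightarrow> \<bar>T \<omega>\<bar> \<le> B" "c > 0"
  shows "outer_expectation M (\<lambda>\<omega>. c * T \<omega>) \<le> c * outer_expectation M T"
proof -
  have "outer_expectation M (\<lambda>\<omega>. c * T \<omega>) / c \<le> outer_expectation M T"
  proof (rule outer_expectation_ge[OF assms(1)])
    show "\<omega> \<in> space M \<Longrightarrow> T \<omega> \<le> B" for \<omega> using assms(2)[of \<omega>] by auto
    fix U assume U: "integrable M U" "\<And>\<omega>. \<omega> \<in> space M \<Longrightarrow> T \<omega> \<le> U \<omega>"
    have "outer_expectation M (\<lambda>\<omega>. c * T \<omega>) \<le> (\<integral>\<omega>. c * U \<omega> \<partial>M)"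
      using U assms by (intro outer_expectation_le[where B="c * B"]) (auto simp: abs_mult)
    then show "outer_expectation M (\<lambda>\<omega>. c * T \<omega>) / c \<le> integral\<^sup>L M U"
      using assms(3) by (simp add: field_simps)
  qed
  then show ?thesis using assms(3) by (simp add: field_simps)
qed

text \<open>
  Subadditivity gives \<open>0 = E\<^sup>* (T - T) \<le> E\<^sup>* T + E\<^sup>* (- T)\<close>. An upper bound on \<open>E\<^sup>* (- T)\<close> therefore is
  a lower bound on \<open>E\<^sup>* T\<close>, which is how all lower bounds on outer expectations arise below.
\<close>

lemma inner_le_outer_expectation:
  assumes "prob_space M" "\<And>\<omega>. \<omega> \<in> space M \<Longrightarrow> \<bar>T \<omega>\<bar> \<le> B"
  shows "- outer_expectation M (\<lambda>\<omega>. - T \<omega>) \<le> outer_expectation M T"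
  using outer_expectation_add_le[where T=T and T'="\<lambda>\<omega>. - T \<omega>" and B=B and B'=B, OF assms] assms(2)
  by (simp add: outer_expectation_const[OF assms(1)])

text \<open>
  Majorants on \<open>N\<close> pull back to majorants on \<open>M\<close>. The inequality can be strict, as \<open>M\<close> may carry
  measurable sets that do not come from \<open>N\<close>.
\<close>

lemma outer_expectation_comp_le:
  assumes "prob_space M" "prob_space N" and \<phi>: "\<phi> \<in> measurable M N" "distr M N \<phi> = N"
    and T: "\<And>x. x \<in> space N \<Longrightarrow> \<bar>T x\<bar> \<le> B"
  shows "outer_expectation M (\<lambda>\<omega>. T (\<phi> \<omega>)) \<le> outer_expectation N T"
proof (rule outer_expectation_ge[OF assms(2)])
  show "x \<in> space N \<Longrightarrow> T x \<le> B" for x using T[of x] by auto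
  fix U assume U: "integrable N U" "\<And>x. x \<in> space N \<Longrightarrow> T x \<le> U x"
  have "outer_expectation M (\<lambda>\<omega>. T (\<phi> \<omega>)) \<le> (\<integral>\<omega>. U (\<phi> \<omega>) \<partial>M)"
  proof (rule outer_expectation_le[OF assms(1)])
    show "integrable M (\<lambda>\<omega>. U (\<phi> \<omega>))"
      using U(1) \<phi> by (metis integrable_distr)
    show "\<omega> \<in> space M \<Longrightarrow> \<bar>T (\<phi> \<omega>)\<bar> \<le> B" for \<omega>
      using T \<phi>(1) by (auto dest: measurable_space)
    show "\<omega> \<in> space M \<Longrightarrow> T (\<phi> \<omega>) \<le> U (\<phi> \<omega>)" for \<omega>
      using U(2) \<phi>(1) by (auto dest: measurable_space)
  qed
  also have "\<dots> = integral\<^sup>L N U"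
    using integral_distr[OF \<phi>(1), of U] U(1) \<phi>(2) by simp
  finally show "outer_expectation M (\<lambda>\<omega>. T (\<phi> \<omega>)) \<le> integral\<^sup>L N U" .
qed

text \<open>
  Markov's inequality: each integrable majorant \<open>U\<close> of \<open>T\<close> provides the measurable cover
  \<open>{U \<ge> 1}\<close> of \<open>A\<close>.
\<close>

lemma outer_measure_of_le_outer_expectation:
  assumes "prob_space M" "\<And>\<omega>. \<omega> \<in> space M \<Longrightarrow> 0 \<le> T \<omega>" "\<And>\<omega>. \<omega> \<in> space M \<Longrightarrow> T \<omega> \<le> B"
    and A: "A \<subseteq> space M" "\<And>\<omega>. \<omega> \<in> A \<Longrightarrow> 1 \<le> T \<omega>"
  shows "outer_measure_of M A \<le> ennreal (outer_expectation M T)"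
proof -
  interpret prob_space M by fact
  have fin: "outer_measure_of M A \<noteq> \<top>"
    using outer_measure_of_mono[OF A(1), of M] by (auto simp: emeasure_space_1 top_unique)
  have "enn2real (outer_measure_of M A) \<le> outer_expectation M T"
  proof (rule outer_expectation_ge[OF assms(1,3)])
    fix U assume U: "integrable M U" "\<And>\<omega>. \<omega> \<in> space M \<Longrightarrow> T \<omega> \<le> U \<omega>"
    let ?B = "{\<omega>\<in>space M. 1 \<le> U \<omega>}"
    have [measurable]: "U \<in> borel_measurable M" using U(1) by auto
    have B: "?B \<in> sets M" by measurable
    have "A \<subseteq> ?B" using A U(2) by force
    then have "outer_measure_of M A \<le> emeasure M ?B"
      using outer_measure_of_mono[of A ?B M] B by simp
    then have "enn2real (outer_measure_of M A) \<le> prob ?B"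
      by (simp add: emeasure_eq_measure enn2real_leI)
    also have "\<dots> = (\<integral>\<omega>. indicator ?B \<omega> \<partial>M)"
      using B by simp
    also have "\<dots> \<le> integral\<^sup>L M U"
    proof (rule integral_mono)
      show "integrable M (indicator ?B :: _ \<Rightarrow> real)" using B by (intro integrable_real_indicator) (auto simp: emeasure_eq_measure)
      show "indicator ?B \<omega> \<le> U \<omega>" if "\<omega> \<in> space M" for \<omega>
        using U(2)[OF that] assms(2)[OF that] by (auto simp: indicator_def)
    qed (rule U(1))
    finally show "enn2real (outer_measure_of M A) \<le> integral\<^sup>L M U" .
  qed auto
  then show ?thesis
    using fin by (metis ennreal_enn2real ennreal_leI less_top)
qed

lemma outer_expectation_indicator_le:
  assumes "prob_space M" "A \<subseteq> space M"
  shows "outer_expectation M (indicator A) \<le> enn2real (outer_measure_of M A)"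
proof -
  interpret prob_space M by fact
  obtain E where E: "E \<in> sets M" "A \<subseteq> E" "outer_measure_of M A = emeasure M E"
    using outer_measure_of_attain[OF assms(2)] by auto
  have "outer_expectation M (indicator A) \<le> (\<integral>\<omega>. indicator E \<omega> \<partial>M)"
    using E by (intro outer_expectation_le[OF assms(1), where B=1] integrable_real_indicator)
      (auto simp: indicator_def emeasure_eq_measure)
  also have "\<dots> = enn2real (outer_measure_of M A)"
    using E by (simp add: measure_def)
  finally show ?thesis .
qed

section \<open>Weak convergence\<close>

lemma mspace_linf_iff:
  "z \<in> mspace (linf T) \<longleftrightarrow> z \<in> extensional T \<and> (\<exists>B. \<forall>t\<in>T. \<bar>z t\<bar> \<le> B)"
  by (auto simp: Metric_space.fspace_def[OF Met_TC.Metric_space_axioms] bounded_iff)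

lemma abs_diff_le_mdist_linf:
  assumes "z \<in> mspace (linf T)" "w \<in> mspace (linf T)" "t \<in> T"
  shows "\<bar>z t - w t\<bar> \<le> mdist (linf T) z w"
  using funspace_mdist_le[OF assms(1,2), of "mdist (linf T) z w"] assms(3)
  by (auto simp: dist_real_def)

lemma mdist_linf_le:
  assumes "z \<in> mspace (linf T)" "w \<in> mspace (linf T)" "0 \<le> a"
    and "\<And>t. t \<in> T \<Longrightarrow> \<bar>z t - w t\<bar> \<le> a"
  shows "mdist (linf T) z w \<le> a"
proof (cases "T = {}")
  case True
  then show ?thesis using assms(3) by (simp add: Metric_space.fdist_empty[OF Met_TC.Metric_space_axioms])
next
  case False
  then show ?thesis
    using funspace_mdist_le[OF assms(1,2) False] assms(4) by (simp add: dist_real_def)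
qed

lemma space_tight_law: "tight_law m L \<Longrightarrow> space L = mspace m"
  using sets_eq_imp_space_eq[of L "metric_borel m"] unfolding tight_law_def metric_borel_def
  by (simp add: space_measure_of_conv)

lemma sets_metric_borel: "openin (mtopology_of m) U \<Longrightarrow> U \<in> sets (metric_borel m)"
  unfolding metric_borel_def using openin_subset by (subst sets_measure_of) fastforce+

lemma space_metric_borel [simp]: "space (metric_borel m) = mspace m"
  by (simp add: metric_borel_def space_measure_of_conv)

lemma continuous_map_borel_measurable:
  assumes "continuous_map (mtopology_of m) euclideanreal h" "sets L = sets (metric_borel m)"
  shows "h \<in> borel_measurable L"
proof (rule borel_measurableI)
  fix S :: "real set" assume "open S"
  then have "openin (mtopology_of m) {x \<in> topspace (mtopology_of m). h x \<in> S}"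
    using assms(1) by (intro openin_continuous_map_preimage) auto
  moreover have "h -` S \<inter> space L = {x \<in> topspace (mtopology_of m). h x \<in> S}"
    using sets_eq_imp_space_eq[OF assms(2)] by auto
  ultimately show "h -` S \<inter> space L \<in> sets L"
    using sets_metric_borel assms(2) by metis
qed

lemma continuous_map_measurable_metric_borel:
  assumes "continuous_map (mtopology_of m) (mtopology_of m') \<phi>" "sets L = sets (metric_borel m)"
  shows "\<phi> \<in> measurable L (metric_borel m')"
  unfolding metric_borel_def[of m']
proof (rule measurable_sigma_sets[OF sets_measure_of])
  have sp: "space L = mspace m" using sets_eq_imp_space_eq[OF assms(2)] by simp
  (* the two rules combined here both ask for this inclusion *)
  show "{U. openin (mtopology_of m') U} \<subseteq> Pow (mspace m')"
    using openin_subset by fastforce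
  then show "{U. openin (mtopology_of m') U} \<subseteq> Pow (mspace m')" .
  show "\<phi> \<in> space L \<rightarrow> mspace m'"
    using assms(1) sp by (auto simp: continuous_map_def)
  fix U assume "U \<in> {U. openin (mtopology_of m') U}"
  then have "openin (mtopology_of m) {x \<in> topspace (mtopology_of m). \<phi> x \<in> U}"
    using assms(1) by (intro openin_continuous_map_preimage) auto
  moreover have "\<phi> -` U \<inter> space L = {x \<in> topspace (mtopology_of m). \<phi> x \<in> U}"
    using sp by auto
  ultimately show "\<phi> -` U \<inter> space L \<in> sets L"
    using sets_metric_borel assms(2) by metis
qed

lemma compactin_sets_metric_borel:
  assumes "compactin (mtopology_of m) K"
  shows "K \<in> sets (metric_borel m)"
proof -
  interpret Metric_space "mspace m" "mdist m" by (rule Metric_space_mspace_mdist)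
  have "closedin (mtopology_of m) K"
    using assms by (simp add: mtopology_of_def compactin_imp_closedin[OF Hausdorff_space_mtopology])
  then have "openin (mtopology_of m) (mspace m - K)" "K \<subseteq> mspace m"
    by (auto simp: closedin_def)
  then have "mspace m - (mspace m - K) \<in> sets (metric_borel m)"
    using sets_metric_borel sets.compl_sets space_metric_borel by metis
  then show ?thesis using \<open>K \<subseteq> mspace m\<close> by (simp add: double_diff)
qed

text \<open>
  Under a measure preserving map, outer expectations can only decrease and inner expectations can only
  increase. As weak convergence applied to \<open>h\<close> and to \<open>- h\<close> makes outer and inner expectations share
  their limit, the transported ones are squeezed in between. This moves the Donsker property, which
  speaks about coordinate projections, to an arbitrary i.i.d. sequence.
\<close>

lemma converges_weakly_distr:
  assumes X: "converges_weakly N m X L"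
    and "prob_space M" "prob_space N" "\<phi> \<in> measurable M N" "distr M N \<phi> = N"
  shows "converges_weakly M m (\<lambda>n \<omega>. X n (\<phi> \<omega>)) L"
  unfolding converges_weakly_def
proof (intro conjI allI ballI impI)
  have mem: "X n x \<in> mspace m" if "x \<in> space N" for n x
    using X that by (auto simp: converges_weakly_def)
  show "X n (\<phi> \<omega>) \<in> mspace m" if "\<omega> \<in> space M" for n \<omega>
    using mem measurable_space[OF assms(4) that] .
  fix h assume h: "continuous_map (mtopology_of m) euclideanreal h \<and> bounded (h ` mspace m)"
  then obtain B where B: "\<And>z. z \<in> mspace m \<Longrightarrow> \<bar>h z\<bar> \<le> B"
    by (auto simp: bounded_iff)
  have h': "continuous_map (mtopology_of m) euclideanreal (\<lambda>z. - h z) \<and> bounded ((\<lambda>z. - h z) ` mspace m)"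
    using h by (auto simp: bounded_iff intro: continuous_map_minus)
  have up: "(\<lambda>n. outer_expectation N (\<lambda>x. h (X n x))) \<longlonglongrightarrow> integral\<^sup>L L h"
    using X h unfolding converges_weakly_def by blast
  have "(\<lambda>n. outer_expectation N (\<lambda>x. - h (X n x))) \<longlonglongrightarrow> (\<integral>z. - h z \<partial>L)"
    using X h' unfolding converges_weakly_def by blast
  then have lo: "(\<lambda>n. - outer_expectation N (\<lambda>x. - h (X n x))) \<longlonglongrightarrow> integral\<^sup>L L h"
    using tendsto_minus by fastforce
  show "(\<lambda>n. outer_expectation M (\<lambda>\<omega>. h (X n (\<phi> \<omega>)))) \<longlonglongrightarrow> integral\<^sup>L L h"
  proof (rule tendsto_sandwich[OF always_eventually always_eventually lo up]; intro allI)
    fix n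
    show "outer_expectation M (\<lambda>\<omega>. h (X n (\<phi> \<omega>))) \<le> outer_expectation N (\<lambda>x. h (X n x))"
      using B mem by (intro outer_expectation_comp_le[OF assms(2-5), where T="\<lambda>x. h (X n x)" and B=B]) auto
    have "outer_expectation M (\<lambda>\<omega>. - h (X n (\<phi> \<omega>))) \<le> outer_expectation N (\<lambda>x. - h (X n x))"
      using B mem by (intro outer_expectation_comp_le[OF assms(2-5), where T="\<lambda>x. - h (X n x)" and B=B]) auto
    moreover have "- outer_expectation M (\<lambda>\<omega>. - h (X n (\<phi> \<omega>))) \<le> outer_expectation M (\<lambda>\<omega>. h (X n (\<phi> \<omega>)))"
      using B mem measurable_space[OF assms(4)]
      by (intro inner_le_outer_expectation[OF assms(2), where B=B]) auto
    ultimately show "- outer_expectation N (\<lambda>x. - h (X n x)) \<le> outer_expectation M (\<lambda>\<omega>. h (X n (\<phi> \<omega>)))"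
      by linarith
  qed
qed

lemma converges_weakly_continuous_map:
  assumes X: "converges_weakly M m X L" and L: "sets L = sets (metric_borel m)"
    and \<phi>: "continuous_map (mtopology_of m) (mtopology_of m') \<phi>"
  shows "converges_weakly M m' (\<lambda>n \<omega>. \<phi> (X n \<omega>)) (distr L (metric_borel m') \<phi>)"
  unfolding converges_weakly_def
proof (intro conjI allI ballI impI)
  have \<phi>m: "\<phi> z \<in> mspace m'" if "z \<in> mspace m" for z
    using \<phi> that by (auto simp: continuous_map_def)
  show "\<phi> (X n \<omega>) \<in> mspace m'" if "\<omega> \<in> space M" for n \<omega>
    using X that by (auto simp: converges_weakly_def intro!: \<phi>m)
  fix h assume h: "continuous_map (mtopology_of m') euclideanreal h \<and> bounded (h ` mspace m')"
  have "continuous_map (mtopology_of m) euclideanreal (\<lambda>z. h (\<phi> z))"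
    using continuous_map_compose[OF \<phi>, of euclideanreal h] h by (simp add: o_def)
  moreover have "bounded ((\<lambda>z. h (\<phi> z)) ` mspace m)"
    using h \<phi>m by (auto simp: bounded_iff)
  ultimately have "(\<lambda>n. outer_expectation M (\<lambda>\<omega>. h (\<phi> (X n \<omega>)))) \<longlonglongrightarrow> (\<integral>z. h (\<phi> z) \<partial>L)"
    using X unfolding converges_weakly_def by blast
  also have "(\<integral>z. h (\<phi> z) \<partial>L) = integral\<^sup>L (distr L (metric_borel m') \<phi>) h"
    using h by (intro integral_distr[symmetric] continuous_map_measurable_metric_borel[OF \<phi> L]
        continuous_map_borel_measurable[where m=m']) auto
  finally show "(\<lambda>n. outer_expectation M (\<lambda>\<omega>. h (\<phi> (X n \<omega>)))) \<longlonglongrightarrow>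
      integral\<^sup>L (distr L (metric_borel m') \<phi>) h" .
qed

lemma tight_law_distr:
  assumes L: "tight_law m L" and \<phi>: "continuous_map (mtopology_of m) (mtopology_of m') \<phi>"
  shows "tight_law m' (distr L (metric_borel m') \<phi>)"
  unfolding tight_law_def
proof (intro conjI allI impI)
  interpret L: prob_space L using L by (simp add: tight_law_def)
  have sL: "sets L = sets (metric_borel m)" using L by (simp add: tight_law_def)
  note \<phi>m = continuous_map_measurable_metric_borel[OF \<phi> sL]
  show "prob_space (distr L (metric_borel m') \<phi>)"
    using \<phi>m by (rule L.prob_space_distr)
  fix e :: real assume "e > 0"
  then obtain K where K: "compactin (mtopology_of m) K" "measure L K \<ge> 1 - e"
    using L by (auto simp: tight_law_def)
  let ?K = "\<phi> ` K"
  have K': "compactin (mtopology_of m') ?K"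
    using K(1) \<phi> by (rule image_compactin)
  have "K \<subseteq> \<phi> -` ?K \<inter> space L"
    using compactin_subset_topspace[OF K(1)] space_tight_law[OF L] by auto
  then have "measure L K \<le> measure L (\<phi> -` ?K \<inter> space L)"
    using measurable_sets[OF \<phi>m compactin_sets_metric_borel[OF K']]
    by (intro L.finite_measure_mono)
  also have "\<dots> = measure (distr L (metric_borel m') \<phi>) ?K"
    using \<phi>m compactin_sets_metric_borel[OF K'] by (simp add: measure_distr)
  finally show "\<exists>K. compactin (mtopology_of m') K \<and> measure (distr L (metric_borel m') \<phi>) K \<ge> 1 - e"
    using K(2) K' by force
qed simp

text \<open>
  By the Lebesgue number lemma the modulus of continuity is uniform in \<open>z \<in> K\<close>, even though \<open>w\<close> need
  not belong to \<open>K\<close>. This is what replaces uniform continuity of test functions.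
\<close>
lemma continuous_map_uniform_near_compact:
  assumes h: "continuous_map (mtopology_of m) euclideanreal h" and K: "compactin (mtopology_of m) K"
    and e: "e > 0"
  obtains r where "r > 0" "\<And>z w. z \<in> K \<Longrightarrow> w \<in> mspace m \<Longrightarrow> mdist m z w < r \<Longrightarrow> \<bar>h z - h w\<bar> < e"
proof -
  interpret Metric_space "mspace m" "mdist m" by (rule Metric_space_mspace_mdist)
  let ?U = "\<lambda>x. {w \<in> topspace mtopology. h w \<in> ball (h x) (e/2)}"
  have KM: "K \<subseteq> mspace m" using compactin_subset_topspace[OF K] by simp
  have "\<exists>r>0. \<forall>x\<in>K. \<exists>U\<in>?U ` K. mball x r \<subseteq> U"
  proof (rule lebesgue_number)
    show "compactin mtopology K" using K by (simp add: mtopology_of_def)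
    show "K \<subseteq> \<Union> (?U ` K)" using KM e by auto
    show "openin mtopology U" if "U \<in> ?U ` K" for U
      using that h by (auto simp: mtopology_of_def simp del: topspace_mtopology mem_ball intro!: openin_continuous_map_preimage)
  qed
  then obtain r where r: "r > 0" "\<And>x. x \<in> K \<Longrightarrow> \<exists>y\<in>K. mball x r \<subseteq> ?U y" by auto
  show thesis
  proof (rule that[OF r(1)])
    fix z w assume zw: "z \<in> K" "w \<in> mspace m" "mdist m z w < r"
    obtain y where y: "mball z r \<subseteq> ?U y" using r(2)[OF zw(1)] by auto
    have "z \<in> mball z r" "w \<in> mball z r" using zw KM r(1) by auto
    then have "z \<in> ?U y" "w \<in> ?U y" using y by blast+
    then have "dist (h y) (h z) < e/2" "dist (h y) (h w) < e/2" by auto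
    then show "\<bar>h z - h w\<bar> < e" unfolding dist_real_def by linarith
  qed
qed

text \<open>
  The witness is \<open>min 1 (D / r)\<close> with \<open>D\<close> the distance from \<open>K\<close>; it serves as a continuous upper
  bound for the indicator of the points at distance at least \<open>r\<close> from \<open>K\<close>.
\<close>
lemma compact_penalty:
  assumes K: "compactin (mtopology_of m) K" "K \<noteq> {}" and r: "r > 0"
  obtains q where "continuous_map (mtopology_of m) euclideanreal q"
    "\<And>z. z \<in> mspace m \<Longrightarrow> 0 \<le> q z \<and> q z \<le> (1::real)" "\<And>z. z \<in> K \<Longrightarrow> q z = 0"
    "\<And>z. z \<in> mspace m \<Longrightarrow> q z < 1 \<Longrightarrow> \<exists>w\<in>K. mdist m w z < r"
proof -
  have KM: "K \<subseteq> mspace m" using compactin_subset_topspace[OF K(1)] by simp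
  define D where "D z = (INF w\<in>K. mdist m w z)" for z
  have D_le: "D z \<le> mdist m w z" if "w \<in> K" for w z
    unfolding D_def using that by (intro cINF_lower bdd_belowI[of _ 0]) auto
  have D_ge: "0 \<le> D z" for z
    unfolding D_def using K(2) by (intro cINF_greatest) auto
  have lip: "D z \<le> D z' + mdist m z z'" if "z \<in> mspace m" "z' \<in> mspace m" for z z'
  proof -
    have "D z - mdist m z z' \<le> D z'"
      unfolding D_def[of z']
    proof (rule cINF_greatest[OF K(2)])
      fix w assume w: "w \<in> K"
      show "D z - mdist m z z' \<le> mdist m w z'"
        using D_le[OF w, of z] mdist_triangle[of w m z' z] w KM that
        by (auto simp: mdist_commute[of m z z'])
    qed
    then show ?thesis by simp
  qed
  have "Lipschitz_continuous_map m euclidean_metric D"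
    unfolding Lipschitz_continuous_map_def
  proof (intro conjI exI[of _ 1] ballI)
    fix z z' assume "z \<in> mspace m" "z' \<in> mspace m"
    then show "mdist euclidean_metric (D z) (D z') \<le> 1 * mdist m z z'"
      using lip[of z z'] lip[of z' z] mdist_commute[of m z z'] by (auto simp: dist_real_def)
  qed auto
  then have D_cont: "continuous_map (mtopology_of m) euclideanreal D"
    using Lipschitz_continuous_imp_continuous_map by fastforce
  define q where "q z = min 1 (D z / r)" for z
  show thesis
  proof (rule that[of q])
    have "continuous_on UNIV (\<lambda>x::real. min 1 (x / r))"
      by (intro continuous_intros) (use r in auto)
    then have "continuous_map euclideanreal euclideanreal (\<lambda>x. min 1 (x / r))" by simp
    from continuous_map_compose[OF D_cont this]
    show "continuous_map (mtopology_of m) euclideanreal q"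
      by (simp add: o_def q_def[abs_def])
    show "0 \<le> q z \<and> q z \<le> 1" if "z \<in> mspace m" for z
      using D_ge[of z] r by (auto simp: q_def)
    show "q z = 0" if "z \<in> K" for z
    proof -
      have "mdist m z z = 0" using that KM by auto
      then have "D z = 0" using D_le[OF that, of z] D_ge[of z] by linarith
      then show ?thesis by (simp add: q_def)
    qed
    fix z assume z: "z \<in> mspace m" "q z < 1"
    then have "D z < r" using r by (auto simp: q_def min_def split: if_splits)
    then show "\<exists>w\<in>K. mdist m w z < r"
      unfolding D_def using K(2) by (subst (asm) cINF_less_iff) (auto intro: bdd_belowI[of _ 0])
  qed
qed

text \<open>
  A portmanteau inequality: the indicator of being far from \<open>K\<close> lies below the test function of
  \<open>compact_penalty\<close>, whose limiting integral is at most the mass outside \<open>K\<close>.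
\<close>
lemma converges_weakly_near_compact:
  assumes M: "prob_space M" and X: "converges_weakly M m X L" and L: "tight_law m L"
    and K: "compactin (mtopology_of m) K" "measure L K \<ge> 1 - c" and c: "0 < c" "c < 1" and r: "r > 0"
  shows "\<forall>\<^sub>F n in sequentially.
           outer_measure_of M {\<omega>\<in>space M. \<not> (\<exists>w\<in>K. mdist m w (X n \<omega>) < r)} < ennreal (2 * c)"
proof -
  interpret L: prob_space L using L by (simp add: tight_law_def)
  have sL: "sets L = sets (metric_borel m)" using L by (simp add: tight_law_def)
  have Xm: "X n \<omega> \<in> mspace m" if "\<omega> \<in> space M" for n \<omega>
    using X that by (auto simp: converges_weakly_def)
  have KL: "K \<in> sets L" using compactin_sets_metric_borel[OF K(1)] sL by simp
  have "K \<noteq> {}" using K(2) c(2) by auto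
  obtain q where q: "continuous_map (mtopology_of m) euclideanreal q"
    "\<And>z. z \<in> mspace m \<Longrightarrow> 0 \<le> q z \<and> q z \<le> (1::real)" "\<And>z. z \<in> K \<Longrightarrow> q z = 0"
    "\<And>z. z \<in> mspace m \<Longrightarrow> q z < 1 \<Longrightarrow> \<exists>w\<in>K. mdist m w z < r"
    using compact_penalty[OF K(1) \<open>K \<noteq> {}\<close> r] by metis
  have "integral\<^sup>L L q \<le> (\<integral>z. 1 - indicator K z \<partial>L)"
  proof (rule integral_mono)
    have qm: "q \<in> borel_measurable L"
      using continuous_map_borel_measurable[OF q(1) sL] .
    show "integrable L q"
      using q(2) space_tight_law[OF L] qm by (intro L.integrable_const_bound[where B=1] AE_I2) auto
    show "integrable L (\<lambda>z. 1 - indicator K z :: real)"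
      using KL by (intro Bochner_Integration.integrable_diff integrable_real_indicator) (auto simp: L.emeasure_eq_measure)
    show "q z \<le> 1 - indicator K z" if "z \<in> space L" for z
      using q(2)[of z] q(3)[of z] that space_tight_law[OF L] by (auto simp: indicator_def)
  qed
  also have "\<dots> = 1 - measure L K"
    using KL by (subst Bochner_Integration.integral_diff) (auto simp: L.emeasure_eq_measure L.prob_space)
  also have "\<dots> \<le> c" using K(2) by simp
  finally have qc: "integral\<^sup>L L q \<le> c" .
  have "(\<lambda>n. outer_expectation M (\<lambda>\<omega>. q (X n \<omega>))) \<longlonglongrightarrow> integral\<^sup>L L q"
    using X q(1,2) unfolding converges_weakly_def by (force simp: bounded_iff)
  then have "\<forall>\<^sub>F n in sequentially. outer_expectation M (\<lambda>\<omega>. q (X n \<omega>)) < 2 * c"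
    using qc c(1) by (intro order_tendstoD) auto
  then show ?thesis
  proof eventually_elim
    case (elim n)
    have "outer_measure_of M {\<omega>\<in>space M. \<not> (\<exists>w\<in>K. mdist m w (X n \<omega>) < r)}
        \<le> ennreal (outer_expectation M (\<lambda>\<omega>. q (X n \<omega>)))"
    proof (rule outer_measure_of_le_outer_expectation[OF M, where B=1])
      show "1 \<le> q (X n \<omega>)" if "\<omega> \<in> {\<omega>\<in>space M. \<not> (\<exists>w\<in>K. mdist m w (X n \<omega>) < r)}" for \<omega>
        using that q(4)[OF Xm, of \<omega> n] by (auto simp: not_less[symmetric])
    qed (use q(2) Xm in auto)
    also have "\<dots> < ennreal (2 * c)"
      using elim c(1) by (intro ennreal_lessI) auto
    finally show ?case .
  qed
qed

text \<open>
  Off two sets of small outer measure, \<open>X n\<close> is near a compact set of large mass and \<open>Y n\<close> is near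
  \<open>X n\<close>, so that a test function takes nearly the same value at both; on the two sets its
  oscillation is at most \<open>2 * B\<close>. This yields the upper bound for every test function, and the lower
  bound follows by passing to the negative test function.
\<close>

proposition converges_weakly_slutsky:
  assumes M: "prob_space M" and X: "converges_weakly M m X L" and L: "tight_law m L"
    and Y: "\<And>n \<omega>. \<omega> \<in> space M \<Longrightarrow> Y n \<omega> \<in> mspace m"
    and XY: "\<And>e. e > 0 \<Longrightarrow> (\<lambda>n. outer_measure_of M {\<omega>\<in>space M. e < mdist m (X n \<omega>) (Y n \<omega>)}) \<longlonglongrightarrow> 0"
  shows "converges_weakly M m Y L"
proof -
  have Xm: "X n \<omega> \<in> mspace m" if "\<omega> \<in> space M" for n \<omega>
    using X that by (auto simp: converges_weakly_def)
  have upper: "\<forall>\<^sub>F n in sequentially. outer_expectation M (\<lambda>\<omega>. h (Y n \<omega>)) \<le> integral\<^sup>L L h + e"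
    if h: "continuous_map (mtopology_of m) euclideanreal h" and B: "B > 0" "\<And>z. z \<in> mspace m \<Longrightarrow> \<bar>h z\<bar> \<le> B"
      and e: "e > 0" for h B and e :: real
  proof -
    \<comment> \<open>The error terms below add up to \<open>3 * c + 6 * B * c\<close>, and \<open>c < 1\<close> keeps the compact set nonempty.\<close>
    define c where "c = min (1/2) (e / (4 + 8 * B))"
    have c: "c > 0" "c \<le> 1/2" and ce: "4 * c + 8 * B * c \<le> e"
    proof -
      show "c > 0" using e B by (auto simp: c_def)
      show "c \<le> 1/2" unfolding c_def by (rule min.cobounded1)
      have "c \<le> e / (4 + 8 * B)" by (simp add: c_def)
      then show "4 * c + 8 * B * c \<le> e" using B by (simp add: field_simps)
    qed
    obtain K where K: "compactin (mtopology_of m) K" "measure L K \<ge> 1 - c"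
      using L c(1) by (auto simp: tight_law_def)
    obtain r where r: "r > 0" "\<And>z w. z \<in> K \<Longrightarrow> w \<in> mspace m \<Longrightarrow> mdist m z w < r \<Longrightarrow> \<bar>h z - h w\<bar> < c"
      using continuous_map_uniform_near_compact[OF h K(1) c(1)] by metis
    define A where "A n = {\<omega>\<in>space M. r/2 < mdist m (X n \<omega>) (Y n \<omega>)}" for n
    define E where "E n = {\<omega>\<in>space M. \<not> (\<exists>w\<in>K. mdist m w (X n \<omega>) < r/2)}" for n
    have 1: "\<forall>\<^sub>F n in sequentially. outer_measure_of M (E n) < ennreal (2 * c)"
      unfolding E_def using r(1) c by (intro converges_weakly_near_compact[OF M X L K]) auto
    have "(\<lambda>n. outer_expectation M (\<lambda>\<omega>. h (X n \<omega>))) \<longlonglongrightarrow> integral\<^sup>L L h"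
      using X h B(2) unfolding converges_weakly_def by (force simp: bounded_iff)
    then have 2: "\<forall>\<^sub>F n in sequentially. outer_expectation M (\<lambda>\<omega>. h (X n \<omega>)) < integral\<^sup>L L h + c"
      using c(1) by (intro order_tendstoD) auto
    have "(\<lambda>n. outer_measure_of M (A n)) \<longlonglongrightarrow> 0"
      unfolding A_def using r(1) by (intro XY) auto
    then have 3: "\<forall>\<^sub>F n in sequentially. outer_measure_of M (A n) < ennreal c"
      using c(1) by (intro order_tendstoD) auto
    show ?thesis
      using 1 2 3
    proof eventually_elim
      case (elim n)
      have "enn2real (outer_measure_of M (A n)) \<le> c"
        using elim(3) c(1) by (intro enn2real_leI) auto
      then have Ac: "outer_expectation M (indicator (A n)) \<le> c"
        using outer_expectation_indicator_le[OF M, of "A n"] by (auto simp: A_def)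
      have "enn2real (outer_measure_of M (E n)) \<le> 2 * c"
        using elim(1) c(1) by (intro enn2real_leI) auto
      then have Ec: "outer_expectation M (indicator (E n)) \<le> 2 * c"
        using outer_expectation_indicator_le[OF M, of "E n"] by (auto simp: E_def)
      have pw: "h (Y n \<omega>) \<le> h (X n \<omega>) + (2 * c + ((2 * B) * indicator (A n) \<omega> + (2 * B) * indicator (E n) \<omega>))"
        if \<omega>: "\<omega> \<in> space M" for \<omega>
      proof (cases "\<omega> \<in> A n \<or> \<omega> \<in> E n")
        case True
        have "2 * B \<le> (2 * B) * indicator (A n) \<omega> + (2 * B) * indicator (E n) \<omega>"
          using True B(1) by (auto simp: indicator_def)
        moreover have "h (Y n \<omega>) \<le> h (X n \<omega>) + 2 * B"
          using B(2)[OF Y[OF \<omega>, of n]] B(2)[OF Xm[OF \<omega>, of n]] by linarith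
        ultimately show ?thesis using c(1) by linarith
      next
        case False
        then obtain w where w: "w \<in> K" "mdist m w (X n \<omega>) < r/2"
          using \<omega> by (auto simp: E_def)
        have "mdist m (X n \<omega>) (Y n \<omega>) \<le> r/2" using False \<omega> by (auto simp: A_def)
        moreover have "mdist m w (Y n \<omega>) \<le> mdist m w (X n \<omega>) + mdist m (X n \<omega>) (Y n \<omega>)"
          using w(1) compactin_subset_topspace[OF K(1)] Xm[OF \<omega>] Y[OF \<omega>] by (intro mdist_triangle) auto
        ultimately have "mdist m w (Y n \<omega>) < r" using w(2) by linarith
        then have "\<bar>h w - h (Y n \<omega>)\<bar> < c" using r(2) w(1) Y[OF \<omega>] by auto
        moreover have "\<bar>h w - h (X n \<omega>)\<bar> < c" using r w Xm[OF \<omega>] by auto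
        moreover have "0 \<le> (2 * B) * indicator (A n) \<omega> + (2 * B) * indicator (E n) \<omega>"
          using B(1) by (simp add: indicator_def)
        ultimately show ?thesis by linarith
      qed
      define S1 where "S1 \<omega> = (2 * B) * (indicator (A n) \<omega> :: real)" for \<omega>
      define S2 where "S2 \<omega> = (2 * B) * (indicator (E n) \<omega> :: real)" for \<omega>
      have b1: "\<bar>S1 \<omega>\<bar> \<le> 2 * B" if "\<omega> \<in> space M" for \<omega>
        using B(1) by (auto simp: S1_def indicator_def)
      have b2: "\<bar>S2 \<omega>\<bar> \<le> 2 * B" if "\<omega> \<in> space M" for \<omega>
        using B(1) by (auto simp: S2_def indicator_def)
      have bX: "\<bar>h (X n \<omega>)\<bar> \<le> B" if "\<omega> \<in> space M" for \<omega> using B(2) Xm that by auto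
      have b12: "\<bar>S1 \<omega> + S2 \<omega>\<bar> \<le> 4 * B" if "\<omega> \<in> space M" for \<omega> using b1[OF that] b2[OF that] by linarith
      have bc: "\<bar>2 * c + (S1 \<omega> + S2 \<omega>)\<bar> \<le> 2 * c + 4 * B" if "\<omega> \<in> space M" for \<omega>
        using b12[OF that] c(1) by linarith
      have e1: "outer_expectation M S1 \<le> 2 * B * c"
      proof -
        have "outer_expectation M S1 \<le> (2 * B) * outer_expectation M (indicator (A n))"
          unfolding S1_def using B(1) by (intro outer_expectation_cmult_le[OF M, where B=1]) (auto simp: indicator_def)
        also have "\<dots> \<le> 2 * B * c" using Ac B(1) by (intro mult_left_mono) auto
        finally show ?thesis .
      qed
      have e2: "outer_expectation M S2 \<le> 4 * B * c"
      proof -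
        have "outer_expectation M S2 \<le> (2 * B) * outer_expectation M (indicator (E n))"
          unfolding S2_def using B(1) by (intro outer_expectation_cmult_le[OF M, where B=1]) (auto simp: indicator_def)
        also have "\<dots> \<le> (2 * B) * (2 * c)" using Ec B(1) by (intro mult_left_mono) auto
        finally show ?thesis by simp
      qed
      have bY: "\<bar>h (Y n \<omega>)\<bar> \<le> B" if "\<omega> \<in> space M" for \<omega> using B(2) Y that by auto
      have s1: "outer_expectation M (\<lambda>\<omega>. h (Y n \<omega>)) \<le> outer_expectation M (\<lambda>\<omega>. h (X n \<omega>) + (2 * c + (S1 \<omega> + S2 \<omega>)))"
      proof (rule outer_expectation_mono[OF M bY])
        show "h (X n \<omega>) + (2 * c + (S1 \<omega> + S2 \<omega>)) \<le> B + (2 * c + 4 * B)" if "\<omega> \<in> space M" for \<omega>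
          using bX[OF that] bc[OF that] by linarith
        show "h (Y n \<omega>) \<le> h (X n \<omega>) + (2 * c + (S1 \<omega> + S2 \<omega>))" if "\<omega> \<in> space M" for \<omega>
          using pw[OF that] by (simp add: S1_def S2_def)
      qed
      have s2: "outer_expectation M (\<lambda>\<omega>. h (X n \<omega>) + (2 * c + (S1 \<omega> + S2 \<omega>)))
          \<le> outer_expectation M (\<lambda>\<omega>. h (X n \<omega>)) + outer_expectation M (\<lambda>\<omega>. 2 * c + (S1 \<omega> + S2 \<omega>))"
        by (rule outer_expectation_add_le[OF M bX bc])
      have s3: "outer_expectation M (\<lambda>\<omega>. 2 * c + (S1 \<omega> + S2 \<omega>))
          \<le> outer_expectation M (\<lambda>\<omega>. 2 * c) + outer_expectation M (\<lambda>\<omega>. S1 \<omega> + S2 \<omega>)"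
        by (rule outer_expectation_add_le[OF M order_refl b12])
      have s4: "outer_expectation M (\<lambda>\<omega>. S1 \<omega> + S2 \<omega>) \<le> outer_expectation M S1 + outer_expectation M S2"
        by (rule outer_expectation_add_le[OF M b1 b2])
      have s5: "outer_expectation M (\<lambda>\<omega>. 2 * c) = 2 * c"
        by (rule outer_expectation_const[OF M])
      have s6: "0 \<le> B * c" using B(1) c(1) by simp
      show ?case
        using s1 s2 s3 s4 s5 s6 e1 e2 elim(2) ce c(1) by linarith
    qed
  qed
  show ?thesis
    unfolding converges_weakly_def
  proof (intro conjI allI ballI impI Y)
    fix h assume h: "continuous_map (mtopology_of m) euclideanreal h \<and> bounded (h ` mspace m)"
    then obtain B where B: "B > 0" "\<And>z. z \<in> mspace m \<Longrightarrow> \<bar>h z\<bar> \<le> B"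
      by (auto simp: bounded_pos)
    have h': "continuous_map (mtopology_of m) euclideanreal (\<lambda>z. - h z)"
      using h by (auto intro: continuous_map_minus)
    show "(\<lambda>n. outer_expectation M (\<lambda>\<omega>. h (Y n \<omega>))) \<longlonglongrightarrow> integral\<^sup>L L h"
    proof (rule tendstoI)
      fix e :: real assume e: "e > 0"
      have "\<forall>\<^sub>F n in sequentially. outer_expectation M (\<lambda>\<omega>. h (Y n \<omega>)) \<le> integral\<^sup>L L h + e/2"
        using h e by (intro upper[OF _ B]) auto
      moreover have "\<forall>\<^sub>F n in sequentially. outer_expectation M (\<lambda>\<omega>. - h (Y n \<omega>)) \<le> (\<integral>z. - h z \<partial>L) + e/2"
        using B e by (intro upper[OF h' B(1)]) auto
      ultimately show "\<forall>\<^sub>F n in sequentially. dist (outer_expectation M (\<lambda>\<omega>. h (Y n \<omega>))) (integral\<^sup>L L h) < e"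
      proof eventually_elim
        case (elim n)
        have "- outer_expectation M (\<lambda>\<omega>. - h (Y n \<omega>)) \<le> outer_expectation M (\<lambda>\<omega>. h (Y n \<omega>))"
          using B(2) Y by (intro inner_le_outer_expectation[OF M, where B=B]) auto
        then show ?case using elim e by (auto simp: dist_real_def)
      qed
    qed
  qed
qed

section \<open>Tight Brownian bridges\<close>

lemma normal_law_second_moment:
  assumes X: "X \<in> borel_measurable L" "distr L borel X = normal_law 0 \<sigma>" and "\<sigma> \<ge> 0"
  shows "integrable L (\<lambda>z. (X z)\<^sup>2)" "(\<integral>z. (X z)\<^sup>2 \<partial>L) = \<sigma>\<^sup>2"
proof -
  have "has_bochner_integral (normal_law 0 \<sigma>) (\<lambda>x. x\<^sup>2) (\<sigma>\<^sup>2)"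
  proof (cases "\<sigma> = 0")
    case True
    then show ?thesis
      by (simp add: normal_law_def has_bochner_integral_iff integral_return
          integrable_iff_bounded nn_integral_return)
  next
    case False
    then have "\<sigma> > 0" using assms(3) by simp
    then have "has_bochner_integral lborel (\<lambda>x. normal_density 0 \<sigma> x * (x - 0) ^ (2 * 1)) (fact (2 * 1) / ((2 / \<sigma>\<^sup>2) ^ 1 * fact 1))"
      by (rule normal_moment_even)
    then have "has_bochner_integral lborel (\<lambda>x. normal_density 0 \<sigma> x *\<^sub>R x\<^sup>2) (\<sigma>\<^sup>2)"
      by simp
    then show ?thesis
      using False by (simp add: normal_law_def has_bochner_integral_density)
  qed
  then have "has_bochner_integral (distr L borel X) (\<lambda>x. x\<^sup>2) (\<sigma>\<^sup>2)"
    by (simp add: X(2))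
  then have "has_bochner_integral L (\<lambda>z. (X z)\<^sup>2) (\<sigma>\<^sup>2)"
    using X(1) by (simp add: has_bochner_integral_iff integral_distr integrable_distr_eq)
  then show "integrable L (\<lambda>z. (X z)\<^sup>2)" "(\<integral>z. (X z)\<^sup>2 \<partial>L) = \<sigma>\<^sup>2"
    by (auto simp: has_bochner_integral_iff)
qed

text \<open>
  The centered normal density is at most \<open>1 / (\<sigma> * sqrt (2 * pi)) \<le> 1 / (2 * \<sigma>)\<close>. The product form
  of the conclusion also covers the point mass \<open>\<sigma> = 0\<close>.
\<close>

lemma normal_law_small_ball:
  assumes "prob_space L" and X: "X \<in> borel_measurable L" "distr L borel X = normal_law 0 \<sigma>"
    and "\<sigma> \<ge> 0" "a \<ge> 0"
  shows "measure L {z\<in>space L. \<bar>X z\<bar> \<le> a} * \<sigma> \<le> a"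
proof (cases "\<sigma> = 0")
  case True
  then show ?thesis using assms by simp
next
  case False
  then have \<sigma>: "\<sigma> > 0" using assms by simp
  interpret prob_space L by fact
  have dens: "normal_density 0 \<sigma> x \<le> 1 / (2 * \<sigma>)" for x
  proof -
    have "2 \<le> sqrt (2 * pi)"
      using pi_gt3 by (intro real_le_rsqrt) auto
    then have "2 * \<sigma> \<le> sqrt (2 * pi) * \<sigma>" using \<sigma> by (intro mult_right_mono) auto
    then have "1 / sqrt (2 * pi * \<sigma>\<^sup>2) \<le> 1 / (2 * \<sigma>)"
      using \<sigma> by (intro divide_left_mono) (auto simp: real_sqrt_mult)
    moreover have "exp (- x\<^sup>2 / (2 * \<sigma>\<^sup>2)) \<le> 1" by simp
    ultimately have "1 / sqrt (2 * pi * \<sigma>\<^sup>2) * exp (- x\<^sup>2 / (2 * \<sigma>\<^sup>2)) \<le> 1 / (2 * \<sigma>) * 1"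
      using \<sigma> by (intro mult_mono) auto
    then show ?thesis by (simp add: normal_density_def)
  qed
  have "emeasure L {z\<in>space L. \<bar>X z\<bar> \<le> a} = emeasure (distr L borel X) {-a..a}"
    using X(1) by (subst emeasure_distr) (auto intro!: arg_cong[where f="emeasure L"] simp: abs_le_iff)
  also have "\<dots> = (\<integral>\<^sup>+x. ennreal (normal_density 0 \<sigma> x) * indicator {-a..a} x \<partial>lborel)"
    using False by (simp add: X(2) normal_law_def emeasure_density)
  also have "\<dots> \<le> (\<integral>\<^sup>+x. ennreal (1 / (2 * \<sigma>)) * indicator {-a..a} x \<partial>lborel)"
    using dens by (intro nn_integral_mono mult_right_mono ennreal_leI) auto
  also have "\<dots> = ennreal (1 / (2 * \<sigma>)) * ennreal (2 * a)"
    using \<open>a \<ge> 0\<close> by (subst nn_integral_cmult_indicator) auto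
  also have "\<dots> = ennreal (a / \<sigma>)"
    using \<sigma> \<open>a \<ge> 0\<close> by (subst ennreal_mult[symmetric]) auto
  finally have "measure L {z\<in>space L. \<bar>X z\<bar> \<le> a} \<le> a / \<sigma>"
    using \<sigma> \<open>a \<ge> 0\<close> by (simp add: emeasure_eq_measure)
  then show ?thesis using \<sigma> by (simp add: field_simps)
qed

lemma eval_continuous_map:
  assumes "t \<in> T"
  shows "continuous_map (mtopology_of (linf T)) euclideanreal (\<lambda>z. z t)"
proof -
  have "Lipschitz_continuous_map (linf T) euclidean_metric (\<lambda>z. z t)"
    unfolding Lipschitz_continuous_map_def
    using abs_diff_le_mdist_linf[OF _ _ assms] by (intro conjI exI[of _ 1]) (auto simp: dist_real_def)
  then show ?thesis
    using Lipschitz_continuous_imp_continuous_map by fastforce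
qed

lemma integrable_mult_of_squares:
  fixes f g :: "'a \<Rightarrow> real"
  assumes [measurable]: "f \<in> borel_measurable M" "g \<in> borel_measurable M"
    and "integrable M (\<lambda>x. (f x)\<^sup>2)" "integrable M (\<lambda>x. (g x)\<^sup>2)"
  shows "integrable M (\<lambda>x. f x * g x)"
proof (rule Bochner_Integration.integrable_bound)
  show "integrable M (\<lambda>x. (f x)\<^sup>2 + (g x)\<^sup>2)" using assms by auto
  have "2 * (\<bar>a\<bar> * \<bar>b\<bar>) \<le> a\<^sup>2 + b\<^sup>2" for a b :: real
    using sum_squares_bound[of "\<bar>a\<bar>" "\<bar>b\<bar>"] by (simp add: mult.assoc)
  moreover have "0 \<le> \<bar>a\<bar> * \<bar>b\<bar>" for a b :: real by simp
  ultimately have "\<bar>a\<bar> * \<bar>b\<bar> \<le> a\<^sup>2 + b\<^sup>2" for a b :: real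
    by (smt (verit))
  then show "AE x in M. norm (f x * g x) \<le> norm ((f x)\<^sup>2 + (g x)\<^sup>2)"
    by (auto simp: abs_mult intro!: AE_I2)
qed auto

lemma integral_square_diff:
  fixes f g :: "'a \<Rightarrow> real"
  assumes [measurable]: "f \<in> borel_measurable M" "g \<in> borel_measurable M"
    and "integrable M (\<lambda>x. (f x)\<^sup>2)" "integrable M (\<lambda>x. (g x)\<^sup>2)"
  shows "integrable M (\<lambda>x. (f x - g x)\<^sup>2)"
    "(\<integral>x. (f x - g x)\<^sup>2 \<partial>M) = (\<integral>x. f x * f x \<partial>M) - 2 * (\<integral>x. f x * g x \<partial>M) + (\<integral>x. g x * g x \<partial>M)"
proof -
  have eq: "(f x - g x)\<^sup>2 = f x * f x - 2 * (f x * g x) + g x * g x" for x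
    by (simp add: power2_eq_square algebra_simps)
  have i: "integrable M (\<lambda>x. f x * g x)" "integrable M (\<lambda>x. f x * f x)" "integrable M (\<lambda>x. g x * g x)"
    using integrable_mult_of_squares[OF assms] assms(3,4) by (auto simp: power2_eq_square)
  show "integrable M (\<lambda>x. (f x - g x)\<^sup>2)" unfolding eq using i by auto
  show "(\<integral>x. (f x - g x)\<^sup>2 \<partial>M) = (\<integral>x. f x * f x \<partial>M) - 2 * (\<integral>x. f x * g x \<partial>M) + (\<integral>x. g x * g x \<partial>M)"
    unfolding eq using i by simp
qed

text \<open>
  Gaussianity is what makes the covariance formula usable: it provides the square integrability under
  \<open>L\<close> that is needed to expand the square of an increment.
\<close>

lemma tight_brownian_bridge_increment:
  assumes L: "tight_brownian_bridge_law P T L" and st: "s \<in> T" "t \<in> T"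
    and T: "\<And>u. u \<in> T \<Longrightarrow> u \<in> borel_measurable P \<and> integrable P (\<lambda>x. (u x)\<^sup>2)"
  obtains \<sigma> where "\<sigma> \<ge> 0" "distr L borel (\<lambda>z. z s - z t) = normal_law 0 \<sigma>"
    "\<sigma>\<^sup>2 = (\<integral>x. (s x - t x)\<^sup>2 \<partial>P) - ((\<integral>x. s x \<partial>P) - (\<integral>x. t x \<partial>P))\<^sup>2"
proof -
  have tl: "tight_law (linf T) L" and gl: "centered_gaussian_law T L"
    and cov: "\<And>u v. u \<in> T \<Longrightarrow> v \<in> T \<Longrightarrow> (\<integral>z. z u * z v \<partial>L) =
        (\<integral>x. u x * v x \<partial>P) - (\<integral>x. u x \<partial>P) * (\<integral>x. v x \<partial>P)"
    using L by (auto simp: tight_brownian_bridge_law_def)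
  have meas: "(\<lambda>z. z u) \<in> borel_measurable L" if "u \<in> T" for u
    using continuous_map_borel_measurable[OF eval_continuous_map[OF that]] tl by (auto simp: tight_law_def)
  have sq: "integrable L (\<lambda>z. (z u)\<^sup>2)" if u: "u \<in> T" for u
  proof -
    have "\<exists>\<sigma>\<ge>0. distr L borel (\<lambda>z. \<Sum>t\<in>{u}. 1 * z t) = normal_law 0 \<sigma>"
      using gl u unfolding centered_gaussian_law_def
      by (elim allE[of _ "{u}"] allE[of _ "\<lambda>_. 1"]) auto
    then obtain \<sigma> where "\<sigma> \<ge> 0" "distr L borel (\<lambda>z. z u) = normal_law 0 \<sigma>" by auto
    then show ?thesis using normal_law_second_moment(1)[OF meas[OF u]] by auto
  qed
  have "\<exists>\<sigma>\<ge>0. distr L borel (\<lambda>z. z s - z t) = normal_law 0 \<sigma>"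
  proof (cases "s = t")
    case True
    have "\<exists>\<sigma>\<ge>0. distr L borel (\<lambda>z. \<Sum>t\<in>{s}. 0 * z t) = normal_law 0 \<sigma>"
      using gl st unfolding centered_gaussian_law_def
      by (elim allE[of _ "{s}"] allE[of _ "\<lambda>_. 0"]) auto
    with True show ?thesis by simp
  next
    case False
    have "\<exists>\<sigma>\<ge>0. distr L borel (\<lambda>z. \<Sum>u\<in>{s, t}. (if u = s then 1 else -1) * z u) = normal_law 0 \<sigma>"
      using gl st unfolding centered_gaussian_law_def
      by (elim allE[of _ "{s, t}"] allE[of _ "\<lambda>u. if u = s then 1 else -1"]) auto
    with False show ?thesis by simp
  qed
  then obtain \<sigma> where \<sigma>: "\<sigma> \<ge> 0" "distr L borel (\<lambda>z. z s - z t) = normal_law 0 \<sigma>" by auto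
  have "\<sigma>\<^sup>2 = (\<integral>z. (z s - z t)\<^sup>2 \<partial>L)"
    using normal_law_second_moment(2)[OF _ \<sigma>(2,1)] meas st by auto
  also have "\<dots> = (\<integral>z. z s * z s \<partial>L) - 2 * (\<integral>z. z s * z t \<partial>L) + (\<integral>z. z t * z t \<partial>L)"
    using meas sq st by (intro integral_square_diff) auto
  also have "\<dots> = (\<integral>x. (s x - t x)\<^sup>2 \<partial>P) - ((\<integral>x. s x \<partial>P) - (\<integral>x. t x \<partial>P))\<^sup>2"
    using T st by (subst integral_square_diff(2)) (auto simp: cov power2_eq_square algebra_simps)
  finally show thesis using that \<sigma> by blast
qed

text \<open>
  The cells of the partition are the level sets of \<open>lab\<close>. A finite net of \<open>K\<close> consists of bounded
  functions, so rounding their values to multiples of \<open>e/3\<close> leaves finitely many labels; points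
  of \<open>K\<close> differ from the net by less than \<open>e/3\<close>.
\<close>

lemma compact_linf_finite_labelling:
  assumes K: "compactin (mtopology_of (linf T)) K" and e: "e > 0"
  obtains lab :: "'t \<Rightarrow> ('t \<Rightarrow> real) \<Rightarrow> int" where "finite (lab ` T)"
    "\<And>z s t. z \<in> K \<Longrightarrow> s \<in> T \<Longrightarrow> t \<in> T \<Longrightarrow> lab s = lab t \<Longrightarrow> \<bar>z s - z t\<bar> \<le> e"
proof -
  interpret Metric_space "mspace (linf T)" "mdist (linf T)" by (rule Metric_space_mspace_mdist)
  have "mtotally_bounded K"
    using K by (intro compactin_imp_mtotally_bounded) (simp add: mtopology_of_def)
  then obtain N where N: "finite N" "N \<subseteq> K" "K \<subseteq> (\<Union>w\<in>N. mball w (e/3))"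
    using e unfolding mtotally_bounded_def by (metis divide_pos_pos zero_less_numeral)
  have Kb: "K \<subseteq> mspace (linf T)" using compactin_subset_topspace[OF K] by simp
  define lab where "lab t = (\<lambda>w\<in>N. \<lfloor>w t / (e/3)\<rfloor>)" for t
  have "\<exists>C. \<forall>t\<in>T. \<bar>w t\<bar> \<le> C" if "w \<in> N" for w
    using that N(2) Kb mspace_linf_iff[of w T] by blast
  then obtain C where C: "\<And>w t. w \<in> N \<Longrightarrow> t \<in> T \<Longrightarrow> \<bar>w t\<bar> \<le> C w" by metis
  have "lab ` T \<subseteq> (\<Pi>\<^sub>E w\<in>N. {\<lfloor>- C w / (e/3)\<rfloor>..\<lfloor>C w / (e/3)\<rfloor>})"
  proof (rule image_subsetI, rule PiE_I)
    fix t w assume t: "t \<in> T" and w: "w \<in> N"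
    have "- C w \<le> w t" "w t \<le> C w" using C[OF w t] by auto
    then have "- C w / (e/3) \<le> w t / (e/3)" "w t / (e/3) \<le> C w / (e/3)"
      using e by (auto simp only: intro!: divide_right_mono)
    from floor_mono[OF this(1)] floor_mono[OF this(2)]
    show "lab t w \<in> {\<lfloor>- C w / (e/3)\<rfloor>..\<lfloor>C w / (e/3)\<rfloor>}"
      using w by (simp add: lab_def)
  qed (simp add: lab_def)
  then have "finite (lab ` T)"
    by (rule finite_subset) (use N(1) in \<open>auto intro: finite_PiE\<close>)
  moreover have "\<bar>z s - z t\<bar> \<le> e" if z: "z \<in> K" and st: "s \<in> T" "t \<in> T" "lab s = lab t" for z s t
  proof -
    obtain w where "w \<in> N" "z \<in> mball w (e/3)" using N(3) z by blast
    then have w: "w \<in> N" "mdist (linf T) w z < e/3" by (simp_all only: in_mball)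
    have wz: "w \<in> mspace (linf T)" "z \<in> mspace (linf T)" using w N(2) Kb z by auto
    have "\<lfloor>w s / (e/3)\<rfloor> = \<lfloor>w t / (e/3)\<rfloor>"
      using fun_cong[OF st(3), of w] w(1) by (simp add: lab_def)
    then have "\<bar>w s / (e/3) - w t / (e/3)\<bar> < 1" by linarith
    then have "\<bar>w s - w t\<bar> / (e/3) < 1"
      using e by (simp only: diff_divide_distrib[symmetric] abs_divide abs_of_pos divide_pos_pos zero_less_numeral)
    then have "\<bar>w s - w t\<bar> < e/3"
      using e by (subst (asm) pos_divide_less_eq) auto
    moreover have "\<bar>w s - z s\<bar> < e/3" "\<bar>w t - z t\<bar> < e/3"
      using abs_diff_le_mdist_linf[OF wz st(1)] abs_diff_le_mdist_linf[OF wz st(2)] w(2) by auto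
    ultimately show ?thesis by linarith
  qed
  ultimately show thesis using that by blast
qed

text \<open>
  A partition adapted to a compact set of mass at least \<open>1/2\<close> works: for two indices in one cell,
  the increment is small with probability at least \<open>1/2\<close>, hence has small variance by
  \<open>normal_law_small_ball\<close>. The variance only sees functions up to constants, so the
  partition is refined according to the means.
\<close>

lemma tight_brownian_bridge_totally_bounded:
  fixes P :: "'x measure"
  assumes L: "tight_brownian_bridge_law P T L"
    and T: "\<And>u. u \<in> T \<Longrightarrow> u \<in> borel_measurable P \<and> integrable P (\<lambda>x. (u x)\<^sup>2)"
    and mean: "\<And>u. u \<in> T \<Longrightarrow> \<bar>\<integral>x. u x \<partial>P\<bar> \<le> C" and e: "e > 0"
  obtains T0 where "finite T0" "T0 \<subseteq> T" "\<And>s. s \<in> T \<Longrightarrow> \<exists>t\<in>T0. (\<integral>x. (s x - t x)\<^sup>2 \<partial>P) \<le> e"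
proof -
  have tl: "tight_law (linf T) L" using L by (simp add: tight_brownian_bridge_law_def)
  interpret L: prob_space L using tl by (simp add: tight_law_def)
  define r where "r = sqrt (e / 2)"
  have r: "r > 0" "r\<^sup>2 = e / 2" using e by (auto simp: r_def)
  obtain K where K: "compactin (mtopology_of (linf T)) K" "measure L K \<ge> 1 - 1/2"
    using tl unfolding tight_law_def by (metis half_gt_zero zero_less_one)
  obtain lab :: "('x \<Rightarrow> real) \<Rightarrow> (('x \<Rightarrow> real) \<Rightarrow> real) \<Rightarrow> int" where lab: "finite (lab ` T)"
    "\<And>z s t. z \<in> K \<Longrightarrow> s \<in> T \<Longrightarrow> t \<in> T \<Longrightarrow> lab s = lab t \<Longrightarrow> \<bar>z s - z t\<bar> \<le> r/2"
    using compact_linf_finite_labelling[OF K(1) half_gt_zero[OF r(1)]] by blast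
  define lab' where "lab' u = (lab u, \<lfloor>(\<integral>x. u x \<partial>P) / r\<rfloor>)" for u
  have "lab' ` T \<subseteq> lab ` T \<times> {\<lfloor>- C / r\<rfloor>..\<lfloor>C / r\<rfloor>}"
  proof (rule image_subsetI)
    fix u assume u: "u \<in> T"
    have "- C \<le> (\<integral>x. u x \<partial>P)" "(\<integral>x. u x \<partial>P) \<le> C" using mean[OF u] by auto
    then have "- C / r \<le> (\<integral>x. u x \<partial>P) / r" "(\<integral>x. u x \<partial>P) / r \<le> C / r"
      using r(1) by (auto simp only: intro!: divide_right_mono)
    from floor_mono[OF this(1)] floor_mono[OF this(2)]
    show "lab' u \<in> lab ` T \<times> {\<lfloor>- C / r\<rfloor>..\<lfloor>C / r\<rfloor>}" using u by (simp add: lab'_def)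
  qed
  then have fin: "finite (lab' ` T)" by (rule finite_subset) (use lab(1) in auto)
  have close: "(\<integral>x. (s x - t x)\<^sup>2 \<partial>P) \<le> e" if st: "s \<in> T" "t \<in> T" "lab' s = lab' t" for s t
  proof -
    obtain \<sigma> where \<sigma>: "\<sigma> \<ge> 0" "distr L borel (\<lambda>z. z s - z t) = normal_law 0 \<sigma>"
      "\<sigma>\<^sup>2 = (\<integral>x. (s x - t x)\<^sup>2 \<partial>P) - ((\<integral>x. s x \<partial>P) - (\<integral>x. t x \<partial>P))\<^sup>2"
      using tight_brownian_bridge_increment[OF L st(1,2) T] by blast
    have meas: "(\<lambda>z. z s - z t) \<in> borel_measurable L"
      using continuous_map_borel_measurable[OF eval_continuous_map[OF st(1)], of L]
        continuous_map_borel_measurable[OF eval_continuous_map[OF st(2)], of L] tl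
      by (auto simp: tight_law_def)
    have "K \<subseteq> {z\<in>space L. \<bar>z s - z t\<bar> \<le> r/2}"
      using lab(2) st compactin_subset_topspace[OF K(1)] space_tight_law[OF tl] by (auto simp: lab'_def)
    moreover have "{z\<in>space L. \<bar>z s - z t\<bar> \<le> r/2} \<in> sets L"
      using meas by measurable
    ultimately have "1/2 \<le> measure L {z\<in>space L. \<bar>z s - z t\<bar> \<le> r/2}"
      using K(2) L.finite_measure_mono[of K "{z\<in>space L. \<bar>z s - z t\<bar> \<le> r/2}"] by linarith
    then have "1/2 * \<sigma> \<le> measure L {z\<in>space L. \<bar>z s - z t\<bar> \<le> r/2} * \<sigma>"
      using \<sigma>(1) by (intro mult_right_mono) auto
    also have "\<dots> \<le> r/2"
      by (rule normal_law_small_ball[OF L.prob_space_axioms meas \<sigma>(2,1)]) (use r(1) in simp)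
    finally have "\<sigma> \<le> r" by simp
    then have v: "\<sigma>\<^sup>2 \<le> r\<^sup>2" using \<sigma>(1) by (intro power_mono) auto
    have "\<lfloor>(\<integral>x. s x \<partial>P) / r\<rfloor> = \<lfloor>(\<integral>x. t x \<partial>P) / r\<rfloor>" using st(3) by (simp add: lab'_def)
    then have "\<bar>(\<integral>x. s x \<partial>P) / r - (\<integral>x. t x \<partial>P) / r\<bar> < 1" by linarith
    then have "\<bar>(\<integral>x. s x \<partial>P) - (\<integral>x. t x \<partial>P)\<bar> \<le> \<bar>r\<bar>"
      using r(1) by (simp add: diff_divide_distrib[symmetric] abs_divide field_simps)
    then have "((\<integral>x. s x \<partial>P) - (\<integral>x. t x \<partial>P))\<^sup>2 \<le> r\<^sup>2"
      by (simp add: abs_le_square_iff)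
    with v show ?thesis using \<sigma>(3) r(2) by linarith
  qed
  define rep where "rep l = (SOME u. u \<in> T \<and> lab' u = l)" for l
  have rep: "rep (lab' s) \<in> T \<and> lab' (rep (lab' s)) = lab' s" if "s \<in> T" for s
    unfolding rep_def using that by (intro someI[of "\<lambda>u. u \<in> T \<and> lab' u = lab' s" s]) auto
  show thesis
  proof (rule that[of "rep ` lab' ` T"])
    show "finite (rep ` lab' ` T)" using fin by auto
    show "rep ` lab' ` T \<subseteq> T" using rep by auto
    show "\<exists>t\<in>rep ` lab' ` T. (\<integral>x. (s x - t x)\<^sup>2 \<partial>P) \<le> e" if "s \<in> T" for s
      using close[OF that, of "rep (lab' s)"] rep[OF that] that by auto
  qed
qed

text \<open>
  The finite partition comes from a compact set alone, and \<open>\<delta>\<close> is chosen afterwards in terms of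
  the number of pairs of cells. Every pair of cells that contains some pair of indices with
  squared distance at most \<open>\<delta>\<close> contributes one exceptional set, of small mass by Chebyshev's
  inequality. These sets are open, so removing them leaves a compact set.
\<close>

lemma tight_brownian_bridge_equicontinuous:
  fixes P :: "'x measure"
  assumes L: "tight_brownian_bridge_law P T L"
    and T: "\<And>u. u \<in> T \<Longrightarrow> u \<in> borel_measurable P \<and> integrable P (\<lambda>x. (u x)\<^sup>2)"
    and e: "e > 0"
  obtains \<delta> K where "\<delta> > 0" "compactin (mtopology_of (linf T)) K" "measure L K \<ge> 1 - e"
    "\<And>z s t. z \<in> K \<Longrightarrow> s \<in> T \<Longrightarrow> t \<in> T \<Longrightarrow> (\<integral>x. (s x - t x)\<^sup>2 \<partial>P) \<le> \<delta> \<Longrightarrow> \<bar>z s - z t\<bar> \<le> e"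
proof -
  have tl: "tight_law (linf T) L" using L by (simp add: tight_brownian_bridge_law_def)
  interpret L: prob_space L using tl by (simp add: tight_law_def)
  have sL: "sets L = sets (metric_borel (linf T))" using tl by (simp add: tight_law_def)
  obtain K where K: "compactin (mtopology_of (linf T)) K" "measure L K \<ge> 1 - e/2"
    using tl e unfolding tight_law_def by (metis half_gt_zero)
  have KL: "K \<in> sets L" using compactin_sets_metric_borel[OF K(1)] sL by simp
  obtain lab :: "('x \<Rightarrow> real) \<Rightarrow> (('x \<Rightarrow> real) \<Rightarrow> real) \<Rightarrow> int" where lab: "finite (lab ` T)"
    "\<And>z s t. z \<in> K \<Longrightarrow> s \<in> T \<Longrightarrow> t \<in> T \<Longrightarrow> lab s = lab t \<Longrightarrow> \<bar>z s - z t\<bar> \<le> e/4"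
    using compact_linf_finite_labelling[OF K(1) divide_pos_pos[OF e zero_less_numeral]] by blast
  define R where "R = lab ` T \<times> lab ` T"
  have finR: "finite R" using lab(1) by (simp add: R_def)
  \<comment> \<open>Chebyshev bounds each of the at most \<open>card R\<close> exceptional sets by \<open>\<delta> / (e/2)\<^sup>2\<close>; their total has to be at most \<open>e/2\<close>.\<close>
  define \<delta> where "\<delta> = (e/2)\<^sup>2 * (e / (2 * (real (card R) + 1)))"
  have \<delta>: "\<delta> > 0" unfolding \<delta>_def using e by (intro mult_pos_pos divide_pos_pos) auto
  define A where "A = {(s, t). s \<in> T \<and> t \<in> T \<and> (\<integral>x. (s x - t x)\<^sup>2 \<partial>P) \<le> \<delta>}"
  define lab2 where "lab2 = (\<lambda>(s, t). (lab s, lab t))"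
  define rep where "rep l = (SOME p. p \<in> A \<and> lab2 p = l)" for l
  have rep: "rep (lab2 p) \<in> A \<and> lab2 (rep (lab2 p)) = lab2 p" if "p \<in> A" for p
    unfolding rep_def using that by (intro someI[of "\<lambda>q. q \<in> A \<and> lab2 q = lab2 p" p]) auto
  define Q where "Q = rep ` (lab2 ` A)"
  have "lab2 ` A \<subseteq> R" by (auto simp: A_def R_def lab2_def)
  then have finQ: "finite Q" and cardQ: "card Q \<le> card R"
    unfolding Q_def using finR finite_subset[of "lab2 ` A" R] card_mono[of R "lab2 ` A"] card_image_le[of "lab2 ` A" rep]
    by auto
  have QA: "Q \<subseteq> A" using rep by (auto simp: Q_def)
  define B where "B = (\<lambda>(s, t). {z\<in>mspace (linf T). e/2 < \<bar>z s - z t\<bar>})"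
  have Bopen: "openin (mtopology_of (linf T)) (B p)" if "p \<in> A" for p
  proof -
    obtain s t where p: "p = (s, t)" "s \<in> T" "t \<in> T" using \<open>p \<in> A\<close> by (auto simp: A_def)
    have "continuous_map (mtopology_of (linf T)) euclideanreal (\<lambda>z. \<bar>z s - z t\<bar>)"
      by (intro continuous_map_real_abs continuous_map_diff eval_continuous_map p)
    from openin_continuous_map_preimage[OF this, of "{e/2<..}"]
    show ?thesis by (simp add: B_def p(1) del: mspace_funspace)
  qed
  have BL: "B p \<in> sets L" if "p \<in> A" for p
    using sets_metric_borel[OF Bopen[OF that]] sL by simp
  have Bm: "measure L (B p) \<le> \<delta> / (e/2)\<^sup>2" if "p \<in> A" for p
  proof -
    obtain s t where p: "p = (s, t)" "s \<in> T" "t \<in> T" "(\<integral>x. (s x - t x)\<^sup>2 \<partial>P) \<le> \<delta>"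
      using \<open>p \<in> A\<close> by (auto simp: A_def)
    obtain \<sigma> where \<sigma>: "\<sigma> \<ge> 0" "distr L borel (\<lambda>z. z s - z t) = normal_law 0 \<sigma>"
      "\<sigma>\<^sup>2 = (\<integral>x. (s x - t x)\<^sup>2 \<partial>P) - ((\<integral>x. s x \<partial>P) - (\<integral>x. t x \<partial>P))\<^sup>2"
      using tight_brownian_bridge_increment[OF L p(2,3) T] by blast
    have [measurable]: "(\<lambda>z. z s - z t) \<in> borel_measurable L"
      using continuous_map_borel_measurable[OF eval_continuous_map[OF p(2)], of L]
        continuous_map_borel_measurable[OF eval_continuous_map[OF p(3)], of L] sL
      by auto
    have mom: "integrable L (\<lambda>z. (z s - z t)\<^sup>2)" "(\<integral>z. (z s - z t)\<^sup>2 \<partial>L) = \<sigma>\<^sup>2"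
      using normal_law_second_moment[OF _ \<sigma>(2,1)] by auto
    have "B p = {z\<in>space L. e/2 < \<bar>z s - z t\<bar>}" using space_tight_law[OF tl] by (simp add: B_def p(1))
    also have "\<dots> \<subseteq> {z\<in>space L. (z s - z t)\<^sup>2 \<ge> (e/2)\<^sup>2}"
      using e by (auto simp: abs_le_square_iff[symmetric])
    finally have "measure L (B p) \<le> measure L {z\<in>space L. (z s - z t)\<^sup>2 \<ge> (e/2)\<^sup>2}"
      by (intro L.finite_measure_mono) measurable
    also have "\<dots> \<le> (\<integral>z. (z s - z t)\<^sup>2 \<partial>L) / (e/2)\<^sup>2"
      using mom(1) e by (intro integral_Markov_inequality_measure[where A="{}"]) auto
    also have "\<dots> \<le> \<delta> / (e/2)\<^sup>2"
    proof (rule divide_right_mono)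
      have "0 \<le> ((\<integral>x. s x \<partial>P) - (\<integral>x. t x \<partial>P))\<^sup>2" by simp
      then show "(\<integral>z. (z s - z t)\<^sup>2 \<partial>L) \<le> \<delta>" unfolding mom(2) \<sigma>(3) using p(4) by linarith
    qed simp
    finally show ?thesis .
  qed
  define K' where "K' = K - (\<Union>p\<in>Q. B p)"
  have K'eq: "K' = K \<inter> (mspace (linf T) - (\<Union>p\<in>Q. B p))"
    using compactin_subset_topspace[OF K(1)] by (auto simp: K'_def)
  have "compactin (mtopology_of (linf T)) K'"
  proof -
    have "openin (mtopology_of (linf T)) (\<Union>p\<in>Q. B p)" using Bopen QA by blast
    then have "closedin (mtopology_of (linf T)) (mspace (linf T) - (\<Union>p\<in>Q. B p))"
      by (metis closedin_diff closedin_topspace topspace_mtopology_of)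
    then show ?thesis unfolding K'eq by (rule compact_Int_closedin[OF K(1)])
  qed
  moreover have "measure L K' \<ge> 1 - e"
  proof -
    have UL: "(\<Union>p\<in>Q. B p) \<in> sets L" using BL QA by (intro sets.finite_UN finQ) blast
    have "measure L (\<Union>p\<in>Q. B p) \<le> (\<Sum>p\<in>Q. measure L (B p))"
      using BL QA finQ by (intro L.finite_measure_subadditive_finite) auto
    also have "\<dots> \<le> card Q * (\<delta> / (e/2)\<^sup>2)"
      using Bm QA by (intro sum_bounded_above) auto
    also have "\<dots> \<le> (real (card R) + 1) * (\<delta> / (e/2)\<^sup>2)"
      using cardQ \<delta> by (intro mult_right_mono) auto
    also have "\<dots> = e/2"
    proof -
      have "\<delta> / (e/2)\<^sup>2 = e / (2 * (real (card R) + 1))" using e by (simp add: \<delta>_def)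
      moreover have "r * (e / (2 * r)) = e / 2" if "r > 0" for r :: real using that by simp
      from this[of "real (card R) + 1"]
      have "(real (card R) + 1) * (e / (2 * (real (card R) + 1))) = e / 2" by linarith
      ultimately show ?thesis by (simp only:)
    qed
    finally have "measure L (\<Union>p\<in>Q. B p) \<le> e/2" .
    moreover have "measure L K \<le> measure L K' + measure L (\<Union>p\<in>Q. B p)"
    proof -
      have "K' \<in> sets L" unfolding K'_def using KL UL by (rule sets.Diff)
      moreover have "measure L K \<le> measure L (K' \<union> (\<Union>p\<in>Q. B p))"
        using calculation UL by (intro L.finite_measure_mono sets.Un) (auto simp only: K'_def)
      ultimately show ?thesis using measure_Un_le[OF _ UL, of K'] by linarith
    qed
    ultimately show ?thesis using K(2) by linarith
  qed
  moreover have "\<bar>z s - z t\<bar> \<le> e"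
    if z: "z \<in> K'" and st: "s \<in> T" "t \<in> T" "(\<integral>x. (s x - t x)\<^sup>2 \<partial>P) \<le> \<delta>" for z s t
  proof -
    have "(s, t) \<in> A" using st by (simp add: A_def)
    from rep[OF this] obtain s' t' where r: "rep (lab2 (s, t)) = (s', t')" "(s', t') \<in> A" "lab s' = lab s" "lab t' = lab t"
      by (cases "rep (lab2 (s, t))") (auto simp: lab2_def)
    have "(s', t') \<in> Q" using r(1) \<open>(s, t) \<in> A\<close> by (force simp: Q_def)
    then have "z \<notin> B (s', t')" using z by (auto simp: K'_def)
    moreover have "z \<in> mspace (linf T)" using z K'eq by auto
    ultimately have "\<bar>z s' - z t'\<bar> \<le> e/2" by (auto simp: B_def)
    moreover have "\<bar>z s' - z s\<bar> \<le> e/4" "\<bar>z t' - z t\<bar> \<le> e/4"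
      using lab(2)[of z s' s] lab(2)[of z t' t] z st r(2-4) by (auto simp: K'_def A_def)
    ultimately show ?thesis by linarith
  qed
  ultimately show thesis using that[OF \<delta>] by blast
qed

text \<open>
  Closeness in \<open>\<ell>\<^sub>\<infinity>(T)\<close> to a function with small increments transfers the bound on increments, at the
  price of twice the distance. So it suffices that \<open>X n\<close> is near the compact set of
  \<open>tight_brownian_bridge_equicontinuous\<close>.
\<close>

proposition converges_weakly_asymptotic_equicontinuity:
  assumes M: "prob_space M" and X: "converges_weakly M (linf T) X L"
    and L: "tight_brownian_bridge_law P T L"
    and T: "\<And>u. u \<in> T \<Longrightarrow> u \<in> borel_measurable P \<and> integrable P (\<lambda>x. (u x)\<^sup>2)"
    and e: "e > 0"
  obtains \<delta> where "\<delta> > 0"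
    "\<forall>\<^sub>F n in sequentially. outer_measure_of M
       {\<omega>\<in>space M. \<exists>s\<in>T. \<exists>t\<in>T. (\<integral>x. (s x - t x)\<^sup>2 \<partial>P) \<le> \<delta> \<and> e < \<bar>X n \<omega> s - X n \<omega> t\<bar>} < ennreal e"
proof -
  have tl: "tight_law (linf T) L" using L by (simp add: tight_brownian_bridge_law_def)
  have Xm: "X n \<omega> \<in> mspace (linf T)" if "\<omega> \<in> space M" for n \<omega>
    using X that unfolding converges_weakly_def by blast
  define c where "c = min (e/3) (1/2)"
  have c: "c > 0" "c < 1" "c \<le> e/3" using e by (auto simp: c_def min_def)
  obtain \<delta> K where K: "\<delta> > 0" "compactin (mtopology_of (linf T)) K" "measure L K \<ge> 1 - c"
    "\<And>z s t. z \<in> K \<Longrightarrow> s \<in> T \<Longrightarrow> t \<in> T \<Longrightarrow> (\<integral>x. (s x - t x)\<^sup>2 \<partial>P) \<le> \<delta> \<Longrightarrow> \<bar>z s - z t\<bar> \<le> c"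
    using tight_brownian_bridge_equicontinuous[OF L T c(1)] by blast
  have "\<forall>\<^sub>F n in sequentially. outer_measure_of M
       {\<omega>\<in>space M. \<exists>s\<in>T. \<exists>t\<in>T. (\<integral>x. (s x - t x)\<^sup>2 \<partial>P) \<le> \<delta> \<and> e < \<bar>X n \<omega> s - X n \<omega> t\<bar>} < ennreal e"
    using converges_weakly_near_compact[OF M X tl K(2,3) c(1,2,1)]
  proof eventually_elim
    case (elim n)
    have "{\<omega>\<in>space M. \<exists>s\<in>T. \<exists>t\<in>T. (\<integral>x. (s x - t x)\<^sup>2 \<partial>P) \<le> \<delta> \<and> e < \<bar>X n \<omega> s - X n \<omega> t\<bar>}
      \<subseteq> {\<omega>\<in>space M. \<not> (\<exists>w\<in>K. mdist (linf T) w (X n \<omega>) < c)}"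
    proof (rule subsetI, rule CollectI, rule conjI)
      fix \<omega> assume "\<omega> \<in> {\<omega>\<in>space M. \<exists>s\<in>T. \<exists>t\<in>T. (\<integral>x. (s x - t x)\<^sup>2 \<partial>P) \<le> \<delta> \<and> e < \<bar>X n \<omega> s - X n \<omega> t\<bar>}"
      then obtain s t where \<omega>: "\<omega> \<in> space M" and st: "s \<in> T" "t \<in> T" "(\<integral>x. (s x - t x)\<^sup>2 \<partial>P) \<le> \<delta>"
        "e < \<bar>X n \<omega> s - X n \<omega> t\<bar>" by blast
      show "\<omega> \<in> space M" by fact
      show "\<not> (\<exists>w\<in>K. mdist (linf T) w (X n \<omega>) < c)"
      proof
        assume "\<exists>w\<in>K. mdist (linf T) w (X n \<omega>) < c"
        then obtain w where w: "w \<in> K" "mdist (linf T) w (X n \<omega>) < c" by blast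
        have wm: "w \<in> mspace (linf T)" using w(1) compactin_subset_topspace[OF K(2)] by auto
        show False
          using abs_diff_le_mdist_linf[OF wm Xm[OF \<omega>, of n] st(1)]
            abs_diff_le_mdist_linf[OF wm Xm[OF \<omega>, of n] st(2)]
            w(2) K(4)[OF w(1) st(1-3)] st(4) c(3) by linarith
      qed
    qed
    then have "outer_measure_of M {\<omega>\<in>space M. \<exists>s\<in>T. \<exists>t\<in>T. (\<integral>x. (s x - t x)\<^sup>2 \<partial>P) \<le> \<delta> \<and> e < \<bar>X n \<omega> s - X n \<omega> t\<bar>}
      \<le> outer_measure_of M {\<omega>\<in>space M. \<not> (\<exists>w\<in>K. mdist (linf T) w (X n \<omega>) < c)}"
      by (rule outer_measure_of_mono)
    also have "\<dots> < ennreal (2 * c)" by (rule elim)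
    also have "\<dots> \<le> ennreal e" using c by (intro ennreal_leI) auto
    finally show ?case .
  qed
  with K(1) show thesis by (rule that)
qed

section \<open>Continuity of translations\<close>

lemma nn_integral_lborel_shift:
  fixes h :: "real \<Rightarrow> ennreal"
  assumes "h \<in> borel_measurable borel"
  shows "(\<integral>\<^sup>+y. h (y + t) \<partial>lborel) = (\<integral>\<^sup>+y. h y \<partial>lborel)"
  using nn_integral_real_affine[of h 1 t] assms by (simp add: add.commute)

lemma integrable_lborel_shift:
  fixes h :: "real \<Rightarrow> real"
  assumes "integrable lborel h"
  shows "integrable lborel (\<lambda>y. h (y + t))"
  using lborel_integrable_real_affine[of h 1 t] assms by (simp add: add.commute)

lemma integral_lborel_shift:
  fixes h :: "real \<Rightarrow> real"
  shows "(\<integral>y. h (y + t) \<partial>lborel) = (\<integral>y. h y \<partial>lborel)"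
  using lborel_integral_real_affine[of 1 h t] by (simp add: add.commute)

text \<open>
  Squeeze \<open>A\<close> between a compact \<open>K\<close> and an open \<open>U\<close> of almost the same measure. Short translations
  map \<open>K\<close> into \<open>U\<close>, so the indicator can change only if \<open>y\<close> or \<open>y + t\<close> lies in \<open>U - K\<close>.
\<close>

lemma indicator_translation_L1_continuous:
  fixes A :: "real set"
  assumes A: "A \<in> sets borel" "emeasure lborel A < \<infinity>" and e: "e > 0"
  shows "\<exists>\<delta>>0. \<forall>t. \<bar>t\<bar> \<le> \<delta> \<longrightarrow>
           (\<integral>y. \<bar>indicator A (y + t) - indicator A y\<bar> \<partial>lborel) \<le> (e::real)"
proof -
  obtain U where U: "open U" "A \<subseteq> U" "emeasure lborel (U - A) < ennreal (e/4)"
    using outer_regular_lborel[OF A(1), of "e/4"] e by auto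
  let ?D = "density lborel (indicator A)"
  have em: "emeasure ?D X = emeasure lborel (A \<inter> X)" if "X \<in> sets borel" for X
    using that A(1) by (auto simp: emeasure_density indicator_inter_arith[symmetric])
  have fin: "emeasure ?D (space ?D) \<noteq> \<infinity>"
    using A by (simp add: em)
  have sup: "emeasure lborel A = (SUP K\<in>{K. K \<subseteq> A \<and> compact K}. emeasure ?D K)"
    using inner_regular[OF _ fin A(1)] A(1) by (simp add: em)
  have "\<exists>K\<in>{K. K \<subseteq> A \<and> compact K}. emeasure lborel A < emeasure ?D K + ennreal (e/4)"
  proof (rule SUP_approx_ennreal[OF _ _ sup])
    show "e/4 > 0" using e by simp
    have "{} \<in> {K. K \<subseteq> A \<and> compact K}" by simp
    then show "{K. K \<subseteq> A \<and> compact K} \<noteq> {}" by blast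
    show "emeasure lborel A \<noteq> \<infinity>" using A(2) by simp
  qed
  then obtain K where K: "K \<subseteq> A" "compact K" "emeasure lborel A < emeasure ?D K + ennreal (e/4)"
    by auto
  have Kb[measurable]: "K \<in> sets borel" "U \<in> sets borel" "A \<in> sets borel"
    using K(2) U(1) A(1) by (auto intro: borel_compact borel_open)
  have emK: "emeasure ?D K = emeasure lborel K"
    using K(1) Kb by (simp add: em Int_absorb1)
  have "emeasure lborel (A - K) \<le> ennreal (e/4)"
  proof -
    have "emeasure lborel K \<noteq> \<infinity>"
      using emeasure_mono[OF K(1), of lborel] A by (auto simp: top_unique)
    then have "emeasure lborel (A - K) = emeasure lborel A - emeasure lborel K"
      using K(1) Kb by (intro emeasure_Diff) auto
    also have "\<dots> \<le> ennreal (e/4)"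
      using K(3) A(2) by (auto simp: emK ennreal_minus_le_iff less_imp_le)
    finally show ?thesis .
  qed
  then have UK: "emeasure lborel (U - K) \<le> ennreal (e/2)"
  proof -
    have "U - K = (U - A) \<union> (A - K)" using U(2) K(1) by blast
    then have "emeasure lborel (U - K) \<le> emeasure lborel (U - A) + emeasure lborel (A - K)"
      using emeasure_subadditive[of "U - A" lborel "A - K"] Kb by (simp only: sets_lborel sets.Diff)
    also have "\<dots> \<le> ennreal (e/4) + ennreal (e/4)"
      using U(3) \<open>emeasure lborel (A - K) \<le> _\<close> by (intro add_mono) auto
    also have "\<dots> = ennreal (e/2)"
      using e by (subst ennreal_plus[symmetric]) auto
    finally show ?thesis .
  qed
  obtain \<delta> where d: "\<delta> > 0" "(\<Union>x\<in>K. cball x \<delta>) \<subseteq> U"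
  proof (cases "K = {}")
    case True
    then show thesis using that[of 1] by auto
  next
    case False
    then show thesis
      using compact_subset_open_imp_cball_epsilon_subset[OF K(2) U(1)] K(1) U(2) that by auto
  qed
  have int: "integrable lborel (indicator (U - K) :: real \<Rightarrow> real)"
    using UK by (intro integrable_real_indicator) (auto intro: le_less_trans)
  have m: "measure lborel (U - K) \<le> e/2"
    unfolding measure_def using UK e by (intro enn2real_leI) auto
  show ?thesis
  proof (intro exI[of _ \<delta>] conjI allI impI d(1))
    fix t :: real assume t: "\<bar>t\<bar> \<le> \<delta>"
    have inU: "y + t \<in> U \<and> y - t \<in> U" if "y \<in> K" for y
      using d(2) that t by (force simp: subset_eq dist_real_def)
    have "(\<integral>y. \<bar>indicator A (y + t) - indicator A y\<bar> \<partial>lborel)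
          \<le> (\<integral>y. indicator (U - K) (y + t) + (indicator (U - K) y :: real) \<partial>lborel)"
    proof (rule Bochner_Integration.integral_mono')
      show "integrable lborel (\<lambda>y. indicator (U - K) (y + t) + (indicator (U - K) y :: real))"
        using int integrable_lborel_shift[OF int] by auto
      fix y
      have "y \<in> K \<Longrightarrow> y + t \<in> U" "y + t \<in> K \<Longrightarrow> y \<in> U"
        using inU[of y] inU[of "y+t"] by auto
      then show "\<bar>indicator A (y + t) - indicator A y\<bar> \<le> indicator (U - K) (y + t) + (indicator (U - K) y :: real)"
        using K(1) U(2) by (auto simp: indicator_def)
      show "0 \<le> indicator (U - K) (y + t) + (indicator (U - K) y :: real)" by simp
    qed
    also have "\<dots> = 2 * measure lborel (U - K)"
      using int integrable_lborel_shift[OF int]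
      by (subst Bochner_Integration.integral_add) (auto simp: integral_lborel_shift)
    finally show "(\<integral>y. \<bar>indicator A (y + t) - indicator A y\<bar> \<partial>lborel) \<le> e"
      using m by simp
  qed
qed

proposition translation_L1_continuous:
  fixes f :: "real \<Rightarrow> real"
  assumes "integrable lborel f" "e > 0"
  shows "\<exists>\<delta>>0. \<forall>t. \<bar>t\<bar> \<le> \<delta> \<longrightarrow> (\<integral>y. \<bar>f (y + t) - f y\<bar> \<partial>lborel) \<le> e"
  using assms
proof (induction arbitrary: e rule: integrable_induct)
  case (base A c)
  define e' where "e' = e / (\<bar>c\<bar> + 1)"
  have e': "e' > 0" using base by (simp add: e'_def)
  obtain \<delta> where d: "\<delta> > 0"
    "\<And>t. \<bar>t\<bar> \<le> \<delta> \<Longrightarrow> (\<integral>y. \<bar>indicator A (y + t) - indicator A y\<bar> \<partial>lborel) \<le> e'"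
    using indicator_translation_L1_continuous[of A e'] base e' by auto
  have ce': "\<bar>c\<bar> * e' \<le> e"
    using base(3) by (simp add: e'_def field_simps)
  show ?case
  proof (intro exI[of _ \<delta>] conjI allI impI d(1))
    fix t :: real assume t: "\<bar>t\<bar> \<le> \<delta>"
    have "(\<integral>y. \<bar>indicator A (y + t) *\<^sub>R c - indicator A y *\<^sub>R c\<bar> \<partial>lborel)
        = (\<integral>y. \<bar>c\<bar> * \<bar>indicator A (y + t) - indicator A y\<bar> \<partial>lborel)"
      by (intro Bochner_Integration.integral_cong refl) (simp add: abs_mult[symmetric] algebra_simps)
    also have "\<dots> = \<bar>c\<bar> * (\<integral>y. \<bar>indicator A (y + t) - indicator A y\<bar> \<partial>lborel)"
      by simp
    also have "\<dots> \<le> \<bar>c\<bar> * e'"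
      using d(2)[OF t] by (intro mult_left_mono) auto
    finally show "(\<integral>y. \<bar>indicator A (y + t) *\<^sub>R c - indicator A y *\<^sub>R c\<bar> \<partial>lborel) \<le> e"
      using ce' by simp
  qed
next
  case (add f g)
  obtain \<delta> where d: "\<delta> > 0" "\<And>t. \<bar>t\<bar> \<le> \<delta> \<Longrightarrow> (\<integral>y. \<bar>f (y + t) - f y\<bar> \<partial>lborel) \<le> e/2"
    using add.IH(1)[of "e/2"] add.prems by auto
  obtain \<delta>' where d': "\<delta>' > 0" "\<And>t. \<bar>t\<bar> \<le> \<delta>' \<Longrightarrow> (\<integral>y. \<bar>g (y + t) - g y\<bar> \<partial>lborel) \<le> e/2"
    using add.IH(2)[of "e/2"] add.prems by auto
  show ?case
  proof (intro exI[of _ "min \<delta> \<delta>'"] conjI allI impI)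
    show "min \<delta> \<delta>' > 0" using d d' by auto
    fix t :: real assume t: "\<bar>t\<bar> \<le> min \<delta> \<delta>'"
    note [simp] = add.hyps integrable_lborel_shift[OF add.hyps(1)] integrable_lborel_shift[OF add.hyps(2)]
    have "(\<integral>y. \<bar>f (y + t) + g (y + t) - (f y + g y)\<bar> \<partial>lborel)
        \<le> (\<integral>y. \<bar>f (y + t) - f y\<bar> + \<bar>g (y + t) - g y\<bar> \<partial>lborel)"
      by (intro integral_mono) auto
    also have "\<dots> \<le> e/2 + e/2"
      using d(2)[of t] d'(2)[of t] t by (subst Bochner_Integration.integral_add) auto
    finally show "(\<integral>y. \<bar>f (y + t) + g (y + t) - (f y + g y)\<bar> \<partial>lborel) \<le> e" by simp
  qed
next
  case (lim f s)
  note [measurable] = borel_measurable_integrable[OF lim.hyps(1)] borel_measurable_integrable[OF lim.hyps(4)]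
  have "(\<lambda>i. \<integral>y. \<bar>s i y - f y\<bar> \<partial>lborel) \<longlonglongrightarrow> (\<integral>y. 0 \<partial>(lborel :: real measure))"
  proof (rule integral_dominated_convergence[where w="\<lambda>y. 3 * \<bar>f y\<bar>"])
    show "AE y in lborel. (\<lambda>i. \<bar>s i y - f y\<bar>) \<longlonglongrightarrow> 0"
      using lim.hyps(2) by (auto intro!: tendsto_eq_intros AE_I2)
    show "AE y in lborel. norm \<bar>s i y - f y\<bar> \<le> 3 * \<bar>f y\<bar>" for i
      using lim.hyps(3)[of _ i] by (intro AE_I2) fastforce
  qed (use lim.hyps(4) in auto)
  then have "eventually (\<lambda>i. (\<integral>y. \<bar>s i y - f y\<bar> \<partial>lborel) < e/3) sequentially"
    using lim.prems by (intro order_tendstoD) auto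
  then obtain i where i: "(\<integral>y. \<bar>s i y - f y\<bar> \<partial>lborel) < e/3"
    by (auto simp: eventually_sequentially)
  obtain \<delta> where d: "\<delta> > 0" "\<And>t. \<bar>t\<bar> \<le> \<delta> \<Longrightarrow> (\<integral>y. \<bar>s i (y + t) - s i y\<bar> \<partial>lborel) \<le> e/3"
    using lim.IH[of "e/3" i] lim.prems by auto
  show ?case
  proof (intro exI[of _ \<delta>] conjI allI impI d(1))
    fix t :: real assume t: "\<bar>t\<bar> \<le> \<delta>"
    note [simp] = lim.hyps(1)[of i] lim.hyps(4) integrable_lborel_shift[OF lim.hyps(1)] integrable_lborel_shift[OF lim.hyps(4)]
    have "(\<integral>y. \<bar>f (y + t) - f y\<bar> \<partial>lborel)
        \<le> (\<integral>y. \<bar>s i (y + t) - f (y + t)\<bar> + (\<bar>s i (y + t) - s i y\<bar> + \<bar>s i y - f y\<bar>) \<partial>lborel)"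
      by (intro integral_mono) auto
    also have "\<dots> = (\<integral>y. \<bar>s i (y + t) - f (y + t)\<bar> \<partial>lborel)
        + ((\<integral>y. \<bar>s i (y + t) - s i y\<bar> \<partial>lborel) + (\<integral>y. \<bar>s i y - f y\<bar> \<partial>lborel))"
      by simp
    also have "(\<integral>y. \<bar>s i (y + t) - f (y + t)\<bar> \<partial>lborel) = (\<integral>y. \<bar>s i y - f y\<bar> \<partial>lborel)"
      using integral_lborel_shift[of "\<lambda>y. \<bar>s i y - f y\<bar>" t] by simp
    finally show "(\<integral>y. \<bar>f (y + t) - f y\<bar> \<partial>lborel) \<le> e"
      using i d(2)[OF t] by simp
  qed
qed

section \<open>Continuity of shifts in weighted mean square\<close>

definition weighted_sqnorm :: "(real \<Rightarrow> real) \<Rightarrow> (real \<Rightarrow> real) \<Rightarrow> ennreal" where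
  "weighted_sqnorm f h = (\<integral>\<^sup>+y. ennreal ((h y)\<^sup>2 * f y) \<partial>lborel)"

text \<open>
  Here \<open>a\<close> is the value of a function at a shifted point, \<open>v'\<close> and \<open>v\<close> are those of the envelope at the
  shifted and at the original point. The excess of \<open>a\<^sup>2\<close> over the truncation level is paid either by
  the increment of the envelope or by the tail of the unshifted envelope; only the truncated part
  remains to be shifted.
\<close>

lemma square_le_truncated:
  fixes a v v' c :: real
  assumes "\<bar>a\<bar> \<le> v'" "c > 0"
  shows "a\<^sup>2 \<le> min (a\<^sup>2) (c\<^sup>2) + 4 * (v' - v)\<^sup>2 + 2 * (if c/2 < v then v else 0)\<^sup>2"
proof (cases "v' \<le> c")
  case True
  then have "a\<^sup>2 \<le> c\<^sup>2" using assms by (intro abs_le_square_iff[THEN iffD1]) auto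
  then have "min (a\<^sup>2) (c\<^sup>2) = a\<^sup>2" by simp
  moreover have "0 \<le> 4 * (v' - v)\<^sup>2" "0 \<le> 2 * (if c/2 < v then v else 0)\<^sup>2" by simp_all
  ultimately show ?thesis by linarith
next
  case False
  have av: "a\<^sup>2 \<le> v'\<^sup>2" using assms(1) by (intro abs_le_square_iff[THEN iffD1]) auto
  have min0: "0 \<le> min (a\<^sup>2) (c\<^sup>2)" by simp
  show ?thesis
  proof (cases "c/2 < v")
    case True
    have "v'\<^sup>2 \<le> 4 * (v' - v)\<^sup>2 + 2 * v\<^sup>2"
      using zero_le_power2[of "v' - 2 * v"] zero_le_power2[of "v' - v"]
      by (simp add: power2_eq_square algebra_simps)
    then show ?thesis unfolding if_P[OF True] using av min0 by linarith
  next
    case False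
    have "v' \<le> 2 * (v' - v)" "0 \<le> v'" using False \<open>\<not> v' \<le> c\<close> assms(2) by auto
    then have "v'\<^sup>2 \<le> (2 * (v' - v))\<^sup>2" by (rule power_mono)
    moreover have "(2 * (v' - v))\<^sup>2 = 4 * (v' - v)\<^sup>2" by (simp only: power_mult_distrib) simp
    moreover have "2 * (0::real)\<^sup>2 = 0" by simp
    ultimately show ?thesis unfolding if_not_P[OF False] using av min0 by linarith
  qed
qed

text \<open>
  The last assumption is the mean-square continuity of \<open>V\<close> under the density \<open>f\<close>. It does not
  follow from \<open>V_sq\<close>, because \<open>f\<close> may decay so fast that shifts of \<open>V\<close> fail to be square
  integrable.
\<close>

locale weighted_shift =
  fixes f V :: "real \<Rightarrow> real"
  assumes f_meas [measurable]: "f \<in> borel_measurable borel" and f_nonneg: "\<And>y. 0 \<le> f y"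
    and f_int: "integrable lborel f"
    and V_meas [measurable]: "V \<in> borel_measurable borel"
    and V_sq: "weighted_sqnorm f V < \<infinity>"
    and V_shift: "\<And>e. e > 0 \<Longrightarrow> \<exists>\<delta>>0. \<forall>t. \<bar>t\<bar> \<le> \<delta> \<longrightarrow> weighted_sqnorm f (\<lambda>y. V (y + t) - V y) \<le> ennreal e"
begin

lemma weighted_sqnorm_mono:
  assumes "\<And>y. (h y)\<^sup>2 \<le> (h' y)\<^sup>2"
  shows "weighted_sqnorm f h \<le> weighted_sqnorm f h'"
  unfolding weighted_sqnorm_def using assms f_nonneg
  by (intro nn_integral_mono ennreal_leI mult_right_mono) auto

lemma weighted_sqnorm_tail:
  assumes "e > 0"
  obtains c where "c > 0" "weighted_sqnorm f (\<lambda>y. if c < V y then V y else 0) \<le> ennreal e"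
proof -
  have "(\<lambda>n. weighted_sqnorm f (\<lambda>y. if real (Suc n) < V y then V y else 0)) \<longlonglongrightarrow> (\<integral>\<^sup>+y. 0 \<partial>(lborel :: real measure))"
    unfolding weighted_sqnorm_def
  proof (rule nn_integral_dominated_convergence[where w="\<lambda>y. ennreal ((V y)\<^sup>2 * f y)"])
    show "(\<integral>\<^sup>+y. ennreal ((V y)\<^sup>2 * f y) \<partial>lborel) < \<infinity>"
      using V_sq by (simp add: weighted_sqnorm_def)
    show "AE y in lborel. ennreal ((if real (Suc n) < V y then V y else 0)\<^sup>2 * f y) \<le> ennreal ((V y)\<^sup>2 * f y)" for n
      using f_nonneg by (intro AE_I2 ennreal_leI) (auto intro!: mult_right_mono)
    show "AE y in lborel. (\<lambda>n. ennreal ((if real (Suc n) < V y then V y else 0)\<^sup>2 * f y)) \<longlonglongrightarrow> 0"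
    proof (rule AE_I2)
      fix y
      obtain N where N: "V y \<le> real N" using real_arch_simple by blast
      have "\<forall>\<^sub>F n in sequentially. ennreal ((if real (Suc n) < V y then V y else 0)\<^sup>2 * f y) = 0"
        using eventually_ge_at_top[of N] by eventually_elim (use N in auto)
      then show "(\<lambda>n. ennreal ((if real (Suc n) < V y then V y else 0)\<^sup>2 * f y)) \<longlonglongrightarrow> 0"
        by (rule tendsto_eventually)
    qed
  qed auto
  then have "\<forall>\<^sub>F n in sequentially. weighted_sqnorm f (\<lambda>y. if real (Suc n) < V y then V y else 0) < ennreal e"
    using assms by (intro order_tendstoD) auto
  then obtain n where "weighted_sqnorm f (\<lambda>y. if real (Suc n) < V y then V y else 0) < ennreal e"
    by (auto simp: eventually_sequentially)
  then show thesis using that[of "real (Suc n)"] by (simp add: less_imp_le)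
qed

lemma f_translation:
  assumes "e > 0"
  obtains \<delta> where "\<delta> > 0" "\<And>t. \<bar>t\<bar> \<le> \<delta> \<Longrightarrow> (\<integral>\<^sup>+y. ennreal \<bar>f (y - t) - f y\<bar> \<partial>lborel) \<le> ennreal e"
proof -
  obtain \<delta> where d: "\<delta> > 0" "\<And>t. \<bar>t\<bar> \<le> \<delta> \<Longrightarrow> (\<integral>y. \<bar>f (y + t) - f y\<bar> \<partial>lborel) \<le> e"
    using translation_L1_continuous[OF f_int assms] by auto
  have "(\<integral>\<^sup>+y. ennreal \<bar>f (y - t) - f y\<bar> \<partial>lborel) \<le> ennreal e" if "\<bar>t\<bar> \<le> \<delta>" for t
  proof -
    have "integrable lborel (\<lambda>y. \<bar>f (y - t) - f y\<bar>)"
      using integrable_lborel_shift[OF f_int, of "- t"] f_int by simp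
    then have "(\<integral>\<^sup>+y. ennreal \<bar>f (y - t) - f y\<bar> \<partial>lborel) = ennreal (\<integral>y. \<bar>f (y - t) - f y\<bar> \<partial>lborel)"
      by (intro nn_integral_eq_integral) auto
    also have "\<dots> \<le> ennreal e" using d(2)[of "- t"] that by (intro ennreal_leI) simp
    finally show ?thesis .
  qed
  with d(1) show thesis by (rule that)
qed

text \<open>
  The truncated part of \<open>w\<^sup>2\<close> is bounded by \<open>(4 * c)\<^sup>2\<close>. Moving the shift from it to the density
  costs that bound times the \<open>L\<^sub>1\<close> distance of \<open>f\<close> from its translate. The envelope \<open>2 * V\<close> is that of
  differences of two functions with envelope \<open>V\<close>.
\<close>

lemma weighted_sqnorm_shift_le:
  assumes [measurable]: "w \<in> borel_measurable borel" and w: "\<And>y. \<bar>w y\<bar> \<le> 2 * V y" and c: "c > 0"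
  shows "weighted_sqnorm f (\<lambda>y. w (y + t)) \<le>
     weighted_sqnorm f w + ennreal ((4 * c)\<^sup>2) * (\<integral>\<^sup>+y. ennreal \<bar>f (y - t) - f y\<bar> \<partial>lborel)
     + 16 * weighted_sqnorm f (\<lambda>y. V (y + t) - V y)
     + 8 * weighted_sqnorm f (\<lambda>y. if c < V y then V y else 0)"
proof -
  let ?m = "\<lambda>y. min ((w y)\<^sup>2) ((4 * c)\<^sup>2)"
  have pw: "(w (y + t))\<^sup>2 * f y \<le> ?m (y + t) * f y + 16 * ((V (y + t) - V y)\<^sup>2 * f y)
      + 8 * ((if c < V y then V y else 0)\<^sup>2 * f y)" for y
  proof -
    have "(w (y + t))\<^sup>2 \<le> ?m (y + t) + 4 * (2 * V (y + t) - 2 * V y)\<^sup>2 + 2 * (if 4 * c / 2 < 2 * V y then 2 * V y else 0)\<^sup>2"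
      using square_le_truncated[OF w[of "y + t"], of "4 * c" "2 * V y"] c by auto
    also have "\<dots> = ?m (y + t) + 16 * (V (y + t) - V y)\<^sup>2 + 8 * (if c < V y then V y else 0)\<^sup>2"
      by (auto simp: power2_eq_square algebra_simps)
    finally have "(w (y + t))\<^sup>2 * f y \<le> (?m (y + t) + 16 * (V (y + t) - V y)\<^sup>2 + 8 * (if c < V y then V y else 0)\<^sup>2) * f y"
      using f_nonneg by (rule mult_right_mono)
    then show ?thesis by (simp add: algebra_simps)
  qed
  have "weighted_sqnorm f (\<lambda>y. w (y + t)) \<le> (\<integral>\<^sup>+y. ennreal (?m (y + t) * f y) + 16 * ennreal ((V (y + t) - V y)\<^sup>2 * f y)
      + 8 * ennreal ((if c < V y then V y else 0)\<^sup>2 * f y) \<partial>lborel)"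
    unfolding weighted_sqnorm_def
  proof (rule nn_integral_mono)
    fix y
    have "ennreal ((w (y + t))\<^sup>2 * f y) \<le> ennreal (?m (y + t) * f y + 16 * ((V (y + t) - V y)\<^sup>2 * f y)
      + 8 * ((if c < V y then V y else 0)\<^sup>2 * f y))"
      by (rule ennreal_leI[OF pw])
    also have "\<dots> = ennreal (?m (y + t) * f y) + 16 * ennreal ((V (y + t) - V y)\<^sup>2 * f y)
      + 8 * ennreal ((if c < V y then V y else 0)\<^sup>2 * f y)"
      using f_nonneg by (simp add: ennreal_mult)
    finally show "ennreal ((w (y + t))\<^sup>2 * f y) \<le> \<dots>" .
  qed
  also have "\<dots> = (\<integral>\<^sup>+y. ennreal (?m (y + t) * f y) \<partial>lborel) + 16 * weighted_sqnorm f (\<lambda>y. V (y + t) - V y)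
     + 8 * weighted_sqnorm f (\<lambda>y. if c < V y then V y else 0)"
    unfolding weighted_sqnorm_def by (simp add: nn_integral_add nn_integral_cmult)
  also have "(\<integral>\<^sup>+y. ennreal (?m (y + t) * f y) \<partial>lborel) = (\<integral>\<^sup>+y. ennreal (?m y * f (y - t)) \<partial>lborel)"
    using nn_integral_lborel_shift[of "\<lambda>y. ennreal (?m y * f (y - t))" t] by simp
  also have "\<dots> \<le> (\<integral>\<^sup>+y. ennreal ((w y)\<^sup>2 * f y) + ennreal ((4 * c)\<^sup>2) * ennreal \<bar>f (y - t) - f y\<bar> \<partial>lborel)"
  proof (rule nn_integral_mono)
    fix y
    have "?m y * f (y - t) \<le> ?m y * (f y + \<bar>f (y - t) - f y\<bar>)" by (intro mult_left_mono) auto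
    also have "\<dots> = ?m y * f y + ?m y * \<bar>f (y - t) - f y\<bar>" by (rule distrib_left)
    also have "\<dots> \<le> (w y)\<^sup>2 * f y + (4 * c)\<^sup>2 * \<bar>f (y - t) - f y\<bar>"
      using f_nonneg by (intro add_mono mult_right_mono) auto
    finally have "ennreal (?m y * f (y - t)) \<le> ennreal ((w y)\<^sup>2 * f y + (4 * c)\<^sup>2 * \<bar>f (y - t) - f y\<bar>)"
      by (rule ennreal_leI)
    also have "\<dots> = ennreal ((w y)\<^sup>2 * f y) + ennreal ((4 * c)\<^sup>2) * ennreal \<bar>f (y - t) - f y\<bar>"
      using f_nonneg by (simp add: ennreal_mult)
    finally show "ennreal (?m y * f (y - t)) \<le> \<dots>" .
  qed
  also have "\<dots> = weighted_sqnorm f w + ennreal ((4 * c)\<^sup>2) * (\<integral>\<^sup>+y. ennreal \<bar>f (y - t) - f y\<bar> \<partial>lborel)"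
    unfolding weighted_sqnorm_def by (simp add: nn_integral_add nn_integral_cmult)
  finally show ?thesis by (simp add: add_right_mono)
qed

lemma weighted_sqnorm_shift_small:
  assumes "e > 0"
  obtains \<delta> where "\<delta> > 0"
    "\<And>w t. w \<in> borel_measurable borel \<Longrightarrow> (\<And>y. \<bar>w y\<bar> \<le> 2 * V y) \<Longrightarrow> \<bar>t\<bar> \<le> \<delta> \<Longrightarrow>
       weighted_sqnorm f (\<lambda>y. w (y + t)) \<le> weighted_sqnorm f w + ennreal e"
proof -
  obtain c where c: "c > 0" "weighted_sqnorm f (\<lambda>y. if c < V y then V y else 0) \<le> ennreal (e/24)"
    using weighted_sqnorm_tail[of "e/24"] assms by auto
  obtain \<delta>1 where d1: "\<delta>1 > 0" "\<And>t. \<bar>t\<bar> \<le> \<delta>1 \<Longrightarrow> weighted_sqnorm f (\<lambda>y. V (y + t) - V y) \<le> ennreal (e/48)"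
    using V_shift[of "e/48"] assms by auto
  obtain \<delta>2 where d2: "\<delta>2 > 0" "\<And>t. \<bar>t\<bar> \<le> \<delta>2 \<Longrightarrow> (\<integral>\<^sup>+y. ennreal \<bar>f (y - t) - f y\<bar> \<partial>lborel) \<le> ennreal (e / (48 * c\<^sup>2))"
    using f_translation[of "e / (48 * c\<^sup>2)"] assms c(1) by auto
  show thesis
  proof (rule that[of "min \<delta>1 \<delta>2"])
    show "min \<delta>1 \<delta>2 > 0" using d1 d2 by auto
    fix w :: "real \<Rightarrow> real" and t :: real assume w: "w \<in> borel_measurable borel" "\<And>y. \<bar>w y\<bar> \<le> 2 * V y" and t: "\<bar>t\<bar> \<le> min \<delta>1 \<delta>2"
    have "weighted_sqnorm f (\<lambda>y. w (y + t)) \<le> weighted_sqnorm f w + ennreal ((4 * c)\<^sup>2) * ennreal (e / (48 * c\<^sup>2))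
     + 16 * ennreal (e/48) + 8 * ennreal (e/24)"
      by (rule order_trans[OF weighted_sqnorm_shift_le[OF w c(1)]])
         (intro add_mono mult_left_mono order_refl c(2) d1(2) d2(2); use t in simp)
    also have "ennreal ((4 * c)\<^sup>2) * ennreal (e / (48 * c\<^sup>2)) = ennreal ((4 * c)\<^sup>2 * (e / (48 * c\<^sup>2)))"
      using assms by (intro ennreal_mult[symmetric]) auto
    also have "(4 * c)\<^sup>2 * (e / (48 * c\<^sup>2)) = e/3"
      using c(1) by (simp add: power2_eq_square)
    also have "16 * ennreal (e/48) = ennreal (e/3)"
      using ennreal_mult[of 16 "e/48"] assms by simp
    also have "8 * ennreal (e/24) = ennreal (e/3)"
      using ennreal_mult[of 8 "e/24"] assms by simp
    also have "weighted_sqnorm f w + ennreal (e/3) + ennreal (e/3) + ennreal (e/3) = weighted_sqnorm f w + ennreal e"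
      using assms by (simp add: add.assoc ennreal_plus[symmetric] del: ennreal_plus)
    finally show "weighted_sqnorm f (\<lambda>y. w (y + t)) \<le> weighted_sqnorm f w + ennreal e" .
  qed
qed

text \<open>
  After expanding the square, \<open>\<integral> h(y + t)\<^sup>2 f(y) dy\<close> and \<open>\<integral> h(y + t) h(y) f(y) dy\<close> both have the form of
  a bounded function, shifted, against an integrable one. Continuity of translations in \<open>L\<^sub>1\<close>
  applies to the integrable factor, which is \<open>f\<close> in the first and \<open>h f\<close> in the second case.
\<close>

lemma bounded_shift_continuous:
  assumes [measurable]: "h \<in> borel_measurable borel" and h: "\<And>y. \<bar>h y\<bar> \<le> c" and e: "e > 0"
  obtains \<delta> where "\<delta> > 0" "\<And>t. \<bar>t\<bar> \<le> \<delta> \<Longrightarrow> weighted_sqnorm f (\<lambda>y. h (y + t) - h y) \<le> ennreal e"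
proof -
  have bdd_int: "integrable lborel (\<lambda>y. p y * q y)" 
    if [measurable]: "p \<in> borel_measurable borel" and "\<And>y. \<bar>p y\<bar> \<le> C" "integrable lborel q" for p q :: "real \<Rightarrow> real" and C
  proof (rule Bochner_Integration.integrable_bound)
    show "integrable lborel (\<lambda>y. C * \<bar>q y\<bar>)" using that by simp
    have [measurable]: "q \<in> borel_measurable borel" using that(3) borel_measurable_integrable by fastforce
    show "(\<lambda>y. p y * q y) \<in> borel_measurable lborel" by simp
    show "AE y in lborel. norm (p y * q y) \<le> norm (C * \<bar>q y\<bar>)"
    proof (rule AE_I2)
      fix y
      have "\<bar>p y\<bar> * \<bar>q y\<bar> \<le> C * \<bar>q y\<bar>" by (intro mult_right_mono that(2)) auto
      then show "norm (p y * q y) \<le> norm (C * \<bar>q y\<bar>)"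
        unfolding real_norm_def abs_mult[of "p y"] by (rule order_trans[OF _ abs_ge_self])
    qed
  qed
  have transl: "\<exists>\<delta>>0. \<forall>t. \<bar>t\<bar> \<le> \<delta> \<longrightarrow> \<bar>(\<integral>y. p (y + t) * q y \<partial>lborel) - (\<integral>y. p y * q y \<partial>lborel)\<bar> \<le> a"
    if p: "p \<in> borel_measurable borel" "\<And>y. \<bar>p y\<bar> \<le> C" and q: "integrable lborel q" and a: "a > 0" for p q :: "real \<Rightarrow> real" and C a
  proof -
    have C: "C \<ge> 0" using p(2)[of 0] by auto
    then have "a / (C + 1) > 0" using a by auto
    then obtain \<delta> where d: "\<delta> > 0" "\<And>t. \<bar>t\<bar> \<le> \<delta> \<Longrightarrow> (\<integral>y. \<bar>q (y + t) - q y\<bar> \<partial>lborel) \<le> a / (C + 1)"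
      using translation_L1_continuous[OF q] by metis
    show ?thesis
    proof (intro exI[of _ \<delta>] conjI allI impI d(1))
      fix t :: real assume t: "\<bar>t\<bar> \<le> \<delta>"
      have qs: "integrable lborel (\<lambda>y. q (y - t))" using integrable_lborel_shift[OF q, of "- t"] by simp
      have "(\<integral>y. p (y + t) * q y \<partial>lborel) = (\<integral>y. p y * q (y - t) \<partial>lborel)"
        using integral_lborel_shift[of "\<lambda>y. p y * q (y - t)" t] by simp
      then have "\<bar>(\<integral>y. p (y + t) * q y \<partial>lborel) - (\<integral>y. p y * q y \<partial>lborel)\<bar> = \<bar>\<integral>y. p y * (q (y - t) - q y) \<partial>lborel\<bar>"
        using bdd_int[OF p q] bdd_int[OF p qs] by (simp add: right_diff_distrib)
      also have "\<dots> \<le> (\<integral>y. \<bar>p y * (q (y - t) - q y)\<bar> \<partial>lborel)" by (rule integral_abs_bound)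
      also have "\<dots> \<le> (\<integral>y. C * \<bar>q (y - t) - q y\<bar> \<partial>lborel)"
      proof (rule integral_mono)
        show "integrable lborel (\<lambda>y. \<bar>p y * (q (y - t) - q y)\<bar>)"
          by (intro integrable_abs bdd_int[OF p] Bochner_Integration.integrable_diff qs q)
        show "integrable lborel (\<lambda>y. C * \<bar>q (y - t) - q y\<bar>)"
          by (intro integrable_mult_right integrable_abs Bochner_Integration.integrable_diff qs q)
        show "\<bar>p y * (q (y - t) - q y)\<bar> \<le> C * \<bar>q (y - t) - q y\<bar>" for y
          unfolding abs_mult by (intro mult_right_mono p(2)) auto
      qed
      also have "\<dots> \<le> C * (a / (C + 1))" using mult_left_mono[OF d(2)[of "- t"] C] t by simp
      also have "\<dots> \<le> a" using C a by (simp add: field_simps)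
      finally show "\<bar>(\<integral>y. p (y + t) * q y \<partial>lborel) - (\<integral>y. p y * q y \<partial>lborel)\<bar> \<le> a" .
    qed
  qed
  have hf: "integrable lborel (\<lambda>y. h y * f y)" using bdd_int[OF _ h f_int] by simp
  have h2: "\<bar>(h y)\<^sup>2\<bar> \<le> c\<^sup>2" for y using h[of y] by (auto simp: abs_le_square_iff[symmetric])
  obtain \<delta>1 where d1: "\<delta>1 > 0" "\<And>t. \<bar>t\<bar> \<le> \<delta>1 \<Longrightarrow> \<bar>(\<integral>y. (h (y + t))\<^sup>2 * f y \<partial>lborel) - (\<integral>y. (h y)\<^sup>2 * f y \<partial>lborel)\<bar> \<le> e/3"
    using transl[of "\<lambda>y. (h y)\<^sup>2" "c\<^sup>2" f "e/3"] h2 f_int e by auto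
  obtain \<delta>2 where d2: "\<delta>2 > 0" "\<And>t. \<bar>t\<bar> \<le> \<delta>2 \<Longrightarrow> \<bar>(\<integral>y. h (y + t) * (h y * f y) \<partial>lborel) - (\<integral>y. h y * (h y * f y) \<partial>lborel)\<bar> \<le> e/3"
    using transl[of h c "\<lambda>y. h y * f y" "e/3"] h hf e by auto
  show thesis
  proof (rule that[of "min \<delta>1 \<delta>2"])
    show "min \<delta>1 \<delta>2 > 0" using d1 d2 by auto
    fix t :: real assume t: "\<bar>t\<bar> \<le> min \<delta>1 \<delta>2"
    have i1: "integrable lborel (\<lambda>y. (h (y + t))\<^sup>2 * f y)" using bdd_int[of "\<lambda>y. (h (y + t))\<^sup>2" "c\<^sup>2" f] h2 f_int by auto
    have i2: "integrable lborel (\<lambda>y. (h y)\<^sup>2 * f y)" using bdd_int[of "\<lambda>y. (h y)\<^sup>2" "c\<^sup>2" f] h2 f_int by auto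
    have i3: "integrable lborel (\<lambda>y. h (y + t) * (h y * f y))" using bdd_int[of "\<lambda>y. h (y + t)" c] h hf by auto
    have eq: "(h (y + t) - h y)\<^sup>2 * f y = (h (y + t))\<^sup>2 * f y - 2 * (h (y + t) * (h y * f y)) + (h y)\<^sup>2 * f y" for y
      by (simp add: power2_eq_square algebra_simps)
    have i: "integrable lborel (\<lambda>y. (h (y + t) - h y)\<^sup>2 * f y)" unfolding eq using i1 i2 i3 by auto
    have int_eq: "(\<integral>y. (h (y + t) - h y)\<^sup>2 * f y \<partial>lborel) = (\<integral>y. (h (y + t))\<^sup>2 * f y \<partial>lborel)
        - 2 * (\<integral>y. h (y + t) * (h y * f y) \<partial>lborel) + (\<integral>y. (h y)\<^sup>2 * f y \<partial>lborel)"
      unfolding eq using i1 i2 i3 by simp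
    have hh: "(\<integral>y. h y * (h y * f y) \<partial>lborel) = (\<integral>y. (h y)\<^sup>2 * f y \<partial>lborel)"
      by (simp add: power2_eq_square mult.assoc)
    have "(\<integral>y. (h (y + t) - h y)\<^sup>2 * f y \<partial>lborel) \<le> e"
    proof -
      have "\<bar>t\<bar> \<le> \<delta>1" "\<bar>t\<bar> \<le> \<delta>2" using t by auto
      from d1(2)[OF this(1)] d2(2)[OF this(2)] show ?thesis
        using int_eq hh by linarith
    qed
    moreover have "weighted_sqnorm f (\<lambda>y. h (y + t) - h y) = ennreal (\<integral>y. (h (y + t) - h y)\<^sup>2 * f y \<partial>lborel)"
      unfolding weighted_sqnorm_def using i f_nonneg by (intro nn_integral_eq_integral) auto
    ultimately show "weighted_sqnorm f (\<lambda>y. h (y + t) - h y) \<le> ennreal e" by (simp add: ennreal_leI)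
  qed
qed

lemma weighted_sqnorm_add3_le:
  assumes [measurable]: "p \<in> borel_measurable borel" "q \<in> borel_measurable borel" "r \<in> borel_measurable borel"
    and "\<And>y. h y = p y + q y + r y"
  shows "weighted_sqnorm f h \<le> 3 * (weighted_sqnorm f p + weighted_sqnorm f q + weighted_sqnorm f r)"
proof -
  have "(p y + q y + r y)\<^sup>2 * f y \<le> 3 * ((p y)\<^sup>2 * f y + (q y)\<^sup>2 * f y + (r y)\<^sup>2 * f y)" for y
  proof -
    have "(p y + q y + r y)\<^sup>2 \<le> 3 * ((p y)\<^sup>2 + (q y)\<^sup>2 + (r y)\<^sup>2)"
      using zero_le_power2[of "p y - q y"] zero_le_power2[of "p y - r y"] zero_le_power2[of "q y - r y"]
      by (simp add: power2_eq_square algebra_simps)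
    then show ?thesis using mult_right_mono[OF _ f_nonneg[of y]] by (fastforce simp: algebra_simps)
  qed
  then have "weighted_sqnorm f h \<le> (\<integral>\<^sup>+y. 3 * (ennreal ((p y)\<^sup>2 * f y) + ennreal ((q y)\<^sup>2 * f y) + ennreal ((r y)\<^sup>2 * f y)) \<partial>lborel)"
    unfolding weighted_sqnorm_def assms(4) using f_nonneg
    by (intro nn_integral_mono) (auto simp: ennreal_plus[symmetric] ennreal_mult[symmetric] ennreal_leI
        simp del: ennreal_plus simp flip: ennreal_numeral)
  also have "\<dots> = 3 * (weighted_sqnorm f p + weighted_sqnorm f q + weighted_sqnorm f r)"
    unfolding weighted_sqnorm_def by (simp add: nn_integral_add nn_integral_cmult)
  finally show ?thesis .
qed

text \<open>
  Split \<open>g\<close> into its truncation at a high level \<open>c\<close>, to which \<open>bounded_shift_continuous\<close> applies, and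
  a remainder \<open>w\<close> that is dominated by the tail of \<open>V\<close> and stays small under shifts.
\<close>

lemma single_shift_continuous:
  assumes [measurable]: "g \<in> borel_measurable borel" and g: "\<And>y. \<bar>g y\<bar> \<le> V y" and e: "e > 0"
  obtains \<delta> where "\<delta> > 0" "\<And>t. \<bar>t\<bar> \<le> \<delta> \<Longrightarrow> weighted_sqnorm f (\<lambda>y. g (y + t) - g y) \<le> ennreal e"
proof -
  obtain c where c: "c > 0" "weighted_sqnorm f (\<lambda>y. if c < V y then V y else 0) \<le> ennreal (e/12)"
    using weighted_sqnorm_tail[of "e/12"] e by auto
  define h where "h y = max (- c) (min c (g y))" for y
  define w where "w y = g y - h y" for y
  have [measurable]: "h \<in> borel_measurable borel" "w \<in> borel_measurable borel" unfolding h_def w_def by measurable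
  have hc: "\<bar>h y\<bar> \<le> c" for y using c(1) by (auto simp: h_def)
  have wV: "\<bar>w y\<bar> \<le> 2 * V y" "(w y)\<^sup>2 \<le> (if c < V y then V y else 0)\<^sup>2" for y
  proof -
    have "\<bar>w y\<bar> \<le> (if c < V y then V y else 0)"
      using g[of y] c(1) unfolding w_def h_def by (auto simp: max_def min_def abs_le_iff)
    then show "\<bar>w y\<bar> \<le> 2 * V y" "(w y)\<^sup>2 \<le> (if c < V y then V y else 0)\<^sup>2"
      using g[of y] by (auto simp: abs_le_square_iff[symmetric] split: if_splits)
  qed
  have Nw: "weighted_sqnorm f w \<le> ennreal (e/12)"
    using weighted_sqnorm_mono[of w, OF wV(2)] c(2) by (rule order_trans)
  obtain \<delta>1 where d1: "\<delta>1 > 0" "\<And>w t. w \<in> borel_measurable borel \<Longrightarrow> (\<And>y. \<bar>w y\<bar> \<le> 2 * V y) \<Longrightarrow> \<bar>t\<bar> \<le> \<delta>1 \<Longrightarrow>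
       weighted_sqnorm f (\<lambda>y. w (y + t)) \<le> weighted_sqnorm f w + ennreal (e/12)"
    using weighted_sqnorm_shift_small[of "e/12"] e by auto
  obtain \<delta>2 where d2: "\<delta>2 > 0" "\<And>t. \<bar>t\<bar> \<le> \<delta>2 \<Longrightarrow> weighted_sqnorm f (\<lambda>y. h (y + t) - h y) \<le> ennreal (e/12)"
    using bounded_shift_continuous[of h c "e/12"] hc e by auto
  show thesis
  proof (rule that[of "min \<delta>1 \<delta>2"])
    show "min \<delta>1 \<delta>2 > 0" using d1 d2 by auto
    fix t :: real assume t: "\<bar>t\<bar> \<le> min \<delta>1 \<delta>2"
    have "weighted_sqnorm f (\<lambda>y. g (y + t) - g y)
        \<le> 3 * (weighted_sqnorm f (\<lambda>y. w (y + t)) + weighted_sqnorm f (\<lambda>y. h (y + t) - h y) + weighted_sqnorm f (\<lambda>y. - w y))"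
      by (rule weighted_sqnorm_add3_le) (auto simp: w_def)
    also have "weighted_sqnorm f (\<lambda>y. - w y) = weighted_sqnorm f w" by (simp add: weighted_sqnorm_def)
    also have "3 * (weighted_sqnorm f (\<lambda>y. w (y + t)) + weighted_sqnorm f (\<lambda>y. h (y + t) - h y) + weighted_sqnorm f w)
        \<le> 3 * ((ennreal (e/12) + ennreal (e/12)) + ennreal (e/12) + ennreal (e/12))"
      using t by (intro mult_left_mono add_mono d2(2) Nw order_trans[OF d1(2)] wV) auto
    also have "\<dots> = ennreal e"
      using e by (simp add: ennreal_plus[symmetric] ennreal_mult[symmetric] del: ennreal_plus flip: ennreal_numeral)
    finally show "weighted_sqnorm f (\<lambda>y. g (y + t) - g y) \<le> ennreal e" .
  qed
qed

text \<open>
  Compare \<open>g\<close> with the nearest member \<open>g0\<close> of a finite net: \<open>g - g0\<close> is small before the shift, hence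
  also after it by \<open>weighted_sqnorm_shift_small\<close>, and the finitely many \<open>g0\<close> are shifted one by one.
\<close>

proposition totally_bounded_shift_continuous:
  assumes G: "\<And>g. g \<in> G \<Longrightarrow> g \<in> borel_measurable borel" "\<And>g y. g \<in> G \<Longrightarrow> \<bar>g y\<bar> \<le> V y"
    and tb: "\<And>e. e > 0 \<Longrightarrow> \<exists>G0. finite G0 \<and> G0 \<subseteq> G \<and> (\<forall>g\<in>G. \<exists>g0\<in>G0. weighted_sqnorm f (\<lambda>y. g y - g0 y) \<le> ennreal e)"
    and e: "e > 0"
  obtains \<delta> where "\<delta> > 0"
    "\<And>g t. g \<in> G \<Longrightarrow> \<bar>t\<bar> \<le> \<delta> \<Longrightarrow> weighted_sqnorm f (\<lambda>y. g (y + t) - g y) \<le> ennreal e"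
proof -
  obtain G0 where G0: "finite G0" "G0 \<subseteq> G" "\<And>g. g \<in> G \<Longrightarrow> \<exists>g0\<in>G0. weighted_sqnorm f (\<lambda>y. g y - g0 y) \<le> ennreal (e/12)"
    using tb[of "e/12"] e by auto
  obtain \<delta>1 where d1: "\<delta>1 > 0" "\<And>w t. w \<in> borel_measurable borel \<Longrightarrow> (\<And>y. \<bar>w y\<bar> \<le> 2 * V y) \<Longrightarrow> \<bar>t\<bar> \<le> \<delta>1 \<Longrightarrow>
       weighted_sqnorm f (\<lambda>y. w (y + t)) \<le> weighted_sqnorm f w + ennreal (e/12)"
    using weighted_sqnorm_shift_small[of "e/12"] e by auto
  have "\<exists>\<delta>>0. \<forall>t. \<bar>t\<bar> \<le> \<delta> \<longrightarrow> weighted_sqnorm f (\<lambda>y. g (y + t) - g y) \<le> ennreal (e/12)" if g: "g \<in> G0" for g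
  proof -
    have "g \<in> G" using g G0(2) by auto
    then obtain \<delta> where "\<delta> > 0" "\<And>t. \<bar>t\<bar> \<le> \<delta> \<Longrightarrow> weighted_sqnorm f (\<lambda>y. g (y + t) - g y) \<le> ennreal (e/12)"
      using single_shift_continuous[of g "e/12"] G e by auto
    then show ?thesis by blast
  qed
  then obtain D where D: "\<And>g. g \<in> G0 \<Longrightarrow> D g > 0"
    "\<And>g t. g \<in> G0 \<Longrightarrow> \<bar>t\<bar> \<le> D g \<Longrightarrow> weighted_sqnorm f (\<lambda>y. g (y + t) - g y) \<le> ennreal (e/12)"
    by metis
  define \<delta> where "\<delta> = Min (insert \<delta>1 (D ` G0))"
  show thesis
  proof (rule that[of \<delta>])
    show "\<delta> > 0" unfolding \<delta>_def using G0(1) d1(1) D(1) by (subst Min_gr_iff) auto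
    fix g t assume g: "g \<in> G" and t: "\<bar>t\<bar> \<le> \<delta>"
    obtain g0 where g0: "g0 \<in> G0" "weighted_sqnorm f (\<lambda>y. g y - g0 y) \<le> ennreal (e/12)" using G0(3)[OF g] by auto
    have t1: "\<bar>t\<bar> \<le> \<delta>1" "\<bar>t\<bar> \<le> D g0" using t G0(1) g0(1) by (auto simp: \<delta>_def)
    define w where "w y = g y - g0 y" for y
    have g0G: "g0 \<in> G" using g0(1) G0(2) by auto
    have [measurable]: "g \<in> borel_measurable borel" "g0 \<in> borel_measurable borel" "w \<in> borel_measurable borel"
      using G(1) g g0G by (auto simp: w_def[abs_def])
    have wV: "\<bar>w y\<bar> \<le> 2 * V y" for y using G(2)[OF g, of y] G(2)[OF g0G, of y] by (auto simp: w_def)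
    have Nw: "weighted_sqnorm f w \<le> ennreal (e/12)" using g0(2) by (simp add: w_def[abs_def])
    have "weighted_sqnorm f (\<lambda>y. g (y + t) - g y)
        \<le> 3 * (weighted_sqnorm f (\<lambda>y. w (y + t)) + weighted_sqnorm f (\<lambda>y. g0 (y + t) - g0 y) + weighted_sqnorm f (\<lambda>y. - w y))"
      by (rule weighted_sqnorm_add3_le) (auto simp: w_def)
    also have "weighted_sqnorm f (\<lambda>y. - w y) = weighted_sqnorm f w" by (simp add: weighted_sqnorm_def)
    also have "3 * (weighted_sqnorm f (\<lambda>y. w (y + t)) + weighted_sqnorm f (\<lambda>y. g0 (y + t) - g0 y) + weighted_sqnorm f w)
        \<le> 3 * ((ennreal (e/12) + ennreal (e/12)) + ennreal (e/12) + ennreal (e/12))"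
      using t1 g0(1) by (intro mult_left_mono add_mono D(2) Nw order_trans[OF d1(2)] wV) auto
    also have "\<dots> = ennreal e"
      using e by (simp add: ennreal_plus[symmetric] ennreal_mult[symmetric] del: ennreal_plus flip: ennreal_numeral)
    finally show "weighted_sqnorm f (\<lambda>y. g (y + t) - g y) \<le> ennreal e" .
  qed
qed

end

section \<open>Kernel smoothing of the empirical measure\<close>

lemma smoothing_kernel_props:
  assumes "smoothing_kernel k"
  shows "k \<in> borel_measurable borel" "integrable lborel k" "(\<integral>u. k u \<partial>lborel) = 1"
    "\<And>u. 0 \<le> k u" "\<And>u. \<bar>u\<bar> > 1 \<Longrightarrow> k u = 0" "\<exists>B. \<forall>u. k u \<le> B"
proof -
  obtain k' where k': "\<And>x. (k has_real_derivative k' x) (at x)"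
    using assms by (auto simp: smoothing_kernel_def)
  have cont: "continuous_on UNIV k"
    using k' by (intro continuous_at_imp_continuous_on) (auto intro: DERIV_isCont)
  then show "k \<in> borel_measurable borel" by (rule borel_measurable_continuous_onI)
  show "integrable lborel k" "(\<integral>u. k u \<partial>lborel) = 1"
    using assms by (auto simp: smoothing_kernel_def has_bochner_integral_iff)
  show "\<And>u. 0 \<le> k u" using assms by (auto simp: smoothing_kernel_def)
  show out: "k u = 0" if "\<bar>u\<bar> > 1" for u
  proof -
    have "u \<notin> {-1..1}" using that by auto
    then show ?thesis using assms unfolding smoothing_kernel_def by blast
  qed
  have "compact (k ` {-1..1})"
    by (intro compact_continuous_image continuous_on_subset[OF cont]) auto
  from compact_imp_bounded[OF this] obtain B where B: "\<And>u. u \<in> {-1..1} \<Longrightarrow> \<bar>k u\<bar> \<le> B"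
    unfolding bounded_iff by (metis imageI real_norm_def)
  have "k u \<le> max B 0" for u
  proof (cases "\<bar>u\<bar> > 1")
    case False
    then have "\<bar>k u\<bar> \<le> B" by (intro B) auto
    then show ?thesis by linarith
  qed (use out in simp)
  then show "\<exists>B. \<forall>u. k u \<le> B" by blast
qed

context weighted_shift
begin

lemma shift_norm_bounded:
  obtains s C where "s > 0" "0 \<le> C" "\<And>t. \<bar>t\<bar> \<le> s \<Longrightarrow> weighted_sqnorm f (\<lambda>y. V (y + t)) \<le> ennreal C"
proof -
  obtain s where s: "s > 0" "\<And>t. \<bar>t\<bar> \<le> s \<Longrightarrow> weighted_sqnorm f (\<lambda>y. V (y + t) - V y) \<le> ennreal 1"
    using V_shift[of 1] by auto
  define C where "C = enn2real (3 * (ennreal 1 + weighted_sqnorm f V + weighted_sqnorm f (\<lambda>y. 0)))"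
  have "weighted_sqnorm f (\<lambda>y. 0) = 0" by (simp add: weighted_sqnorm_def)
  then have C: "ennreal C = 3 * (ennreal 1 + weighted_sqnorm f V + weighted_sqnorm f (\<lambda>y. 0))"
    unfolding C_def using V_sq by (intro ennreal_enn2real) (auto simp: ennreal_mult_less_top)
  have "weighted_sqnorm f (\<lambda>y. V (y + t)) \<le> ennreal C" if t: "\<bar>t\<bar> \<le> s" for t
  proof -
    have "weighted_sqnorm f (\<lambda>y. V (y + t))
        \<le> 3 * (weighted_sqnorm f (\<lambda>y. V (y + t) - V y) + weighted_sqnorm f V + weighted_sqnorm f (\<lambda>y. 0))"
      by (rule weighted_sqnorm_add3_le) auto
    also have "\<dots> \<le> 3 * (ennreal 1 + weighted_sqnorm f V + weighted_sqnorm f (\<lambda>y. 0))"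
      by (intro mult_left_mono add_mono order_refl s(2) t) auto
    finally show ?thesis using C by simp
  qed
  with s(1) show thesis by (intro that[of s C]) (auto simp: C_def)
qed

text \<open>
  Integrating the bound of \<open>shift_norm_bounded\<close> over the shifts and exchanging integrals shows that
  \<open>V\<^sup>2\<close> is integrable over a neighbourhood of fixed radius of almost every point, as \<open>f\<close> is
  positive. Finitely many such neighbourhoods cover a compact interval. Local integrability makes the
  smoothed process well defined and bounded for every bandwidth, however large.
\<close>

lemma envelope_locally_integrable:
  assumes pos: "\<And>y. 0 < f y"
  shows "integrable lborel (\<lambda>y. indicator {a..b} y * V y)"
proof -
  obtain s C where sC: "s > 0" "0 \<le> C" "\<And>t. \<bar>t\<bar> \<le> s \<Longrightarrow> weighted_sqnorm f (\<lambda>y. V (y + t)) \<le> ennreal C"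
    using shift_norm_bounded by metis
  define H where "H y = (\<integral>\<^sup>+t. indicator {-s..s} t * ennreal ((V (y + t))\<^sup>2) \<partial>lborel)" for y
  have [measurable]: "H \<in> borel_measurable borel" unfolding H_def by measurable
  have "(\<integral>\<^sup>+y. ennreal (f y) * H y \<partial>lborel)
      = (\<integral>\<^sup>+y. \<integral>\<^sup>+t. indicator {-s..s} t * ennreal ((V (y + t))\<^sup>2 * f y) \<partial>lborel \<partial>lborel)"
    unfolding H_def using f_nonneg
    by (intro nn_integral_cong, subst nn_integral_cmult[symmetric])
       (auto simp: ennreal_mult ac_simps intro!: nn_integral_cong)
  also have "\<dots> = (\<integral>\<^sup>+t. \<integral>\<^sup>+y. indicator {-s..s} t * ennreal ((V (y + t))\<^sup>2 * f y) \<partial>lborel \<partial>lborel)"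
    by (intro lborel_pair.Fubini') measurable
  also have "\<dots> = (\<integral>\<^sup>+t. indicator {-s..s} t * weighted_sqnorm f (\<lambda>y. V (y + t)) \<partial>lborel)"
    unfolding weighted_sqnorm_def by (intro nn_integral_cong nn_integral_cmult) measurable
  also have "\<dots> \<le> (\<integral>\<^sup>+t. ennreal C * indicator {-s..s} t \<partial>lborel)"
    using sC(3) by (intro nn_integral_mono) (auto simp: indicator_def)
  also have "\<dots> = ennreal C * ennreal (2 * s)"
    using sC(1) by (subst nn_integral_cmult_indicator) auto
  also have "\<dots> < \<infinity>" by (simp add: ennreal_mult_less_top)
  finally have "(\<integral>\<^sup>+y. ennreal (f y) * H y \<partial>lborel) \<noteq> \<infinity>" by simp
  then have "AE y in lborel. ennreal (f y) * H y \<noteq> \<infinity>"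
    by (intro nn_integral_PInf_AE) measurable
  then have AE: "AE y in lborel. H y < \<infinity>"
    by eventually_elim (use pos in \<open>auto simp: ennreal_mult_eq_top_iff less_top ennreal_eq_0_iff not_le\<close>)
  have loc: "(\<integral>\<^sup>+z. indicator {x..x + s} z * ennreal ((V z)\<^sup>2) \<partial>lborel) < \<infinity>" for x
  proof -
    have "\<exists>y\<in>{x<..<x + s}. H y < \<infinity>"
    proof (rule ccontr)
      assume none: "\<not> ?thesis"
      have "AE y in lborel. y \<notin> {x<..<x + s}" using AE by eventually_elim (use none in auto)
      then have "emeasure lborel {x<..<x + s} = 0"
        by (subst (asm) AE_iff_measurable[where N="{x<..<x + s}"]) auto
      then show False using sC(1) by simp
    qed
    then obtain y where y: "x < y" "y < x + s" "H y < \<infinity>" by auto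
    have "(\<integral>\<^sup>+z. indicator {x..x + s} z * ennreal ((V z)\<^sup>2) \<partial>lborel)
        = (\<integral>\<^sup>+t. indicator {x..x + s} (t + y) * ennreal ((V (t + y))\<^sup>2) \<partial>lborel)"
      by (rule nn_integral_lborel_shift[symmetric]) measurable
    also have "\<dots> \<le> H y"
      unfolding H_def using y by (intro nn_integral_mono) (auto simp: indicator_def add.commute)
    finally show ?thesis using y(3) by (rule le_less_trans)
  qed
  have multi: "(\<integral>\<^sup>+z. indicator {a..a + real n * s} z * ennreal ((V z)\<^sup>2) \<partial>lborel) < \<infinity>" for n
  proof (induction n)
    case 0
    have "(\<integral>\<^sup>+z. indicator {a..a + real 0 * s} z * ennreal ((V z)\<^sup>2) \<partial>lborel)
      \<le> (\<integral>\<^sup>+z. indicator {a..a + s} z * ennreal ((V z)\<^sup>2) \<partial>lborel)"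
      using sC(1) by (intro nn_integral_mono mult_right_mono) (auto simp: indicator_def)
    then show ?case using loc by (rule le_less_trans)
  next
    case (Suc n)
    have "(\<integral>\<^sup>+z. indicator {a..a + real (Suc n) * s} z * ennreal ((V z)\<^sup>2) \<partial>lborel)
      \<le> (\<integral>\<^sup>+z. indicator {a..a + real n * s} z * ennreal ((V z)\<^sup>2)
          + indicator {a + real n * s..a + real n * s + s} z * ennreal ((V z)\<^sup>2) \<partial>lborel)"
      by (intro nn_integral_mono) (auto simp: indicator_def algebra_simps)
    also have "\<dots> = (\<integral>\<^sup>+z. indicator {a..a + real n * s} z * ennreal ((V z)\<^sup>2) \<partial>lborel)
          + (\<integral>\<^sup>+z. indicator {a + real n * s..a + real n * s + s} z * ennreal ((V z)\<^sup>2) \<partial>lborel)"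
      by (rule nn_integral_add) auto
    also have "\<dots> < \<infinity>" using Suc.IH loc by auto
    finally show ?case .
  qed
  obtain n where n: "b - a \<le> real n * s" using ex_less_of_nat_mult[OF sC(1), of "b - a"] by (meson less_imp_le)
  show ?thesis
  proof (rule integrableI_bounded)
    have "(\<integral>\<^sup>+y. ennreal (norm (indicator {a..b} y * V y)) \<partial>lborel)
        \<le> (\<integral>\<^sup>+y. indicator {a..b} y + indicator {a..a + real n * s} y * ennreal ((V y)\<^sup>2) \<partial>lborel)"
    proof (intro nn_integral_mono)
      fix y
      have "\<bar>V y\<bar> \<le> 1 + (V y)\<^sup>2"
        using zero_le_power2[of "\<bar>V y\<bar> - 1"] by (simp add: power2_eq_square algebra_simps)
      then have "ennreal \<bar>V y\<bar> \<le> ennreal 1 + ennreal ((V y)\<^sup>2)"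
        using ennreal_leI[of "\<bar>V y\<bar>" "1 + (V y)\<^sup>2"] ennreal_plus[of 1 "(V y)\<^sup>2"] by (simp del: ennreal_plus)
      then show "ennreal (norm (indicator {a..b} y * V y)) \<le> indicator {a..b} y + indicator {a..a + real n * s} y * ennreal ((V y)\<^sup>2)"
        using n by (auto simp: indicator_def)
    qed
    also have "\<dots> = (\<integral>\<^sup>+y. indicator {a..b} y \<partial>lborel) + (\<integral>\<^sup>+y. indicator {a..a + real n * s} y * ennreal ((V y)\<^sup>2) \<partial>lborel)"
      by (rule nn_integral_add) auto
    also have "\<dots> < \<infinity>" using multi[of n] by (auto simp: emeasure_lborel_Icc_eq)
    finally show "(\<integral>\<^sup>+y. ennreal (norm (indicator {a..b} y * V y)) \<partial>lborel) < \<infinity>" .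
  qed measurable
qed

lemma envelope_kernel_integrable:
  assumes pos: "\<And>y. 0 < f y" and k: "smoothing_kernel k" and b: "b > 0"
    and [measurable]: "g \<in> borel_measurable borel" and g: "\<And>y. \<bar>g y\<bar> \<le> V y"
  shows "integrable lborel (\<lambda>y. g y * scaled_kernel k b (y - x))"
proof -
  note kp = smoothing_kernel_props[OF k]
  note [measurable] = kp(1)
  obtain B where B: "\<And>u. k u \<le> B" using kp(6) by auto
  have dom: "integrable lborel (\<lambda>y. (B / b) * (indicator {x - b..x + b} y * V y))"
    using envelope_locally_integrable[OF pos] by simp
  have meas: "(\<lambda>y. g y * scaled_kernel k b (y - x)) \<in> borel_measurable lborel"
    unfolding scaled_kernel_def by measurable
  have B0: "0 \<le> B" using B[of 0] kp(4)[of 0] by linarith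
  have "\<bar>g y * scaled_kernel k b (y - x)\<bar> \<le> (B / b) * (indicator {x - b..x + b} y * V y)" for y
  proof (cases "\<bar>(y - x) / b\<bar> > 1")
    case True
    have "0 \<le> V y" using g[of y] by linarith
    then show ?thesis using kp(5)[OF True] B0 b by (simp add: scaled_kernel_def indicator_def)
  next
    case False
    then have "y \<in> {x - b..x + b}" using b by (auto simp: field_simps abs_le_iff)
    then have i: "indicator {x - b..x + b} y = (1::real)" by simp
    have "\<bar>g y\<bar> * (k ((y - x) / b) / b) \<le> V y * (B / b)"
      using g[of y] B kp(4) b by (intro mult_mono divide_right_mono) auto
    then show ?thesis using kp(4)[of "(y - x)/b"] b by (simp add: abs_mult scaled_kernel_def i mult.commute)
  qed
  then have "AE y in lborel. norm (g y * scaled_kernel k b (y - x)) \<le> norm ((B / b) * (indicator {x - b..x + b} y * V y))"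
    by (intro AE_I2) (metis real_norm_def abs_ge_self order_trans)
  with dom meas show ?thesis
    by (rule Bochner_Integration.integrable_bound)
qed

lemma integrable_mult_scaled_kernel_subst:
  fixes g :: "real \<Rightarrow> real"
  assumes b: "b > 0" and i: "integrable lborel (\<lambda>y. g y * scaled_kernel k b (y - x))"
  shows "integrable lborel (\<lambda>u. k u * g (x + b * u))"
    "(\<integral>y. g y * scaled_kernel k b (y - x) \<partial>lborel) = (\<integral>u. k u * g (x + b * u) \<partial>lborel)"
proof -
  have eq: "g (x + b * u) * scaled_kernel k b ((x + b * u) - x) = (1 / b) * (k u * g (x + b * u))" for u
    using b by (simp add: scaled_kernel_def)
  have "integrable lborel (\<lambda>u. (1 / b) * (k u * g (x + b * u)))"
    using lborel_integrable_real_affine[OF i, of b x] b unfolding eq by simp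
  then have "integrable lborel (\<lambda>u. b * ((1 / b) * (k u * g (x + b * u))))" by (rule integrable_mult_right)
  then show "integrable lborel (\<lambda>u. k u * g (x + b * u))" using b by simp
  show "(\<integral>y. g y * scaled_kernel k b (y - x) \<partial>lborel) = (\<integral>u. k u * g (x + b * u) \<partial>lborel)"
    using lborel_integral_real_affine[of b "\<lambda>y. g y * scaled_kernel k b (y - x)" x] b unfolding eq by simp
qed

lemma envelope_shift_integrable:
  assumes C: "0 \<le> C" "weighted_sqnorm f (\<lambda>y. V (y + t)) \<le> ennreal C"
    and [measurable]: "g \<in> borel_measurable borel" and g: "\<And>y. \<bar>g y\<bar> \<le> V y"
  shows "(\<integral>\<^sup>+y. ennreal \<bar>g (y + t) * f y\<bar> \<partial>lborel) \<le> ennreal ((\<integral>y. f y \<partial>lborel) + C)"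
    "integrable lborel (\<lambda>y. g (y + t) * f y)"
proof -
  have "(\<integral>\<^sup>+y. ennreal \<bar>g (y + t) * f y\<bar> \<partial>lborel) \<le> (\<integral>\<^sup>+y. ennreal (f y) + ennreal ((V (y + t))\<^sup>2 * f y) \<partial>lborel)"
  proof (rule nn_integral_mono)
    fix y
    have "\<bar>g (y + t)\<bar> \<le> 1 + (V (y + t))\<^sup>2"
      using g[of "y + t"] zero_le_power2[of "V (y + t) - 1"] zero_le_power2[of "V (y + t)"]
      by (simp add: power2_eq_square algebra_simps)
    then have "\<bar>g (y + t) * f y\<bar> \<le> (1 + (V (y + t))\<^sup>2) * f y"
      using f_nonneg[of y] by (simp add: abs_mult mult_right_mono)
    also have "\<dots> = f y + (V (y + t))\<^sup>2 * f y" by (simp add: algebra_simps)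
    finally have "ennreal \<bar>g (y + t) * f y\<bar> \<le> ennreal (f y + (V (y + t))\<^sup>2 * f y)" by (rule ennreal_leI)
    then show "ennreal \<bar>g (y + t) * f y\<bar> \<le> ennreal (f y) + ennreal ((V (y + t))\<^sup>2 * f y)"
      using f_nonneg[of y] by simp
  qed
  also have "\<dots> = (\<integral>\<^sup>+y. ennreal (f y) \<partial>lborel) + weighted_sqnorm f (\<lambda>y. V (y + t))"
    unfolding weighted_sqnorm_def by (rule nn_integral_add) auto
  also have "\<dots> \<le> ennreal (\<integral>y. f y \<partial>lborel) + ennreal C"
    using C(2) nn_integral_eq_integral[OF f_int] f_nonneg by (intro add_mono) auto
  also have "\<dots> = ennreal ((\<integral>y. f y \<partial>lborel) + C)"
    using C(1) f_nonneg by (intro ennreal_plus[symmetric]) auto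
  finally show *: "(\<integral>\<^sup>+y. ennreal \<bar>g (y + t) * f y\<bar> \<partial>lborel) \<le> ennreal ((\<integral>y. f y \<partial>lborel) + C)" .
  show "integrable lborel (\<lambda>y. g (y + t) * f y)"
    using * by (intro integrableI_bounded) (auto intro: le_less_trans)
qed

text \<open>
  With \<open>m t\<close> the mean of \<open>g(\<cdot> + t)\<close> under \<open>f\<close>, Fubini's theorem identifies the integral of \<open>g\<close> against the
  convolution with the kernel average of \<open>m\<close>. This is the population counterpart of the
  substitution that is applied to the kernel estimator.
\<close>

lemma smoothing_bias:
  fixes m :: "real \<Rightarrow> real"
  assumes k: "smoothing_kernel k" and b: "0 < b" "b \<le> s"
    and C: "0 \<le> C" "\<And>t. \<bar>t\<bar> \<le> s \<Longrightarrow> weighted_sqnorm f (\<lambda>y. V (y + t)) \<le> ennreal C"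
    and [measurable]: "g \<in> borel_measurable borel" and g: "\<And>y. \<bar>g y\<bar> \<le> V y"
  defines "m \<equiv> \<lambda>t. \<integral>y. g (y + t) * f y \<partial>lborel"
  shows "integrable lborel (\<lambda>y. g y * convolve f (scaled_kernel k b) y)"
    "integrable lborel (\<lambda>u. k u * m (b * u))"
    "(\<integral>y. g y * convolve f (scaled_kernel k b) y \<partial>lborel) = (\<integral>u. k u * m (b * u) \<partial>lborel)"
proof -
  note kp = smoothing_kernel_props[OF k]
  note [measurable] = kp(1)
  define K where "K = scaled_kernel k b"
  have [measurable]: "K \<in> borel_measurable borel" unfolding K_def scaled_kernel_def by measurable
  have K0: "0 \<le> K x" for x using kp(4) b by (simp add: K_def scaled_kernel_def)
  have Kout: "K x = 0" if "\<bar>x\<bar> > s" for x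
  proof -
    have "\<bar>x / b\<bar> > 1" using that b by (simp add: abs_divide)
    then show ?thesis by (simp add: K_def scaled_kernel_def kp(5))
  qed
  have Kint: "integrable lborel K"
    using lborel_integrable_real_affine[OF kp(2), of "1/b" 0] b by (simp add: K_def scaled_kernel_def[abs_def])
  define \<Phi> where "\<Phi> y x = g y * f (y - x) * K x" for y x
  define D where "D = (\<integral>y. f y \<partial>lborel) + C"
  have \<Phi>int: "integrable (lborel \<Otimes>\<^sub>M lborel) (\<lambda>(y, x). \<Phi> y x)"
  proof (rule integrableI_bounded)
    show [measurable]: "(\<lambda>(y, x). \<Phi> y x) \<in> borel_measurable (lborel \<Otimes>\<^sub>M lborel)"
      unfolding \<Phi>_def by measurable
    have "(\<integral>\<^sup>+p. ennreal (norm (case p of (y, x) \<Rightarrow> \<Phi> y x)) \<partial>(lborel \<Otimes>\<^sub>M lborel))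
        = (\<integral>\<^sup>+x. \<integral>\<^sup>+y. ennreal \<bar>\<Phi> y x\<bar> \<partial>lborel \<partial>lborel)"
      by (subst lborel_pair.nn_integral_snd[symmetric]) auto
    also have "\<dots> \<le> (\<integral>\<^sup>+x. ennreal D * ennreal (K x) \<partial>lborel)"
    proof (rule nn_integral_mono)
      fix x
      have "(\<integral>\<^sup>+y. ennreal \<bar>\<Phi> y x\<bar> \<partial>lborel) = (\<integral>\<^sup>+y. ennreal \<bar>\<Phi> (y + x) x\<bar> \<partial>lborel)"
        unfolding \<Phi>_def by (rule nn_integral_lborel_shift[symmetric]) measurable
      also have "\<dots> = (\<integral>\<^sup>+y. ennreal (K x) * ennreal \<bar>g (y + x) * f y\<bar> \<partial>lborel)"
        using K0[of x] by (simp add: \<Phi>_def abs_mult ennreal_mult[symmetric] mult.commute)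
      also have "\<dots> = ennreal (K x) * (\<integral>\<^sup>+y. ennreal \<bar>g (y + x) * f y\<bar> \<partial>lborel)"
        by (rule nn_integral_cmult) measurable
      also have "\<dots> \<le> ennreal (K x) * ennreal D"
      proof (cases "\<bar>x\<bar> > s")
        case False
        then show ?thesis
          unfolding D_def using C g by (intro mult_left_mono envelope_shift_integrable(1)) auto
      qed (simp add: Kout)
      finally show "(\<integral>\<^sup>+y. ennreal \<bar>\<Phi> y x\<bar> \<partial>lborel) \<le> ennreal D * ennreal (K x)" by (simp add: mult.commute)
    qed
    also have "\<dots> = ennreal D * (\<integral>\<^sup>+x. ennreal (K x) \<partial>lborel)" by (rule nn_integral_cmult) measurable
    also have "\<dots> < \<infinity>"
      using nn_integral_eq_integral[OF Kint] K0 by (simp add: ennreal_mult_less_top)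
    finally show "(\<integral>\<^sup>+p. ennreal (norm (case p of (y, x) \<Rightarrow> \<Phi> y x)) \<partial>(lborel \<Otimes>\<^sub>M lborel)) < \<infinity>" .
  qed
  have inner1: "(\<integral>x. \<Phi> y x \<partial>lborel) = g y * convolve f K y" for y
    unfolding \<Phi>_def convolve_def by (simp add: mult.assoc)
  have inner2: "(\<integral>y. \<Phi> y x \<partial>lborel) = m x * K x" for x
  proof -
    have "(\<integral>y. \<Phi> y x \<partial>lborel) = (\<integral>y. \<Phi> (y + x) x \<partial>lborel)" by (rule integral_lborel_shift[symmetric])
    also have "\<dots> = m x * K x" by (simp add: \<Phi>_def m_def)
    finally show ?thesis .
  qed
  show "integrable lborel (\<lambda>y. g y * convolve f (scaled_kernel k b) y)"
    using lborel_pair.integrable_fst[OF \<Phi>int] by (simp add: inner1 K_def)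
  have "integrable lborel (\<lambda>x. m x * K x)"
    using lborel_pair.integrable_snd[OF \<Phi>int] by (simp add: inner2)
  then have mK: "integrable lborel (\<lambda>x. m x * scaled_kernel k b (x - 0))" by (simp add: K_def)
  note sub = integrable_mult_scaled_kernel_subst[OF b(1) mK]
  show "integrable lborel (\<lambda>u. k u * m (b * u))" using sub(1) by simp
  have "(\<integral>y. g y * convolve f K y \<partial>lborel) = (\<integral>x. m x * K x \<partial>lborel)"
    using lborel_pair.Fubini_integral[OF \<Phi>int] by (simp add: inner1 inner2)
  then show "(\<integral>y. g y * convolve f (scaled_kernel k b) y \<partial>lborel) = (\<integral>u. k u * m (b * u) \<partial>lborel)"
    using sub(2) by (simp add: K_def)
qed

text \<open>
  Smoothing averages the shifted centered empirical means against the kernel. If these vary by at most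
  \<open>r\<close> over shifts up to the bandwidth, then smoothing changes the empirical mean by at most
  \<open>r\<close> plus the deterministic bias.
\<close>
proposition smoothing_deviation:
  fixes x :: "nat \<Rightarrow> real" and n :: nat
  assumes pos: "\<And>y. 0 < f y" and k: "smoothing_kernel k" and b: "0 < b" "b \<le> s"
    and C: "0 \<le> C" "\<And>t. \<bar>t\<bar> \<le> s \<Longrightarrow> weighted_sqnorm f (\<lambda>y. V (y + t)) \<le> ennreal C"
    and gm [measurable]: "g \<in> borel_measurable borel" and g: "\<And>y. \<bar>g y\<bar> \<le> V y"
    and r: "\<And>t. \<bar>t\<bar> \<le> b \<Longrightarrow>
      \<bar>((1 / real n) * (\<Sum>i<n. g (x i + t)) - (\<integral>y. g (y + t) * f y \<partial>lborel))
        - ((1 / real n) * (\<Sum>i<n. g (x i)) - (\<integral>y. g y * f y \<partial>lborel))\<bar> \<le> r"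
  shows "\<bar>(\<integral>y. g y * ((1 / real n) * (\<Sum>i<n. scaled_kernel k b (y - x i))) \<partial>lborel) - (1 / real n) * (\<Sum>i<n. g (x i))\<bar>
      \<le> r + \<bar>\<integral>y. g y * (convolve f (scaled_kernel k b) y - f y) \<partial>lborel\<bar>"
proof -
  note kp = smoothing_kernel_props[OF k]
  define m where "m t = (\<integral>y. g (y + t) * f y \<partial>lborel)" for t
  define P where "P t = (1 / real n) * (\<Sum>i<n. g (x i + t))" for t
  note bias = smoothing_bias[OF k b C gm g, folded m_def]
  have m0: "(\<integral>y. g y * f y \<partial>lborel) = m 0" by (simp add: m_def)
  have gf: "integrable lborel (\<lambda>y. g y * f y)"
    using envelope_shift_integrable(2)[OF C(1) C(2)[of 0] gm g] b by simp
  have i1: "integrable lborel (\<lambda>y. g y * scaled_kernel k b (y - x i))" for i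
    using envelope_kernel_integrable[OF pos k b(1) gm g] .
  have i2: "integrable lborel (\<lambda>u. k u * g (x i + b * u))" for i
    using integrable_mult_scaled_kernel_subst(1)[OF b(1) i1] .
  have kP: "k u * P (b * u) = (1 / real n) * (\<Sum>i<n. k u * g (x i + b * u))" for u
    by (simp add: P_def sum_distrib_left)
  have kPint: "integrable lborel (\<lambda>u. k u * P (b * u))"
    unfolding kP using i2 by auto
  have "(\<integral>y. g y * ((1 / real n) * (\<Sum>i<n. scaled_kernel k b (y - x i))) \<partial>lborel)
      = (\<integral>y. (1 / real n) * (\<Sum>i<n. g y * scaled_kernel k b (y - x i)) \<partial>lborel)"
    by (simp add: sum_distrib_left mult.left_commute)
  also have "\<dots> = (1 / real n) * (\<Sum>i<n. \<integral>u. k u * g (x i + b * u) \<partial>lborel)"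
    using i1 by (simp add: integrable_mult_scaled_kernel_subst(2)[OF b(1) i1])
  also have "\<dots> = (\<integral>u. k u * P (b * u) \<partial>lborel)"
    unfolding kP using i2 by simp
  finally have smooth: "(\<integral>y. g y * ((1 / real n) * (\<Sum>i<n. scaled_kernel k b (y - x i))) \<partial>lborel)
      = (\<integral>u. k u * P (b * u) \<partial>lborel)" .
  define D where "D u = (P (b * u) - m (b * u)) - (P 0 - m 0)" for u
  have kD: "k u * D u = k u * P (b * u) - k u * m (b * u) - k u * (P 0 - m 0)" for u
    by (simp add: D_def algebra_simps)
  have kc: "integrable lborel (\<lambda>u. k u * (P 0 - m 0))" using kp(2) by simp
  have kDint: "integrable lborel (\<lambda>u. k u * D u)"
    unfolding kD using kPint bias(2) kc by (intro Bochner_Integration.integrable_diff)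
  have "(\<integral>u. k u * D u \<partial>lborel) = (\<integral>u. k u * P (b * u) \<partial>lborel) - (\<integral>u. k u * m (b * u) \<partial>lborel) - (P 0 - m 0)"
    unfolding kD using kPint bias(2) kc kp(2,3) by simp
  moreover have "(\<integral>y. g y * (convolve f (scaled_kernel k b) y - f y) \<partial>lborel) = (\<integral>u. k u * m (b * u) \<partial>lborel) - m 0"
    using bias(1,3) gf by (simp add: right_diff_distrib m0)
  ultimately have split: "(\<integral>u. k u * P (b * u) \<partial>lborel) - P 0
      = (\<integral>u. k u * D u \<partial>lborel) + (\<integral>y. g y * (convolve f (scaled_kernel k b) y - f y) \<partial>lborel)"
    by simp
  have "\<bar>\<integral>u. k u * D u \<partial>lborel\<bar> \<le> (\<integral>u. \<bar>k u * D u\<bar> \<partial>lborel)" by (rule integral_abs_bound)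
  also have "\<dots> \<le> (\<integral>u. k u * r \<partial>lborel)"
  proof (rule integral_mono)
    show "integrable lborel (\<lambda>u. \<bar>k u * D u\<bar>)" using kDint by (rule integrable_abs)
    show "integrable lborel (\<lambda>u. k u * r)" using kp(2) by simp
    fix u
    show "\<bar>k u * D u\<bar> \<le> k u * r"
    proof (cases "\<bar>u\<bar> > 1")
      case False
      then have "\<bar>b * u\<bar> \<le> b" using b(1) by (simp add: abs_mult)
      from r[OF this] have "\<bar>D u\<bar> \<le> r" by (simp add: D_def P_def m_def)
      then show ?thesis using kp(4)[of u] by (simp add: abs_mult mult_left_mono)
    qed (simp add: kp(5))
  qed
  also have "\<dots> = r" using kp(3) by simp
  finally have "\<bar>\<integral>u. k u * D u \<partial>lborel\<bar> \<le> r" .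
  moreover have "(1 / real n) * (\<Sum>i<n. g (x i)) = P 0" by (simp add: P_def)
  ultimately show ?thesis unfolding smooth using split by linarith
qed

end

section \<open>Restriction of the index set, and i.i.d. sequences\<close>

lemma restrict_continuous_map_linf:
  assumes "S \<subseteq> T"
  shows "continuous_map (mtopology_of (linf T)) (mtopology_of (linf S)) (\<lambda>z. restrict z S)"
proof (rule Lipschitz_continuous_imp_continuous_map)
  have mem: "restrict z S \<in> mspace (linf S)" if "z \<in> mspace (linf T)" for z
    using that assms unfolding mspace_linf_iff by fastforce
  show "Lipschitz_continuous_map (linf T) (linf S) (\<lambda>z. restrict z S)"
    unfolding Lipschitz_continuous_map_def
  proof (intro conjI exI[of _ 1] ballI)
    fix z w assume zw: "z \<in> mspace (linf T)" "w \<in> mspace (linf T)"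
    show "mdist (linf S) (restrict z S) (restrict w S) \<le> 1 * mdist (linf T) z w"
      unfolding mult_1 using assms abs_diff_le_mdist_linf[OF zw]
      by (intro mdist_linf_le mem zw mdist_nonneg) auto
  qed (use mem in blast)
qed

lemma tight_brownian_bridge_law_restrict:
  assumes L: "tight_brownian_bridge_law P T L" and S: "S \<subseteq> T"
  shows "tight_brownian_bridge_law P S (distr L (metric_borel (linf S)) (\<lambda>z. restrict z S))"
    (is "tight_brownian_bridge_law P S ?L")
proof -
  have tl: "tight_law (linf T) L" and gl: "centered_gaussian_law T L"
    and cov: "\<And>u v. u \<in> T \<Longrightarrow> v \<in> T \<Longrightarrow> (\<integral>z. z u * z v \<partial>L) =
        (\<integral>x. u x * v x \<partial>P) - (\<integral>x. u x \<partial>P) * (\<integral>x. v x \<partial>P)"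
    using L by (auto simp: tight_brownian_bridge_law_def)
  note cont = restrict_continuous_map_linf[OF S]
  have sL: "sets L = sets (metric_borel (linf T))" using tl by (simp add: tight_law_def)
  note rm = continuous_map_measurable_metric_borel[OF cont sL]
  have ev: "(\<lambda>z. z t) \<in> borel_measurable (metric_borel (linf S))" if "t \<in> S" for t
    using continuous_map_borel_measurable[OF eval_continuous_map[OF that] refl] .
  have "centered_gaussian_law S ?L"
    unfolding centered_gaussian_law_def
  proof (intro allI impI)
    fix R and c :: "('a \<Rightarrow> real) \<Rightarrow> real" assume R: "finite R \<and> R \<subseteq> S"
    have "(\<lambda>z. \<Sum>t\<in>R. c t * z t) \<in> borel_measurable (metric_borel (linf S))"
      using ev R by (intro borel_measurable_sum borel_measurable_times) auto
    then have "distr ?L borel (\<lambda>z. \<Sum>t\<in>R. c t * z t) = distr L borel (\<lambda>z. \<Sum>t\<in>R. c t * restrict z S t)"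
      by (subst distr_distr[OF _ rm]) (auto simp: o_def)
    also have "\<dots> = distr L borel (\<lambda>z. \<Sum>t\<in>R. c t * z t)"
      using R by (intro arg_cong[where f="distr L borel"] ext sum.cong) auto
    finally show "\<exists>\<sigma>\<ge>0. distr ?L borel (\<lambda>z. \<Sum>t\<in>R. c t * z t) = normal_law 0 \<sigma>"
      using gl R S unfolding centered_gaussian_law_def by (metis order_trans)
  qed
  moreover have "(\<integral>z. z u * z v \<partial>?L) = (\<integral>x. u x * v x \<partial>P) - (\<integral>x. u x \<partial>P) * (\<integral>x. v x \<partial>P)"
    if uv: "u \<in> S" "v \<in> S" for u v
  proof -
    have "(\<integral>z. z u * z v \<partial>?L) = (\<integral>z. restrict z S u * restrict z S v \<partial>L)"
      using ev uv by (intro integral_distr[OF rm] borel_measurable_times) auto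
    then show ?thesis using cov[of u v] uv S by auto
  qed
  ultimately show ?thesis
    using tight_law_distr[OF tl cont] by (auto simp: tight_brownian_bridge_law_def)
qed

lemma (in prob_space) distr_iid_sequence:
  assumes ind: "indep_vars (\<lambda>_. borel) X UNIV" and law: "\<And>i::nat. distr M borel (X i) = F"
    and sF: "sets F = sets (borel :: real measure)"
  shows "(\<lambda>\<omega> i. X i \<omega>) \<in> measurable M (\<Pi>\<^sub>M i\<in>(UNIV :: nat set). F)"
    "distr M (\<Pi>\<^sub>M i\<in>(UNIV :: nat set). F) (\<lambda>\<omega> i. X i \<omega>) = (\<Pi>\<^sub>M i\<in>(UNIV :: nat set). F)"
proof -
  have rv: "random_variable borel (X i)" for i using ind by (auto simp: indep_vars_def)
  have s: "sets (\<Pi>\<^sub>M i\<in>(UNIV :: nat set). F) = sets (\<Pi>\<^sub>M i\<in>(UNIV :: nat set). borel)"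
    using sF by (intro sets_PiM_cong) auto
  have "(\<lambda>\<omega>. \<lambda>i\<in>UNIV. X i \<omega>) \<in> measurable M (\<Pi>\<^sub>M i\<in>(UNIV :: nat set). borel)"
    using rv by (intro measurable_restrict) auto
  then show "(\<lambda>\<omega> i. X i \<omega>) \<in> measurable M (\<Pi>\<^sub>M i\<in>(UNIV :: nat set). F)"
    by (simp add: measurable_cong_sets[OF refl s] restrict_UNIV)
  have "distr M (\<Pi>\<^sub>M i\<in>(UNIV :: nat set). F) (\<lambda>\<omega> i. X i \<omega>) = distr M (\<Pi>\<^sub>M i\<in>(UNIV :: nat set). borel) (\<lambda>\<omega> i. X i \<omega>)"
    by (intro distr_cong s) auto
  also have "\<dots> = (\<Pi>\<^sub>M i\<in>(UNIV :: nat set). F)"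
    using ind rv law indep_vars_iff_distr_eq_PiM'[where I=UNIV and M'="\<lambda>_. borel" and X=X] by (simp add: restrict_UNIV)
  finally show "distr M (\<Pi>\<^sub>M i\<in>(UNIV :: nat set). F) (\<lambda>\<omega> i. X i \<omega>) = (\<Pi>\<^sub>M i\<in>(UNIV :: nat set). F)" .
qed

lemma weighted_sqnorm_eq_integral_density:
  assumes [measurable]: "f \<in> borel_measurable borel" "h \<in> borel_measurable borel" and "\<And>y. 0 \<le> f y"
    and "integrable (density lborel (\<lambda>y. ennreal (f y))) (\<lambda>y. (h y)\<^sup>2)"
  shows "weighted_sqnorm f h = ennreal (\<integral>y. (h y)\<^sup>2 \<partial>density lborel (\<lambda>y. ennreal (f y)))"
proof -
  have "weighted_sqnorm f h = (\<integral>\<^sup>+y. ennreal ((h y)\<^sup>2) \<partial>density lborel (\<lambda>y. ennreal (f y)))"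
    unfolding weighted_sqnorm_def using assms(3)
    by (subst nn_integral_density) (auto simp: ennreal_mult mult.commute intro!: nn_integral_cong)
  also have "\<dots> = ennreal (\<integral>y. (h y)\<^sup>2 \<partial>density lborel (\<lambda>y. ennreal (f y)))"
    using assms(4) by (intro nn_integral_eq_integral) auto
  finally show ?thesis .
qed

section \<open>Convergence of the smoothed empirical process\<close>

context weighted_shift
begin

lemma kernel_estimator_integrable:
  assumes pos: "\<And>y. 0 < f y" and k: "smoothing_kernel k" and b: "b n > 0"
    and g: "g \<in> borel_measurable borel" "\<And>y. \<bar>g y\<bar> \<le> V y"
  shows "integrable lborel (\<lambda>y. g y * kernel_estimator k b \<epsilon> n \<omega> y)"
proof -
  have "integrable lborel (\<lambda>y. (1 / real n) * (\<Sum>i<n. g y * scaled_kernel k (b n) (y - \<epsilon> i \<omega>)))"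
    using envelope_kernel_integrable[OF pos k b g] by auto
  then show ?thesis by (simp add: kernel_estimator_def sum_distrib_left mult.left_commute)
qed

lemma density_integrable:
  assumes g: "g \<in> borel_measurable borel" "\<And>y. \<bar>g y\<bar> \<le> V y"
  shows "integrable lborel (\<lambda>y. g y * f y)"
proof -
  obtain s C where sC: "s > 0" "0 \<le> C" "\<And>t. \<bar>t\<bar> \<le> s \<Longrightarrow> weighted_sqnorm f (\<lambda>y. V (y + t)) \<le> ennreal C"
    using shift_norm_bounded by metis
  show ?thesis using envelope_shift_integrable(2)[OF sC(2) sC(3)[of 0] g] sC(1) by simp
qed

lemma smoothed_process_bounded:
  assumes pos: "\<And>y. 0 < f y" and k: "smoothing_kernel k" and b: "b n > 0"
    and G: "\<And>g. g \<in> G \<Longrightarrow> g \<in> borel_measurable borel" "\<And>g y. g \<in> G \<Longrightarrow> \<bar>g y\<bar> \<le> V y"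
  shows "\<exists>B. \<forall>g\<in>G. \<bar>\<integral>y. g y * (kernel_estimator k b \<epsilon> n \<omega> y - f y) \<partial>lborel\<bar> \<le> B"
proof (cases "G = {}")
  case False
  then obtain g0 where "g0 \<in> G" by auto
  then have V0: "0 \<le> V y" for y using G(2)[of g0 y] by linarith
  let ?k = "kernel_estimator k b \<epsilon> n \<omega>"
  have k0: "0 \<le> ?k y" for y
    using smoothing_kernel_props(4)[OF k] b
    by (auto simp: kernel_estimator_def scaled_kernel_def less_imp_le intro!: divide_nonneg_nonneg sum_nonneg)
  have Vi: "integrable lborel (\<lambda>y. V y * (?k y + f y))"
    using kernel_estimator_integrable[where b=b and \<epsilon>=\<epsilon> and \<omega>=\<omega>, OF pos k b V_meas] density_integrable[OF V_meas] V0
    by (simp add: distrib_left)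
  have "\<bar>\<integral>y. g y * (?k y - f y) \<partial>lborel\<bar> \<le> (\<integral>y. V y * (?k y + f y) \<partial>lborel)" if g: "g \<in> G" for g
  proof (rule integral_abs_bound_integral[OF _ Vi])
    show "integrable lborel (\<lambda>y. g y * (?k y - f y))"
      using kernel_estimator_integrable[where b=b and \<epsilon>=\<epsilon> and \<omega>=\<omega>, OF pos k b G(1) G(2), OF g g] density_integrable[OF G(1) G(2), OF g g]
      by (simp add: right_diff_distrib)
    fix y
    show "\<bar>g y * (?k y - f y)\<bar> \<le> V y * (?k y + f y)"
      unfolding abs_mult using G(2)[OF g, of y] k0[of y] f_nonneg[of y] by (intro mult_mono) auto
  qed
  then show ?thesis by blast
qed auto

end

theorem proposition2p1:
  fixes M :: "'a measure"
    and \<epsilon> :: "nat \<Rightarrow> 'a \<Rightarrow> real"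
    and f :: "real \<Rightarrow> real"
    and F :: "real measure"
    and k :: "real \<Rightarrow> real"
    and b :: "nat \<Rightarrow> real"
    and d :: nat
    and G :: "(real \<Rightarrow> real) set"
    and \<eta> :: real
    and V :: "real \<Rightarrow> real"
  assumes "prob_space M"
    and "prob_space.indep_vars M (\<lambda>_. borel) \<epsilon> UNIV"
    and f_meas: "f \<in> borel_measurable borel" and f_pos: "\<And>y. f y > 0"
    and "\<And>i. distributed M lborel (\<epsilon> i) (\<lambda>y. ennreal (f y))"
    and "\<And>i. integrable M (\<lambda>\<omega>. (\<epsilon> i \<omega>)\<^sup>2)"
    and "\<And>i. (\<integral>\<omega>. \<epsilon> i \<omega> \<partial>M) = 0"
    and F: "F = density lborel (\<lambda>y. ennreal (f y))"
    and "smoothing_kernel k"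
    and "d \<ge> 1"
    and "\<And>n. n \<ge> 1 \<Longrightarrow> b n > 0"
    and "(\<lambda>n. real n * b n ^ 4) \<longlonglongrightarrow> 0"
    and "filterlim (\<lambda>n. real n * b n powr ((50 + 20 * real d) / (14 + 5 * real d)))
           at_top sequentially"
    and "G \<subseteq> borel_measurable borel"
    and "\<eta> > 0"
    and "donsker F (shift_class G \<eta>)"
    and "envelope (shift_class G \<eta>) V"
    and "V \<in> borel_measurable borel" and "integrable F (\<lambda>y. (V y)\<^sup>2)"
    and "((\<lambda>s. \<integral>\<^sup>+y. ennreal ((V (y + s) - V y)\<^sup>2 * f y) \<partial>lborel) \<longlongrightarrow> 0) (at 0)"
    and "(\<lambda>n. SUP g\<in>G. ennreal \<bar>sqrt (real n) *
            (\<integral>y. g y * (convolve f (scaled_kernel k (b n)) y - f y) \<partial>lborel)\<bar>) \<longlonglongrightarrow> 0"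
  shows "little_o_p M
           (\<lambda>n \<omega>. SUP g\<in>G. ennreal \<bar>(\<integral>y. g y * kernel_estimator k b \<epsilon> n \<omega> y \<partial>lborel)
              - (1 / real n) * (\<Sum>i<n. g (\<epsilon> i \<omega>))\<bar>)
           (\<lambda>n. real n powr (- 1 / 2))
       \<and> (\<exists>L. tight_brownian_bridge_law F G L \<and>
           converges_weakly M (linf G)
             (\<lambda>n \<omega>. \<lambda>g\<in>G. sqrt (real n) *
                (\<integral>y. g y * (kernel_estimator k b \<epsilon> n \<omega> y - f y) \<partial>lborel)) L)"
proof -
  interpret M: prob_space M by fact
  let ?T = "shift_class G \<eta>"
  note ind = assms(2) and dist = assms(5) and k = assms(9) and bpos = assms(11) and nb4 = assms(12)
    and Gm = assms(14) and \<eta> = assms(15) and dons = assms(16) and env = assms(17)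
    and Vm = assms(18) and V2 = assms(19) and Vs = assms(20) and bias = assms(21)
  have sF: "sets F = sets borel" by (simp add: F)
  have law: "distr M borel (\<epsilon> i) = F" for i
  proof -
    have "distr M borel (\<epsilon> i) = distr M lborel (\<epsilon> i)" by (intro distr_cong) auto
    then show ?thesis using dist[of i] by (simp add: distributed_def F)
  qed
  have "M.random_variable borel (\<epsilon> 0)" using ind by (auto simp: M.indep_vars_def)
  then have PF: "prob_space F" using M.prob_space_distr[of "\<epsilon> 0" borel] law[of 0] by simp
  then interpret F: prob_space F .
  have f0: "0 \<le> f y" for y using f_pos[of y] by simp
  have nnf: "(\<integral>\<^sup>+y. ennreal (f y) \<partial>lborel) = 1"
    using F.emeasure_space_1 f_meas by (simp add: F emeasure_density)
  have fint: "integrable lborel f"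
    using nnf f_meas f0 by (intro integrableI_bounded) auto
  have sqF: "weighted_sqnorm f h = ennreal (\<integral>y. (h y)\<^sup>2 \<partial>F)"
    if "h \<in> borel_measurable borel" "integrable F (\<lambda>y. (h y)\<^sup>2)" for h
    using weighted_sqnorm_eq_integral_density[OF f_meas that(1) f0] that(2) by (simp add: F)
  have V_shift: "\<exists>\<delta>>0. \<forall>t. \<bar>t\<bar> \<le> \<delta> \<longrightarrow> weighted_sqnorm f (\<lambda>y. V (y + t) - V y) \<le> ennreal e" if "e > 0" for e
  proof -
    \<comment> \<open>The hypothesis on \<open>V\<close> concerns punctured neighbourhoods of \<open>0\<close>; the shift by \<open>0\<close> is trivial.\<close>
    have "\<forall>\<^sub>F s in at 0. weighted_sqnorm f (\<lambda>y. V (y + s) - V y) < ennreal e"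
      using Vs that unfolding weighted_sqnorm_def by (intro order_tendstoD(2)) auto
    then obtain d where d: "d > 0" "\<And>s. s \<noteq> 0 \<Longrightarrow> \<bar>s\<bar> < d \<Longrightarrow> weighted_sqnorm f (\<lambda>y. V (y + s) - V y) < ennreal e"
      unfolding eventually_at by (auto simp: dist_real_def)
    have "weighted_sqnorm f (\<lambda>y. V (y + t) - V y) \<le> ennreal e" if "\<bar>t\<bar> \<le> d/2" for t
    proof (cases "t = 0")
      case True
      then show ?thesis by (simp add: weighted_sqnorm_def)
    next
      case False
      then show ?thesis using d that by (intro less_imp_le d(2)) auto
    qed
    then show ?thesis using d(1) by (intro exI[of _ "d/2"]) auto
  qed
  interpret weighted_shift f V
    using f_meas f0 fint Vm V_shift sqF[OF Vm V2] by unfold_locales auto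

  have T_mem: "(\<lambda>y. g (y + t)) \<in> ?T" if "g \<in> G" "\<bar>t\<bar> \<le> \<eta>" for g t
    using that by (auto simp: shift_class_def)
  have GT: "G \<subseteq> ?T"
    using T_mem[of _ 0] \<eta> by auto
  have Tm: "u \<in> borel_measurable borel" and TV: "\<And>y. \<bar>u y\<bar> \<le> V y" if uT: "u \<in> ?T" for u
  proof -
    obtain g t where u: "u = (\<lambda>y. g (y + t))" "g \<in> G" using uT by (auto simp: shift_class_def)
    have [measurable]: "g \<in> borel_measurable borel" using Gm u(2) by auto
    show "u \<in> borel_measurable borel" unfolding u(1) by measurable
    show "\<And>y. \<bar>u y\<bar> \<le> V y" using env uT by (auto simp: envelope_def)
  qed
  have T2: "u \<in> borel_measurable F \<and> integrable F (\<lambda>y. (u y)\<^sup>2)" if "u \<in> ?T" for u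
    using dons that by (auto simp: donsker_def)
  have dT: "weighted_sqnorm f (\<lambda>y. u y - v y) = ennreal (\<integral>y. (u y - v y)\<^sup>2 \<partial>F)" if "u \<in> ?T" "v \<in> ?T" for u v
    using Tm T2 that by (intro sqF integral_square_diff(1) borel_measurable_diff) auto
  have mean: "\<bar>\<integral>y. u y \<partial>F\<bar> \<le> (\<integral>y. 1 + (V y)\<^sup>2 \<partial>F)" if u: "u \<in> ?T" for u
  proof (rule integral_abs_bound_integral)
    have le: "\<bar>u y\<bar> \<le> 1 + (V y)\<^sup>2" for y
      using TV[OF u, of y] zero_le_power2[of "V y - 1"] zero_le_power2[of "V y"]
      by (simp add: power2_eq_square algebra_simps)
    then show "\<And>y. \<bar>u y\<bar> \<le> 1 + (V y)\<^sup>2" .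
    show V1: "integrable F (\<lambda>y. 1 + (V y)\<^sup>2)" using V2 by simp
    show "integrable F u"
      using le T2[OF u] by (intro Bochner_Integration.integrable_bound[OF V1] AE_I2) (auto intro: order_trans[OF _ abs_ge_self])
  qed
  have mean_eq: "(\<integral>y. h y \<partial>F) = (\<integral>y. h y * f y \<partial>lborel)" if "h \<in> borel_measurable borel" for h :: "real \<Rightarrow> real"
    unfolding F using f_meas f0 that by (subst integral_density) (auto simp: mult.commute)

  obtain L where L: "tight_brownian_bridge_law F ?T L"
    and conv: "converges_weakly (\<Pi>\<^sub>M i\<in>(UNIV :: nat set). F) (linf ?T) (empirical_process F ?T (\<lambda>i x. x i)) L"
    using dons by (auto simp: donsker_def)
  define X where "X = empirical_process F ?T \<epsilon>"
  interpret PF: prob_space "\<Pi>\<^sub>M i\<in>(UNIV :: nat set). F"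
    by (intro prob_space_PiM PF)
  have X: "converges_weakly M (linf ?T) X L"
    using converges_weakly_distr[OF conv M.prob_space_axioms PF.prob_space_axioms
        M.distr_iid_sequence[OF ind law sF]]
    by (simp add: X_def empirical_process_def[abs_def])
  have X_eq: "X n \<omega> u = sqrt (real n) * ((1 / real n) * (\<Sum>i<n. u (\<epsilon> i \<omega>)) - (\<integral>y. u y * f y \<partial>lborel))"
    if "u \<in> ?T" for n \<omega> u
    using that mean_eq[OF Tm[OF that]] by (simp add: X_def empirical_process_def)

  \<comment> \<open>As \<open>b n ^ 4 \<le> n * b n ^ 4\<close>, the bandwidth tends to \<open>0\<close>.\<close>
  have b_small: "\<forall>\<^sub>F n in sequentially. b n < x" if x: "x > 0" for x
  proof -
    have "\<forall>\<^sub>F n in sequentially. real n * b n ^ 4 < x ^ 4"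
      using nb4 x by (intro order_tendstoD) auto
    then show ?thesis using eventually_ge_at_top[of 1]
    proof eventually_elim
      case (elim n)
      have "1 * b n ^ 4 \<le> real n * b n ^ 4" using elim(2) by (intro mult_right_mono) auto
      then have "b n ^ 4 < x ^ 4" using elim(1) by simp
      then show "b n < x" using x by (intro power_less_imp_less_base[of "b n" 4 x]) auto
    qed
  qed
  obtain s C where sC: "s > 0" "0 \<le> C" "\<And>t. \<bar>t\<bar> \<le> s \<Longrightarrow> weighted_sqnorm f (\<lambda>y. V (y + t)) \<le> ennreal C"
    using shift_norm_bounded by metis

  \<comment> \<open>The event that smoothing moves some empirical mean by more than \<open>e / \<surd>n\<close>.\<close>
  define Q where "Q e n = {\<omega>\<in>space M. \<exists>g\<in>G. e < sqrt (real n) *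
      \<bar>(\<integral>y. g y * kernel_estimator k b \<epsilon> n \<omega> y \<partial>lborel) - (1 / real n) * (\<Sum>i<n. g (\<epsilon> i \<omega>))\<bar>}" for e n
  have negligible: "(\<lambda>n. outer_measure_of M (Q e n)) \<longlonglongrightarrow> 0" if e: "e > 0" for e
  proof (rule order_tendstoI)
    fix a :: ennreal assume "0 < a"
    then obtain a' where a': "0 < a'" "ennreal a' < a"
      by (metis ennreal_0 ennreal_less_zero_iff dense ennreal_cases ennreal_less_top top.not_eq_extremum not_less_iff_gr_or_eq order_less_trans ennreal_less_iff)
    \<comment> \<open>Half of \<open>e\<close> is reserved for the bias.\<close>
    define e1 where "e1 = min (e/2) a'"
    have e1: "e1 > 0" "e1 \<le> e/2" "e1 \<le> a'" using e a' by (auto simp: e1_def)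
    obtain \<delta> where \<delta>: "\<delta> > 0" "\<forall>\<^sub>F n in sequentially. outer_measure_of M
       {\<omega>\<in>space M. \<exists>s\<in>?T. \<exists>t\<in>?T. (\<integral>x. (s x - t x)\<^sup>2 \<partial>F) \<le> \<delta> \<and> e1 < \<bar>X n \<omega> s - X n \<omega> t\<bar>} < ennreal e1"
      using converges_weakly_asymptotic_equicontinuity[OF M.prob_space_axioms X L T2 e1(1)] by blast
    have tb: "\<exists>G0. finite G0 \<and> G0 \<subseteq> ?T \<and> (\<forall>g\<in>?T. \<exists>g0\<in>G0. weighted_sqnorm f (\<lambda>y. g y - g0 y) \<le> ennreal e)"
      if e: "e > 0" for e
    proof -
      obtain T0 where "finite T0" "T0 \<subseteq> ?T" "\<And>s. s \<in> ?T \<Longrightarrow> \<exists>t\<in>T0. (\<integral>x. (s x - t x)\<^sup>2 \<partial>F) \<le> e"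
        using tight_brownian_bridge_totally_bounded[OF L T2 mean e] by blast
      then show ?thesis using dT by (intro exI[of _ T0]) (metis ennreal_leI subsetD)
    qed
    have "\<exists>\<delta>'>0. \<forall>g\<in>?T. \<forall>t. \<bar>t\<bar> \<le> \<delta>' \<longrightarrow> weighted_sqnorm f (\<lambda>y. g (y + t) - g y) \<le> ennreal \<delta>"
    proof (rule totally_bounded_shift_continuous[where G="?T" and e=\<delta>])
      show "u \<in> borel_measurable borel" if "u \<in> ?T" for u using that by (rule Tm)
      show "\<bar>u y\<bar> \<le> V y" if "u \<in> ?T" for u y using that by (rule TV)
      show "\<exists>G0. finite G0 \<and> G0 \<subseteq> ?T \<and> (\<forall>g\<in>?T. \<exists>g0\<in>G0. weighted_sqnorm f (\<lambda>y. g y - g0 y) \<le> ennreal e)"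
        if "e > 0" for e using that by (rule tb)
    qed (use \<delta>(1) in auto)
    then obtain \<delta>' where \<delta>': "\<delta>' > 0"
      "\<And>g t. g \<in> ?T \<Longrightarrow> \<bar>t\<bar> \<le> \<delta>' \<Longrightarrow> weighted_sqnorm f (\<lambda>y. g (y + t) - g y) \<le> ennreal \<delta>"
      by blast
    have "\<forall>\<^sub>F n in sequentially. (SUP g\<in>G. ennreal \<bar>sqrt (real n) *
            (\<integral>y. g y * (convolve f (scaled_kernel k (b n)) y - f y) \<partial>lborel)\<bar>) < ennreal (e/2)"
      using bias e by (intro order_tendstoD) auto
    then show "\<forall>\<^sub>F n in sequentially. outer_measure_of M (Q e n) < a"
      using \<delta>(2) b_small[OF \<delta>'(1)] b_small[OF \<eta>] b_small[OF sC(1)] eventually_ge_at_top[of 1]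
    proof eventually_elim
      case (elim n)
      have bn: "0 < b n" using bpos elim(6) by auto
      have sn: "sqrt (real n) > 0" using elim(6) by simp
      \<comment> \<open>If no pair of close indices has an increment above \<open>e1\<close>, then no shift by at most \<open>b n\<close> has one, and smoothing costs less than \<open>e1 + e/2\<close>.\<close>
      have "Q e n \<subseteq> {\<omega>\<in>space M. \<exists>s\<in>?T. \<exists>t\<in>?T. (\<integral>x. (s x - t x)\<^sup>2 \<partial>F) \<le> \<delta> \<and> e1 < \<bar>X n \<omega> s - X n \<omega> t\<bar>}"
        (is "_ \<subseteq> ?E")
      proof (rule subsetI, rule ccontr)
        fix \<omega> assume Q: "\<omega> \<in> Q e n" and nE: "\<omega> \<notin> ?E"
        then obtain g where \<omega>: "\<omega> \<in> space M" and g: "g \<in> G" and big: "e < sqrt (real n) *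
          \<bar>(\<integral>y. g y * kernel_estimator k b \<epsilon> n \<omega> y \<partial>lborel) - (1 / real n) * (\<Sum>i<n. g (\<epsilon> i \<omega>))\<bar>"
          by (auto simp: Q_def)
        have gT: "g \<in> ?T" using g GT by auto
        have shift: "\<bar>((1 / real n) * (\<Sum>i<n. g (\<epsilon> i \<omega> + t)) - (\<integral>y. g (y + t) * f y \<partial>lborel))
          - ((1 / real n) * (\<Sum>i<n. g (\<epsilon> i \<omega>)) - (\<integral>y. g y * f y \<partial>lborel))\<bar> \<le> e1 / sqrt (real n)"
          (is "\<bar>?A - ?B\<bar> \<le> _") if t: "\<bar>t\<bar> \<le> b n" for t
        proof -
          have tT: "(\<lambda>y. g (y + t)) \<in> ?T" using T_mem[OF g] t elim(4) by auto
          have "ennreal (\<integral>y. (g (y + t) - g y)\<^sup>2 \<partial>F) \<le> ennreal \<delta>"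
            using \<delta>'(2)[OF gT, of t] t elim(3) dT[OF tT gT] by simp
          then have "(\<integral>y. (g (y + t) - g y)\<^sup>2 \<partial>F) \<le> \<delta>" using \<delta>(1) by simp
          then have "\<bar>X n \<omega> (\<lambda>y. g (y + t)) - X n \<omega> g\<bar> \<le> e1"
            using nE \<omega> tT gT by fastforce
          moreover have "X n \<omega> (\<lambda>y. g (y + t)) - X n \<omega> g = sqrt (real n) * (?A - ?B)"
            unfolding X_eq[OF tT] X_eq[OF gT] by (simp only: right_diff_distrib)
          ultimately have "sqrt (real n) * \<bar>?A - ?B\<bar> \<le> e1" using sn by (simp add: abs_mult)
          then show ?thesis using sn by (simp add: field_simps)
        qed
        have "\<bar>(\<integral>y. g y * kernel_estimator k b \<epsilon> n \<omega> y \<partial>lborel) - (1 / real n) * (\<Sum>i<n. g (\<epsilon> i \<omega>))\<bar>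
          \<le> e1 / sqrt (real n) + \<bar>\<integral>y. g y * (convolve f (scaled_kernel k (b n)) y - f y) \<partial>lborel\<bar>"
          unfolding kernel_estimator_def
          by (rule smoothing_deviation[where x="\<lambda>i. \<epsilon> i \<omega>", OF f_pos k bn less_imp_le[OF elim(5)] sC(2,3) Tm[OF gT] TV[OF gT] shift])
        then have "sqrt (real n) * \<bar>(\<integral>y. g y * kernel_estimator k b \<epsilon> n \<omega> y \<partial>lborel) - (1 / real n) * (\<Sum>i<n. g (\<epsilon> i \<omega>))\<bar>
          \<le> sqrt (real n) * (e1 / sqrt (real n) + \<bar>\<integral>y. g y * (convolve f (scaled_kernel k (b n)) y - f y) \<partial>lborel\<bar>)"
          using sn by (intro mult_left_mono) auto
        also have "\<dots> = e1 + \<bar>sqrt (real n) * (\<integral>y. g y * (convolve f (scaled_kernel k (b n)) y - f y) \<partial>lborel)\<bar>"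
          using sn by (simp add: distrib_left abs_mult)
        also have "\<dots> < e/2 + e/2"
        proof (rule add_le_less_mono[OF e1(2)])
          have "ennreal \<bar>sqrt (real n) * (\<integral>y. g y * (convolve f (scaled_kernel k (b n)) y - f y) \<partial>lborel)\<bar> < ennreal (e/2)"
            by (rule le_less_trans[OF SUP_upper[OF g] elim(1)])
          then show "\<bar>sqrt (real n) * (\<integral>y. g y * (convolve f (scaled_kernel k (b n)) y - f y) \<partial>lborel)\<bar> < e/2"
            by (simp add: ennreal_less_iff)
        qed
        finally show False using big by simp
      qed
      then have "outer_measure_of M (Q e n) \<le> outer_measure_of M ?E" by (rule outer_measure_of_mono)
      also have "\<dots> < ennreal e1" by (rule elim(2))
      also have "\<dots> \<le> ennreal a'" using e1(3) by (rule ennreal_leI)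
      also have "\<dots> < a" by (rule a'(2))
      finally show ?case .
    qed
  qed auto

  have first: "little_o_p M
           (\<lambda>n \<omega>. SUP g\<in>G. ennreal \<bar>(\<integral>y. g y * kernel_estimator k b \<epsilon> n \<omega> y \<partial>lborel)
              - (1 / real n) * (\<Sum>i<n. g (\<epsilon> i \<omega>))\<bar>)
           (\<lambda>n. real n powr (- 1 / 2))"
    unfolding little_o_p_def
  proof (intro allI impI)
    fix e :: real assume e: "e > 0"
    have ev: "\<forall>\<^sub>F n in sequentially. outer_measure_of M {\<omega>\<in>space M. ennreal (e * real n powr (- 1 / 2)) <
        (SUP g\<in>G. ennreal \<bar>(\<integral>y. g y * kernel_estimator k b \<epsilon> n \<omega> y \<partial>lborel)
              - (1 / real n) * (\<Sum>i<n. g (\<epsilon> i \<omega>))\<bar>)} \<le> outer_measure_of M (Q e n)"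
      using eventually_ge_at_top[of 1]
    proof eventually_elim
      case (elim n)
      have sn: "sqrt (real n) > 0" using elim by simp
      have pw: "real n powr (- 1 / 2) = 1 / sqrt (real n)"
        using elim powr_half_sqrt[of "real n"] by (simp add: powr_minus_divide minus_divide_left[symmetric])
      show ?case
      proof (rule outer_measure_of_mono, rule subsetI)
        fix \<omega> assume \<omega>: "\<omega> \<in> {\<omega>\<in>space M. ennreal (e * real n powr (- 1 / 2)) <
          (SUP g\<in>G. ennreal \<bar>(\<integral>y. g y * kernel_estimator k b \<epsilon> n \<omega> y \<partial>lborel)
              - (1 / real n) * (\<Sum>i<n. g (\<epsilon> i \<omega>))\<bar>)}"
        then obtain g where g: "g \<in> G" "ennreal (e * real n powr (- 1 / 2)) <
          ennreal \<bar>(\<integral>y. g y * kernel_estimator k b \<epsilon> n \<omega> y \<partial>lborel) - (1 / real n) * (\<Sum>i<n. g (\<epsilon> i \<omega>))\<bar>"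
          by (auto simp: less_SUP_iff)
        then have "e * (1 / sqrt (real n)) < \<bar>(\<integral>y. g y * kernel_estimator k b \<epsilon> n \<omega> y \<partial>lborel) - (1 / real n) * (\<Sum>i<n. g (\<epsilon> i \<omega>))\<bar>"
          unfolding pw using e sn by (subst (asm) ennreal_less_iff) auto
        then show "\<omega> \<in> Q e n" using \<omega> g(1) sn by (auto simp: Q_def field_simps)
      qed
    qed
    show "(\<lambda>n. outer_measure_of M {\<omega>\<in>space M. ennreal (e * real n powr (- 1 / 2)) <
        (SUP g\<in>G. ennreal \<bar>(\<integral>y. g y * kernel_estimator k b \<epsilon> n \<omega> y \<partial>lborel)
              - (1 / real n) * (\<Sum>i<n. g (\<epsilon> i \<omega>))\<bar>)}) \<longlonglongrightarrow> 0"
      by (rule tendsto_sandwich[OF _ ev tendsto_const negligible[OF e]]) (intro always_eventually allI zero_le)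
  qed

  define Y where "Y n \<omega> = (\<lambda>g\<in>G. sqrt (real n) *
      (\<integral>y. g y * (kernel_estimator k b \<epsilon> n \<omega> y - f y) \<partial>lborel))" for n \<omega>
  \<comment> \<open>The limit of the empirical process on all shifts, seen from \<open>G\<close> only.\<close>
  define L' where "L' = distr L (metric_borel (linf G)) (\<lambda>z. restrict z G)"
  have bridge: "tight_brownian_bridge_law F G L'"
    unfolding L'_def by (rule tight_brownian_bridge_law_restrict[OF L GT])
  have sL: "sets L = sets (metric_borel (linf ?T))"
    using L by (simp add: tight_brownian_bridge_law_def tight_law_def)
  have XG: "converges_weakly M (linf G) (\<lambda>n \<omega>. restrict (X n \<omega>) G) L'"
    unfolding L'_def by (rule converges_weakly_continuous_map[OF X sL restrict_continuous_map_linf[OF GT]])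
  have Ym: "Y n \<omega> \<in> mspace (linf G)" for n \<omega>
  proof -
    have "\<exists>B. \<forall>g\<in>G. \<bar>sqrt (real n) * (\<integral>y. g y * (kernel_estimator k b \<epsilon> n \<omega> y - f y) \<partial>lborel)\<bar> \<le> B"
    proof (cases "n = 0")
      case False
      then have "b n > 0" using bpos by auto
      from smoothed_process_bounded[where b=b, OF f_pos k this, of G \<epsilon> \<omega>] Tm TV GT
      obtain B where "\<And>g. g \<in> G \<Longrightarrow> \<bar>\<integral>y. g y * (kernel_estimator k b \<epsilon> n \<omega> y - f y) \<partial>lborel\<bar> \<le> B" by blast
      then show ?thesis
        by (intro exI[of _ "sqrt (real n) * B"]) (auto simp: abs_mult intro!: mult_left_mono)
    qed auto
    then show ?thesis unfolding mspace_linf_iff Y_def by auto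
  qed
  have XGm: "restrict (X n \<omega>) G \<in> mspace (linf G)" if "\<omega> \<in> space M" for n \<omega>
    using XG that unfolding converges_weakly_def by blast
  have "converges_weakly M (linf G) Y L'"
  proof (rule converges_weakly_slutsky[OF M.prob_space_axioms XG _ Ym])
    show "tight_law (linf G) L'" using bridge by (simp add: tight_brownian_bridge_law_def)
    fix e :: real assume e: "e > 0"
    have le: "outer_measure_of M {\<omega>\<in>space M. e < mdist (linf G) (restrict (X n \<omega>) G) (Y n \<omega>)} \<le> outer_measure_of M (Q e n)" for n
    proof (rule outer_measure_of_mono, rule subsetI, rule ccontr)
      fix \<omega> assume \<omega>: "\<omega> \<in> {\<omega>\<in>space M. e < mdist (linf G) (restrict (X n \<omega>) G) (Y n \<omega>)}" and nQ: "\<omega> \<notin> Q e n"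
      have "mdist (linf G) (restrict (X n \<omega>) G) (Y n \<omega>) \<le> e"
      proof (rule mdist_linf_le[OF XGm Ym])
        fix g assume g: "g \<in> G"
        then have gT: "g \<in> ?T" using GT by auto
        have eq: "restrict (X n \<omega>) G g - Y n \<omega> g = - (sqrt (real n) *
          ((\<integral>y. g y * kernel_estimator k b \<epsilon> n \<omega> y \<partial>lborel) - (1 / real n) * (\<Sum>i<n. g (\<epsilon> i \<omega>))))"
        proof (cases "n = 0")
          case True
          then show ?thesis using g by (simp add: X_eq[OF gT] Y_def)
        next
          case False
          then have "b n > 0" using bpos by auto
          then have "integrable lborel (\<lambda>y. g y * kernel_estimator k b \<epsilon> n \<omega> y)"
            by (rule kernel_estimator_integrable[OF f_pos k _ Tm[OF gT] TV[OF gT]])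
          then show ?thesis
            using g density_integrable[OF Tm[OF gT] TV[OF gT]]
            by (simp add: X_eq[OF gT] Y_def right_diff_distrib)
        qed
        show "\<bar>restrict (X n \<omega>) G g - Y n \<omega> g\<bar> \<le> e"
          unfolding eq abs_minus_cancel abs_mult using nQ \<omega> g by (auto simp: Q_def not_less)
      qed (use \<omega> e in auto)
      then show False using \<omega> by auto
    qed
    show "(\<lambda>n. outer_measure_of M {\<omega>\<in>space M. e < mdist (linf G) (restrict (X n \<omega>) G) (Y n \<omega>)}) \<longlonglongrightarrow> 0"
      by (rule tendsto_sandwich[OF _ _ tendsto_const negligible[OF e]]; intro always_eventually allI zero_le le)
  qed
  then have second: "converges_weakly M (linf G) (\<lambda>n \<omega>. \<lambda>g\<in>G. sqrt (real n) *
                (\<integral>y. g y * (kernel_estimator k b \<epsilon> n \<omega> y - f y) \<partial>lborel)) L'"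
    unfolding Y_def .
  show ?thesis using first bridge second by blast
qed

end
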